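(* Let $\ell\ge2$ and let $\rho$ be a regular representation of ${\rm GL}_n(\mathfrak o_\ell)$. Then the restriction of $\rho$ to ${\rm SL}_n(\mathfrak o_\ell)$ is multiplicity free.
   Context: $\mathfrak o$ is the ring of integers of a non-archimedean local field with uniformizer $\varpi$ and residue field $\mathbb F_q$; $\mathfrak o_r=\mathfrak o/\varpi^r\mathfrak o$. Let $K_\ell^{\ell-1}=\ker({\rm GL}_n(\mathfrak o_\ell)\to{\rm GL}_n(\mathfrak o_{\ell-1}))=\{I+\varpi^{\ell-1}y\}$. Fix a character $\varphi$ of $(\mathfrak o_\ell,+)$ nontrivial on $\varpi^{\ell-1}\mathfrak o_\ell$; each $x\in M_n(\mathbb F_q)$ gives a character $\varphi_x(I+\varpi^{\ell-1}y)=\varphi(\varpi^{\ell-1}\mathrm{tr}(\hat xy))$ of $K_\ell^{\ell-1}$ ($\hat x$ any lift of $x$). $x\in M_n(\mathbb F_q)$ is regular if its characteristic polynomial equals its minimal polynomial. An irreducible representation of ${\rm GL}_n(\mathfrak o_\ell)$ is regular if its restriction to $K_\ell^{\ell-1}$ contains $\varphi_x$ for some regular $x$. *)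

theory Defs
  imports "Jordan_Normal_Form.Jordan_Normal_Form" "Jordan_Normal_Form.Char_Poly"
begin

definition trunc_dvr :: "'r::comm_ring_1 \<Rightarrow> nat \<Rightarrow> bool" where
  "trunc_dvr pw l \<longleftrightarrow> finite (UNIV :: 'r set) \<and> l \<ge> 1 \<and>
     pw ^ l = 0 \<and> pw ^ (l - 1) \<noteq> 0 \<and>
     (\<forall>a::'r. \<not> (a dvd 1) \<longleftrightarrow> pw dvd a)"

definition residue_map :: "'r::comm_ring_1 \<Rightarrow> ('r \<Rightarrow> 'k::field) \<Rightarrow> bool" where
  "residue_map pw \<pi> \<longleftrightarrow> \<pi> 0 = 0 \<and> \<pi> 1 = 1 \<and>
     (\<forall>a b. \<pi> (a + b) = \<pi> a + \<pi> b) \<and> (\<forall>a b. \<pi> (a * b) = \<pi> a * \<pi> b) \<and>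
     surj \<pi> \<and> (\<forall>a. \<pi> a = 0 \<longleftrightarrow> pw dvd a)"

definition GL :: "nat \<Rightarrow> 'r::comm_ring_1 mat set" where
  "GL n = {A \<in> carrier_mat n n. det A dvd 1}"

definition SL :: "nat \<Rightarrow> 'r::comm_ring_1 mat set" where
  "SL n = {A \<in> carrier_mat n n. det A = 1}"

definition poly_eval_mat :: "'a::comm_ring_1 poly \<Rightarrow> 'a mat \<Rightarrow> 'a mat" where
  "poly_eval_mat p A = mat (dim_row A) (dim_row A)
     (\<lambda>(i,j). \<Sum>k\<le>degree p. coeff p k * (A ^\<^sub>m k) $$ (i,j))"

definition is_minimal_poly :: "'a::field mat \<Rightarrow> 'a poly \<Rightarrow> bool" where
  "is_minimal_poly A p \<longleftrightarrow> monic p \<and> poly_eval_mat p A = 0\<^sub>m (dim_row A) (dim_row A) \<and>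
     (\<forall>q. q \<noteq> 0 \<longrightarrow> poly_eval_mat q A = 0\<^sub>m (dim_row A) (dim_row A) \<longrightarrow> degree p \<le> degree q)"

definition regular_mat :: "'a::field mat \<Rightarrow> bool" where
  "regular_mat A \<longleftrightarrow> is_minimal_poly A (char_poly A)"

definition is_rep :: "'r::comm_ring_1 mat set \<Rightarrow> nat \<Rightarrow> ('r mat \<Rightarrow> complex mat) \<Rightarrow> nat \<Rightarrow> bool" where
  "is_rep G n \<rho> d \<longleftrightarrow> (\<forall>g\<in>G. \<rho> g \<in> carrier_mat d d) \<and> \<rho> (1\<^sub>m n) = 1\<^sub>m d \<and>
     (\<forall>g\<in>G. \<forall>h\<in>G. \<rho> (g * h) = \<rho> g * \<rho> h)"

definition invariant_subspace :: "'r mat set \<Rightarrow> ('r mat \<Rightarrow> complex mat) \<Rightarrow> nat \<Rightarrow> complex vec set \<Rightarrow> bool" where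
  "invariant_subspace G \<rho> d W \<longleftrightarrow> W \<subseteq> carrier_vec d \<and> 0\<^sub>v d \<in> W \<and>
     (\<forall>v\<in>W. \<forall>w\<in>W. v + w \<in> W) \<and> (\<forall>c::complex. \<forall>v\<in>W. c \<cdot>\<^sub>v v \<in> W) \<and>
     (\<forall>g\<in>G. \<forall>v\<in>W. \<rho> g *\<^sub>v v \<in> W)"

definition irreducible_rep :: "'r::comm_ring_1 mat set \<Rightarrow> nat \<Rightarrow> ('r mat \<Rightarrow> complex mat) \<Rightarrow> nat \<Rightarrow> bool" where
  "irreducible_rep G n \<rho> d \<longleftrightarrow> is_rep G n \<rho> d \<and> d > 0 \<and>
     (\<forall>W. invariant_subspace G \<rho> d W \<longrightarrow> W = {0\<^sub>v d} \<or> W = carrier_vec d)"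

definition intertwiners :: "'r mat set \<Rightarrow> ('r mat \<Rightarrow> complex mat) \<Rightarrow> nat \<Rightarrow> ('r mat \<Rightarrow> complex mat) \<Rightarrow> nat \<Rightarrow> complex mat set" where
  "intertwiners H \<sigma> e \<rho> d = {T \<in> carrier_mat d e. \<forall>h\<in>H. T * \<sigma> h = \<rho> h * T}"

text \<open>The restriction of rho to H is multiplicity free: every irreducible
  representation sigma of H occurs with multiplicity dim Hom_H(sigma, rho) at most 1.\<close>
definition multiplicity_free_restriction :: "'r::comm_ring_1 mat set \<Rightarrow> nat \<Rightarrow> ('r mat \<Rightarrow> complex mat) \<Rightarrow> nat \<Rightarrow> bool" where
  "multiplicity_free_restriction H n \<rho> d \<longleftrightarrow>
     (\<forall>\<sigma> e. irreducible_rep H n \<sigma> e \<longrightarrow>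
        (\<forall>T1\<in>intertwiners H \<sigma> e \<rho> d. \<forall>T2\<in>intertwiners H \<sigma> e \<rho> d.
           \<exists>a b::complex. (a \<noteq> 0 \<or> b \<noteq> 0) \<and> a \<cdot>\<^sub>m T1 + b \<cdot>\<^sub>m T2 = 0\<^sub>m d e))"

definition mat_trace :: "'a::comm_ring_1 mat \<Rightarrow> 'a" where
  "mat_trace A = (\<Sum>i<dim_row A. A $$ (i,i))"


definition add_char :: "('r::comm_ring_1 \<Rightarrow> complex) \<Rightarrow> bool" where
  "add_char \<phi> \<longleftrightarrow> \<phi> 0 = 1 \<and> (\<forall>a b. \<phi> (a + b) = \<phi> a * \<phi> b)"

text \<open>rho restricted to K^(ell-1) = {I + varpi^(ell-1) y} contains phi_x, where x is
  the reduction of the lift xh, phi_x(I + varpi^(ell-1) y) = phi(varpi^(ell-1) tr(xh y)).\<close>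
definition contains_phi_x :: "'r::comm_ring_1 \<Rightarrow> nat \<Rightarrow> ('r \<Rightarrow> complex) \<Rightarrow> nat \<Rightarrow>
     ('r mat \<Rightarrow> complex mat) \<Rightarrow> nat \<Rightarrow> 'r mat \<Rightarrow> bool" where
  "contains_phi_x pw l \<phi> n \<rho> d xh \<longleftrightarrow>
     (\<exists>v\<in>carrier_vec d. v \<noteq> 0\<^sub>v d \<and>
        (\<forall>y\<in>carrier_mat n n.
           \<rho> (1\<^sub>m n + (pw ^ (l - 1)) \<cdot>\<^sub>m y) *\<^sub>v v = \<phi> (pw ^ (l - 1) * mat_trace (xh * y)) \<cdot>\<^sub>v v))"

definition regular_rep :: "'r::comm_ring_1 \<Rightarrow> nat \<Rightarrow> ('r \<Rightarrow> 'k::field) \<Rightarrow> ('r \<Rightarrow> complex) \<Rightarrow> nat \<Rightarrow>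
     ('r mat \<Rightarrow> complex mat) \<Rightarrow> nat \<Rightarrow> bool" where
  "regular_rep pw l \<pi> \<phi> n \<rho> d \<longleftrightarrow> irreducible_rep (GL n) n \<rho> d \<and>
     (\<exists>xh\<in>carrier_mat n n. regular_mat (map_mat \<pi> xh) \<and> contains_phi_x pw l \<phi> n \<rho> d xh)"

end

theory Submission
  imports Defs "Jordan_Normal_Form.Schur_Decomposition"
begin

text \<open>
  Let \<open>p\<close> be the uniformizer, \<open>r = l div 2\<close>, \<open>m = l - r\<close>, and let \<open>U\<close> be the group of upper
  unitriangular matrices. Since \<open>U\<close> lies in \<open>SL\<close>, it suffices that a nondegenerate character of \<open>U\<close>
  occurs in \<open>\<rho>\<close> exactly once: the projection to its isotypic part is an element of the group algebra
  of \<open>SL\<close> that acts with rank one, and \<open>SL\<close> is normal.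

  Regularity gives a cyclic vector, so that \<open>\<rho>\<close>, restricted to the abelian group \<open>1 + p\<^sup>m y\<close>, contains
  the character \<open>y \<mapsto> \<phi> (p\<^sup>m tr (X y))\<close> of a companion matrix \<open>X\<close>. The characters of this group that are
  compatible with the one of \<open>U\<close> come from matrices with subdiagonal \<open>1\<close> and zeros below it; each of
  them is conjugate under \<open>U\<close> to a companion matrix. This reduces the claim to the multiplicity of
  the character \<open>1 + p\<^sup>r \<nu> + p\<^sup>m y \<mapsto> \<phi> (p\<^sup>r tr (X \<nu>) + p\<^sup>m tr (X y))\<close>, where \<open>\<nu>\<close> is strictly upper
  triangular. Let \<open>E\<close> be its projection. The symmetric Hankel matrix \<open>S\<close> with \<open>S X = X\<^sup>T S\<close> defines an
  anti-involution \<open>\<tau> g = S\<inverse> g\<^sup>T S\<close> that fixes the centralizer of \<open>X\<close>, preserves the strictly upper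
  triangular matrices, and satisfies \<open>E \<rho>(\<tau> g) E = E \<rho>(g) E\<close>. By Gelfand's trick the operators
  \<open>E \<rho>(g) E\<close> commute, and Schur's lemma shows that \<open>E\<close> has rank one.
\<close>

lemma finite_carrier_mat:
  assumes "finite (UNIV :: 'a set)"
  shows "finite (carrier_mat nr nc :: 'a mat set)"
proof -
  have "(carrier_mat nr nc :: 'a mat set) \<subseteq> mat nr nc ` (PiE ({..<nr} \<times> {..<nc}) (\<lambda>_. UNIV))"
  proof
    fix A :: "'a mat" assume A: "A \<in> carrier_mat nr nc"
    then have "A = mat nr nc (restrict (\<lambda>ij. A $$ ij) ({..<nr} \<times> {..<nc}))"
      by (intro eq_matI) auto
    then show "A \<in> mat nr nc ` (PiE ({..<nr} \<times> {..<nc}) (\<lambda>_. UNIV))"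
      by (intro image_eqI[of _ _ "restrict (\<lambda>ij. A $$ ij) ({..<nr} \<times> {..<nc})"]) auto
  qed
  then show ?thesis
    by (rule finite_subset) (intro finite_imageI finite_PiE; simp add: assms)
qed

lemma smult_smult_mat: "a \<cdot>\<^sub>m (b \<cdot>\<^sub>m A) = (a * b :: 'a :: comm_ring_1) \<cdot>\<^sub>m A"
  by (rule eq_matI) (auto simp: mult.assoc)

lemma one_smult_mat [simp]: "(1 :: 'a :: comm_ring_1) \<cdot>\<^sub>m A = A"
  by (rule eq_matI) auto

lemma zero_smult_mat: "A \<in> carrier_mat nr nc \<Longrightarrow> (0 :: 'a :: comm_ring_1) \<cdot>\<^sub>m A = 0\<^sub>m nr nc"
  by (rule eq_matI) auto

lemma smult_zero_mat [simp]: "(a :: 'a :: comm_ring_1) \<cdot>\<^sub>m 0\<^sub>m nr nc = 0\<^sub>m nr nc"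
  by (rule eq_matI) auto

lemma smult_diff_mat:
  "A \<in> carrier_mat nr nc \<Longrightarrow> B \<in> carrier_mat nr nc \<Longrightarrow>
    (a :: 'a :: comm_ring_1) \<cdot>\<^sub>m (A - B) = a \<cdot>\<^sub>m A - a \<cdot>\<^sub>m B"
  by (rule eq_matI) (auto simp: right_diff_distrib)

lemma index_mult_sum:
  assumes "A \<in> carrier_mat nr n" "B \<in> carrier_mat n nc" "i < nr" "j < nc"
  shows "(A * B) $$ (i, j) = (\<Sum>k<n. A $$ (i, k) * (B $$ (k, j) :: 'a :: comm_ring_1))"
  using assms by (auto simp: scalar_prod_def lessThan_atLeast0 intro!: sum.cong)

lemma index_mult_vec_sum:
  assumes "A \<in> carrier_mat nr n" "v \<in> carrier_vec n" "i < nr"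
  shows "(A *\<^sub>v v) $ i = (\<Sum>k<n. A $$ (i, k) * (v $ k :: 'a :: comm_ring_1))"
  using assms by (auto simp: scalar_prod_def lessThan_atLeast0 intro!: sum.cong)

subsection \<open>Sums of matrices\<close>

definition msum :: "nat \<Rightarrow> ('b \<Rightarrow> 'a :: comm_ring_1 mat) \<Rightarrow> 'b set \<Rightarrow> 'a mat" where
  "msum d f I = mat d d (\<lambda>ij. \<Sum>x\<in>I. f x $$ ij)"

lemma msum_carrier [simp]: "msum d f I \<in> carrier_mat d d"
  by (simp add: msum_def)

lemma msum_dim [simp]: "dim_row (msum d f I) = d" "dim_col (msum d f I) = d"
  by (simp_all add: msum_def)

lemma msum_index [simp]:
  "i < d \<Longrightarrow> j < d \<Longrightarrow> msum d f I $$ (i, j) = (\<Sum>x\<in>I. f x $$ (i, j))"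
  by (simp add: msum_def)

lemma msum_cong: "(\<And>x. x \<in> I \<Longrightarrow> f x = g x) \<Longrightarrow> msum d f I = msum d g I"
  by (simp add: msum_def cong: sum.cong)

lemma mult_msum:
  assumes "A \<in> carrier_mat d d" "\<And>x. x \<in> I \<Longrightarrow> f x \<in> carrier_mat d d"
  shows "A * msum d f I = msum d (\<lambda>x. A * f x) I"
proof (rule eq_matI)
  fix i j assume "i < dim_row (msum d (\<lambda>x. A * f x) I)" "j < dim_col (msum d (\<lambda>x. A * f x) I)"
  then have ij: "i < d" "j < d" by auto
  have "(A * msum d f I) $$ (i, j) = (\<Sum>k<d. A $$ (i, k) * (\<Sum>x\<in>I. f x $$ (k, j)))"
    using ij assms by (subst index_mult_sum[of _ d d _ d]) auto
  also have "\<dots> = (\<Sum>x\<in>I. \<Sum>k<d. A $$ (i, k) * f x $$ (k, j))"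
    by (subst sum.swap) (simp add: sum_distrib_left)
  also have "\<dots> = (\<Sum>x\<in>I. (A * f x) $$ (i, j))"
    using ij assms by (intro sum.cong refl, subst index_mult_sum[of _ d d _ d]) auto
  finally show "(A * msum d f I) $$ (i, j) = msum d (\<lambda>x. A * f x) I $$ (i, j)"
    using ij by simp
qed (use assms in auto)

lemma msum_mult:
  assumes "A \<in> carrier_mat d d" "\<And>x. x \<in> I \<Longrightarrow> f x \<in> carrier_mat d d"
  shows "msum d f I * A = msum d (\<lambda>x. f x * A) I"
proof (rule eq_matI)
  fix i j assume "i < dim_row (msum d (\<lambda>x. f x * A) I)" "j < dim_col (msum d (\<lambda>x. f x * A) I)"
  then have ij: "i < d" "j < d" by auto
  have "(msum d f I * A) $$ (i, j) = (\<Sum>k<d. (\<Sum>x\<in>I. f x $$ (i, k)) * A $$ (k, j))"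
    using ij assms by (subst index_mult_sum[of _ d d _ d]) auto
  also have "\<dots> = (\<Sum>x\<in>I. \<Sum>k<d. f x $$ (i, k) * A $$ (k, j))"
    by (subst sum.swap) (simp add: sum_distrib_right)
  also have "\<dots> = (\<Sum>x\<in>I. (f x * A) $$ (i, j))"
    using ij assms by (intro sum.cong refl, subst index_mult_sum[of _ d d _ d]) auto
  finally show "(msum d f I * A) $$ (i, j) = msum d (\<lambda>x. f x * A) I $$ (i, j)"
    using ij by simp
qed (use assms in auto)

lemma smult_msum:
  assumes "\<And>x. x \<in> I \<Longrightarrow> f x \<in> carrier_mat d d"
  shows "a \<cdot>\<^sub>m msum d f I = msum d (\<lambda>x. a \<cdot>\<^sub>m f x) I"
proof (rule eq_matI, goal_cases)
  case (1 i j)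
  have "f x $$ (i,j) * a = (a \<cdot>\<^sub>m f x) $$ (i,j)" if "x \<in> I" for x
    using assms[OF that] 1 by (auto simp: mult.commute)
  then show ?case using 1 by (auto simp: sum_distrib_left mult.commute intro!: sum.cong)
qed auto

lemma msum_reindex:
  assumes "bij_betw h I J"
  shows "msum d f J = msum d (\<lambda>x. f (h x)) I"
proof (rule eq_matI, goal_cases)
  case (1 i j)
  then show ?case by (simp add: sum.reindex_bij_betw[OF assms, of "\<lambda>x. f x $$ (i, j)", symmetric])
qed auto

lemma msum_const_dir:
  assumes "A \<in> carrier_mat d d" "\<And>x. x \<in> I \<Longrightarrow> f x = c x \<cdot>\<^sub>m A"
  shows "msum d f I = (\<Sum>x\<in>I. c x) \<cdot>\<^sub>m A"
proof (rule eq_matI, goal_cases)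
  case (1 i j)
  have "f x $$ (i,j) = c x * A $$ (i,j)" if "x \<in> I" for x
    using assms(1) assms(2)[OF that] 1 by auto
  then show ?case using assms(1) 1 by (auto simp: sum_distrib_right)
qed (use assms in auto)

lemma msum_swap: "msum d (\<lambda>x. msum d (f x) J) I = msum d (\<lambda>y. msum d (\<lambda>x. f x y) I) J"
  by (rule eq_matI) (auto intro: sum.swap)

lemma msum_Times:
  "msum d f (I \<times> J) = msum d (\<lambda>x. msum d (\<lambda>y. f (x, y)) J) I"
  by (rule eq_matI) (auto simp: sum.cartesian_product)

lemma msum_zero:
  assumes "\<And>x. x \<in> I \<Longrightarrow> f x = 0\<^sub>m d d"
  shows "msum d f I = 0\<^sub>m d d"
  by (rule eq_matI) (auto simp: assms)

lemma msum_mult_vec: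
  assumes "v \<in> carrier_vec d" "\<And>x. x \<in> I \<Longrightarrow> f x \<in> carrier_mat d d" "i < d"
  shows "(msum d f I *\<^sub>v v) $ i = (\<Sum>x\<in>I. (f x *\<^sub>v v) $ i)"
proof -
  have "(msum d f I *\<^sub>v v) $ i = (\<Sum>k<d. \<Sum>x\<in>I. f x $$ (i, k) * v $ k)"
    using assms by (subst index_mult_vec_sum[of _ d d]) (auto simp: sum_distrib_right)
  also have "\<dots> = (\<Sum>x\<in>I. \<Sum>k<d. f x $$ (i, k) * v $ k)"
    by (rule sum.swap)
  also have "\<dots> = (\<Sum>x\<in>I. (f x *\<^sub>v v) $ i)"
    using assms by (intro sum.cong refl, subst index_mult_vec_sum[of _ d d]) auto
  finally show ?thesis .
qed

lemma msum_mult_vec_line: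
  assumes "v \<in> carrier_vec d" "w \<in> carrier_vec d" "\<And>x. x \<in> I \<Longrightarrow> f x \<in> carrier_mat d d"
    and "\<And>x. x \<in> I \<Longrightarrow> f x *\<^sub>v v = c x \<cdot>\<^sub>v w"
  shows "msum d f I *\<^sub>v v = (\<Sum>x\<in>I. c x) \<cdot>\<^sub>v w"
proof (rule eq_vecI, goal_cases)
  case (1 i)
  then show ?case using assms
    by (subst msum_mult_vec) (auto simp: sum_distrib_right)
qed (use assms in auto)

subsection \<open>Traces\<close>

lemma mat_trace_add:
  "A \<in> carrier_mat n n \<Longrightarrow> B \<in> carrier_mat n n \<Longrightarrow> mat_trace (A + B) = mat_trace A + mat_trace B"
  by (auto simp: mat_trace_def sum.distrib)

lemma mat_trace_diff:
  "A \<in> carrier_mat n n \<Longrightarrow> B \<in> carrier_mat n n \<Longrightarrow> mat_trace (A - B) = mat_trace A - mat_trace B"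
  by (auto simp: mat_trace_def sum_subtractf)

lemma mat_trace_smult:
  "A \<in> carrier_mat n n \<Longrightarrow> mat_trace (a \<cdot>\<^sub>m A) = a * mat_trace A"
  by (auto simp: mat_trace_def sum_distrib_left)

lemma mat_trace_mult_sum:
  assumes "A \<in> carrier_mat n n" "B \<in> carrier_mat n n"
  shows "mat_trace (A * B) = (\<Sum>i<n. \<Sum>k<n. A $$ (i, k) * B $$ (k, i))"
  unfolding mat_trace_def using assms
  by (intro sum.cong) (auto simp: index_mult_sum[of _ n n _ n] simp del: index_mult_mat(1))

lemma mat_trace_comm:
  assumes "A \<in> carrier_mat n n" "B \<in> carrier_mat n n"
  shows "mat_trace (A * B) = mat_trace (B * A)"
  unfolding mat_trace_mult_sum[OF assms] mat_trace_mult_sum[OF assms(2,1)]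
  by (subst sum.swap) (simp add: mult.commute)

lemma mat_trace_transpose: "A \<in> carrier_mat n n \<Longrightarrow> mat_trace (A\<^sup>T) = mat_trace A"
  by (auto simp: mat_trace_def)

definition entry_mat :: "nat \<Rightarrow> nat \<Rightarrow> nat \<Rightarrow> 'a \<Rightarrow> 'a :: comm_ring_1 mat" where
  "entry_mat n i j t = mat n n (\<lambda>p. if p = (i, j) then t else 0)"

lemma entry_mat_carrier [simp]: "entry_mat n i j t \<in> carrier_mat n n"
  by (simp add: entry_mat_def)

lemma entry_mat_dim [simp]: "dim_row (entry_mat n i j t) = n" "dim_col (entry_mat n i j t) = n"
  by (simp_all add: entry_mat_def)

lemma mat_trace_entry_mat:
  assumes "z \<in> carrier_mat n n" "i < n" "j < n"
  shows "mat_trace (z * entry_mat n i j t) = z $$ (j, i) * t"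
proof -
  have "mat_trace (z * entry_mat n i j t) =
      (\<Sum>a<n. \<Sum>k<n. z $$ (a, k) * (if k = i \<and> a = j then t else 0))"
    by (subst mat_trace_mult_sum) (use assms in \<open>auto simp: entry_mat_def intro!: sum.cong\<close>)
  also have "\<dots> = (\<Sum>a<n. \<Sum>k<n. if k = i then (if a = j then z $$ (a, k) * t else 0) else 0)"
    by (intro sum.cong) auto
  also have "\<dots> = z $$ (j, i) * t"
    using assms by (simp add: sum.delta)
  finally show ?thesis .
qed

subsection \<open>Character sums and orthogonal complements\<close>

lemma sum_eq_0_if_equivariant:
  fixes \<chi> :: "'a \<Rightarrow> complex"
  assumes "finite S" "inj_on f S" "f ` S \<subseteq> S" "\<And>x. x \<in> S \<Longrightarrow> \<chi> (f x) = \<zeta> * \<chi> x" "\<zeta> \<noteq> 1"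
  shows "sum \<chi> S = 0"
proof -
  have "bij_betw f S S"
    using assms(1-3) by (simp add: bij_betw_def endo_inj_surj)
  then have "sum \<chi> S = (\<Sum>x\<in>S. \<chi> (f x))"
    by (rule sum.reindex_bij_betw[symmetric])
  also have "\<dots> = \<zeta> * sum \<chi> S"
    by (simp add: assms(4) sum_distrib_left)
  finally show ?thesis using assms(5) by simp
qed

lemma orthogonal_complement_involutive:
  fixes \<beta> :: "'a \<Rightarrow> 'a \<Rightarrow> complex" and add :: "'a \<Rightarrow> 'a \<Rightarrow> 'a"
  assumes fin: "finite A"
    and closed: "\<And>x y. x \<in> A \<Longrightarrow> y \<in> A \<Longrightarrow> add x y \<in> A"
    and inj: "\<And>x. x \<in> A \<Longrightarrow> inj_on (add x) A"
    and addl: "\<And>x y b. x \<in> A \<Longrightarrow> y \<in> A \<Longrightarrow> b \<in> A \<Longrightarrow> \<beta> (add x y) b = \<beta> x b * \<beta> y b"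
    and addr: "\<And>x y b. x \<in> A \<Longrightarrow> y \<in> A \<Longrightarrow> b \<in> A \<Longrightarrow> \<beta> b (add x y) = \<beta> b x * \<beta> b y"
    and z: "z \<in> A" "\<And>a. a \<in> A \<Longrightarrow> \<beta> a z = 1"
    and S: "S \<subseteq> A" "\<And>x y. x \<in> S \<Longrightarrow> y \<in> S \<Longrightarrow> add x y \<in> S"
    and rad: "\<And>a. a \<in> A \<Longrightarrow> (\<And>b. b \<in> A \<Longrightarrow> \<beta> a b = 1) \<Longrightarrow> a \<in> S"
    and a: "a \<in> A" "\<And>b. b \<in> A \<Longrightarrow> (\<And>s. s \<in> S \<Longrightarrow> \<beta> s b = 1) \<Longrightarrow> \<beta> a b = 1"
  shows "a \<in> S"
proof -
  define R where "R = {a \<in> A. \<forall>b\<in>A. \<beta> a b = 1}"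
  define perp where "perp T = {b \<in> A. \<forall>s\<in>T. \<beta> s b = 1}" for T
  have count: "card T * card (perp T) = card R * card A"
    if T: "T \<subseteq> A" "\<And>x y. x \<in> T \<Longrightarrow> y \<in> T \<Longrightarrow> add x y \<in> T" "R \<subseteq> T" for T
  proof -
    have finT: "finite T" using T(1) fin by (rule finite_subset)
    have 1: "(\<Sum>s\<in>T. \<beta> s b) = (if b \<in> perp T then of_nat (card T) else 0)" if b: "b \<in> A" for b
    proof (cases "b \<in> perp T")
      case True then show ?thesis by (simp add: perp_def)
    next
      case False
      then obtain s where s: "s \<in> T" "\<beta> s b \<noteq> 1" using b by (auto simp: perp_def)
      have "(\<Sum>s\<in>T. \<beta> s b) = 0"
      proof (rule sum_eq_0_if_equivariant[OF finT])
        show "inj_on (add s) T" using s T(1) by (intro inj_on_subset[OF inj T(1)]) auto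
        show "add s ` T \<subseteq> T" using s T(2) by blast
        show "\<beta> (add s x) b = \<beta> s b * \<beta> x b" if "x \<in> T" for x
          using s T(1) b that by (intro addl) auto
      qed (rule s)
      then show ?thesis using False by simp
    qed
    have 2: "(\<Sum>b\<in>A. \<beta> s b) = (if s \<in> R then of_nat (card A) else 0)" if s: "s \<in> A" for s
    proof (cases "s \<in> R")
      case True then show ?thesis by (simp add: R_def)
    next
      case False
      then obtain b where b: "b \<in> A" "\<beta> s b \<noteq> 1" using s by (auto simp: R_def)
      have "(\<Sum>b\<in>A. \<beta> s b) = 0"
        by (rule sum_eq_0_if_equivariant[of _ "add b" _ "\<beta> s b"])
          (use s b fin inj addr closed in auto)
      then show ?thesis using False by simp
    qed
    have "of_nat (card T * card (perp T)) = (\<Sum>b\<in>A. \<Sum>s\<in>T. \<beta> s b)"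
    proof -
      have "{b \<in> A. b \<in> perp T} = perp T" by (auto simp: perp_def)
      then show ?thesis using fin by (simp add: 1 flip: sum.inter_filter)
    qed
    also have "\<dots> = (\<Sum>s\<in>T. \<Sum>b\<in>A. \<beta> s b)"
      by (rule sum.swap)
    also have "\<dots> = of_nat (card R * card A)"
    proof -
      have "{s \<in> T. s \<in> R} = R" using T(3) by auto
      moreover have "(\<Sum>s\<in>T. \<Sum>b\<in>A. \<beta> s b) = (\<Sum>s\<in>T. if s \<in> R then of_nat (card A) else 0)"
        using T(1) by (intro sum.cong) (auto simp: 2)
      ultimately show ?thesis using finT by (simp flip: sum.inter_filter)
    qed
    finally show ?thesis by (simp only: of_nat_eq_iff)
  qed
  define S' where "S' = {a \<in> A. \<forall>b\<in>perp S. \<beta> a b = 1}"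
  have SS': "S \<subseteq> S'" using S by (auto simp: S'_def perp_def)
  have RS: "R \<subseteq> S" using rad by (auto simp: R_def)
  have "perp S' = perp S" using SS' by (auto simp: S'_def perp_def)
  moreover have "card S' * card (perp S') = card R * card A"
    using SS' RS closed addl by (intro count) (auto simp: S'_def perp_def)
  moreover have "card S * card (perp S) = card R * card A"
    using S RS by (intro count)
  moreover have "z \<in> perp S" using z S by (auto simp: perp_def)
  moreover have "finite (perp S)" using fin by (auto simp: perp_def)
  ultimately have "card S' = card S"
    by (metis card_eq_0_iff empty_iff mult_right_cancel)
  then have "S = S'"
    using SS' fin by (intro card_subset_eq) (auto simp: S'_def)
  moreover have "a \<in> S'" using a by (auto simp: S'_def perp_def)
  ultimately show ?thesis by simp
qed

subsection \<open>Truncated discrete valuation rings\<close>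

locale trunc_dvr_char =
  fixes pw :: "'r :: comm_ring_1" and l :: nat and \<phi> :: "'r \<Rightarrow> complex"
  assumes dvr: "trunc_dvr pw l" and l2: "l \<ge> 2"
    and add_char: "add_char \<phi>" and nontriv: "\<exists>a. \<phi> (pw ^ (l - 1) * a) \<noteq> 1"
begin

definition "r = l div 2"
definition "m = l - r"

lemma r_m: "1 \<le> r" "r \<le> m" "m \<le> 2 * r" "m + r = l" "l \<le> 2 * m" "l \<le> 3 * r" "1 \<le> m" "m \<le> l - 1" "r \<le> l" "m \<le> l"
  using l2 by (auto simp: r_def m_def)

lemma finite_ring: "finite (UNIV :: 'r set)"
  using dvr by (simp add: trunc_dvr_def)

lemma finite_mats [simp]: "finite (carrier_mat nr nc :: 'r mat set)"
  by (rule finite_carrier_mat[OF finite_ring])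

lemma pw_power_0: "k \<ge> l \<Longrightarrow> pw ^ k = 0"
  using dvr power_add[of pw l "k - l"] by (simp add: trunc_dvr_def)

lemma pw_dvd_or_unit: "pw dvd a \<or> a dvd 1"
  using dvr by (auto simp: trunc_dvr_def)

lemma pw_annihilator:
  assumes "k \<le> l" "pw ^ k * a = 0"
  shows "pw ^ (l - k) dvd a"
proof -
  have "j \<le> l - k \<Longrightarrow> pw ^ j dvd a" for j
  proof (induction j)
    case (Suc j)
    then obtain b where b: "a = pw ^ j * b" by (auto elim: dvdE)
    have "\<not> b dvd 1"
    proof
      assume "b dvd 1"
      then obtain c where c: "b * c = 1" by (metis dvdE)
      have "pw ^ (k + j) = pw ^ k * a * c" using c by (simp add: b power_add mult.assoc)
      then have "pw ^ (k + j) = 0" using assms by simp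
      moreover have "pw ^ (l - 1) = pw ^ (k + j) * pw ^ (l - 1 - (k + j))"
        using Suc.prems by (simp flip: power_add)
      ultimately have "pw ^ (l - 1) = 0" by simp
      then show False using dvr by (simp add: trunc_dvr_def)
    qed
    then have "pw dvd b" using pw_dvd_or_unit by blast
    then have "pw ^ j * pw dvd pw ^ j * b" by (rule mult_dvd_mono[OF dvd_refl])
    then show ?case unfolding b by (simp only: power_Suc2)
  qed simp
  then show ?thesis by blast
qed

lemma \<phi>_0 [simp]: "\<phi> 0 = 1" and \<phi>_add: "\<phi> (a + b) = \<phi> a * \<phi> b"
  using add_char by (auto simp: add_char_def)

lemma \<phi>_minus: "\<phi> (- a) * \<phi> a = 1" "\<phi> a * \<phi> (- a) = 1"
  by (simp_all flip: \<phi>_add)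

lemma \<phi>_nonzero [simp]: "\<phi> a \<noteq> 0"
  using \<phi>_minus(1)[of a] by auto

lemma \<phi>_eq_iff: "\<phi> a = \<phi> b \<longleftrightarrow> \<phi> (a - b) = 1"
  using \<phi>_add[of "a - b" b] by (metis diff_add_cancel mult_cancel_right1 \<phi>_nonzero)

lemma \<phi>_nondegenerate:
  assumes "\<And>t. \<phi> (a * t) = 1"
  shows "a = 0"
proof (rule ccontr)
  assume "a \<noteq> 0"
  then have "\<not> pw ^ l dvd a" using dvr by (auto simp: trunc_dvr_def)
  then have "\<exists>k. \<not> pw ^ k dvd a" by blast
  define k where "k = (LEAST k. \<not> pw ^ k dvd a)"
  have k: "\<not> pw ^ k dvd a" unfolding k_def using \<open>\<exists>k. \<not> pw ^ k dvd a\<close> by (rule LeastI_ex)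
  have kl: "k \<le> l" unfolding k_def using \<open>\<not> pw ^ l dvd a\<close> by (rule Least_le)
  have k0: "k \<noteq> 0" using k by (cases k) auto
  then have "pw ^ (k - 1) dvd a" using not_less_Least[of "k - 1" "\<lambda>k. \<not> pw ^ k dvd a"]
    unfolding k_def by auto
  then obtain b where b: "a = pw ^ (k - 1) * b" by (auto elim: dvdE)
  have "\<not> pw dvd b"
  proof
    assume "pw dvd b"
    then have "pw ^ (k - 1) * pw dvd a" unfolding b by (intro mult_dvd_mono) auto
    then show False using k k0 by (simp add: power_eq_if[of pw k] mult.commute)
  qed
  then obtain c where c: "b * c = 1" using pw_dvd_or_unit by (metis dvdE)
  obtain s where s: "\<phi> (pw ^ (l - 1) * s) \<noteq> 1" using nontriv by blast
  have "a * (c * pw ^ (l - k) * s) = pw ^ (k - 1) * pw ^ (l - k) * s * (b * c)"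
    by (simp add: b algebra_simps)
  also have "pw ^ (k - 1) * pw ^ (l - k) = pw ^ (l - 1)"
    using k0 kl by (simp flip: power_add)
  finally show False using s assms[of "c * pw ^ (l - k) * s"] c by simp
qed

lemma trace_nondegenerate:
  assumes z: "z \<in> carrier_mat n n" and h: "\<And>y. y \<in> carrier_mat n n \<Longrightarrow> \<phi> (\<kappa> * mat_trace (z * y)) = 1"
  shows "\<kappa> \<cdot>\<^sub>m z = 0\<^sub>m n n"
proof (rule eq_matI, goal_cases)
  case (1 i j)
  have "\<phi> (\<kappa> * z $$ (i, j) * t) = 1" for t
    using h[of "entry_mat n j i t"] 1 z by (simp add: mat_trace_entry_mat mult.assoc)
  then have "\<kappa> * z $$ (i, j) = 0" by (rule \<phi>_nondegenerate)
  then show ?case using 1 z by simp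
qed (use z in auto)

lemma pw_smult_eq_0D:
  assumes "z \<in> carrier_mat n n'" "pw ^ k \<cdot>\<^sub>m z = 0\<^sub>m n n'" "k \<le> l"
  shows "\<exists>y\<in>carrier_mat n n'. z = pw ^ (l - k) \<cdot>\<^sub>m y \<and> (\<forall>i<n. \<forall>j<n'. z $$ (i, j) = 0 \<longrightarrow> y $$ (i, j) = 0)"
proof -
  have ex: "\<exists>b. z $$ (i, j) = pw ^ (l - k) * b \<and> (z $$ (i, j) = 0 \<longrightarrow> b = 0)" if ij: "i < n" "j < n'" for i j
  proof (cases "z $$ (i, j) = 0")
    case False
    have "(pw ^ k \<cdot>\<^sub>m z) $$ (i, j) = 0" using ij assms(2) by simp
    then have "pw ^ k * z $$ (i, j) = 0" using ij assms(1) by simp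
    then have "pw ^ (l - k) dvd z $$ (i, j)" by (rule pw_annihilator[OF assms(3)])
    then obtain b where "z $$ (i, j) = pw ^ (l - k) * b" by (elim dvdE)
    with False show ?thesis by (intro exI[of _ b]) simp
  next
    case True
    then show ?thesis by (intro exI[of _ 0]) simp
  qed
  define b where "b i j = (SOME b. z $$ (i, j) = pw ^ (l - k) * b \<and> (z $$ (i, j) = 0 \<longrightarrow> b = 0))" for i j
  have b: "z $$ (i, j) = pw ^ (l - k) * b i j \<and> (z $$ (i, j) = 0 \<longrightarrow> b i j = 0)" if "i < n" "j < n'" for i j
    unfolding b_def by (rule someI_ex[OF ex[OF that]])
  define y where "y = mat n n' (\<lambda>(i, j). b i j)"
  have "z = pw ^ (l - k) \<cdot>\<^sub>m y"
  proof (rule eq_matI, goal_cases)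
    case (1 i j)
    then have "i < n" "j < n'" by (simp_all add: y_def)
    with b[OF this] show ?case by (simp only: y_def index_smult_mat index_mat mat_carrier dim_row_mat dim_col_mat split)
  qed (use assms(1) in \<open>simp_all add: y_def\<close>)
  moreover have "y \<in> carrier_mat n n'" "\<forall>i<n. \<forall>j<n'. z $$ (i, j) = 0 \<longrightarrow> y $$ (i, j) = 0"
    using b[THEN conjunct2] by (simp_all add: y_def)
  ultimately show ?thesis by blast
qed

end

subsection \<open>Irreducible representations\<close>

lemma mult_mat_carrier_iff [simp]:
  "A * B \<in> carrier_mat nr nc \<longleftrightarrow> dim_row A = nr \<and> dim_col B = nc"
  unfolding carrier_mat_def by simp

lemma mult_mat_vec_carrier_iff [simp]: "A *\<^sub>v v \<in> carrier_vec nr \<longleftrightarrow> dim_row A = nr"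
  unfolding carrier_vec_def by simp

lemma mult_mat_vec_smult:
  "A \<in> carrier_mat nr nc \<Longrightarrow> v \<in> carrier_vec nc \<Longrightarrow>
    A *\<^sub>v (k \<cdot>\<^sub>v v) = (k :: 'a :: comm_ring_1) \<cdot>\<^sub>v (A *\<^sub>v v)"
  by (rule eq_vecI) auto

lemma smult_mat_mult_vec:
  "A \<in> carrier_mat nr nc \<Longrightarrow> v \<in> carrier_vec nc \<Longrightarrow>
    (k \<cdot>\<^sub>m A) *\<^sub>v v = (k :: 'a :: comm_ring_1) \<cdot>\<^sub>v (A *\<^sub>v v)"
  by (rule eq_vecI) auto

lemma mult_mat_zero_vec:
  "A \<in> carrier_mat nr nc \<Longrightarrow> A *\<^sub>v 0\<^sub>v nc = (0\<^sub>v nr :: 'a :: comm_ring_1 vec)"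
  by (rule eq_vecI) auto

lemma mat_eq_0I:
  assumes A: "(A :: 'a :: comm_ring_1 mat) \<in> carrier_mat nr nc"
    and 0: "\<And>v. v \<in> carrier_vec nc \<Longrightarrow> A *\<^sub>v v = 0\<^sub>v nr"
  shows "A = 0\<^sub>m nr nc"
proof (rule eq_matI, goal_cases)
  case (1 i j)
  then have "(A *\<^sub>v unit_vec nc j) $ i = 0" using 0 by simp
  then show ?case using 1 A by simp
qed (use A in auto)

lemma ex_eigenvector_in_invariant_set:
  fixes T :: "complex mat"
  assumes T: "T \<in> carrier_mat d d" and U: "U \<subseteq> carrier_vec d"
    and v: "v \<in> U" "v \<noteq> 0\<^sub>v d"
    and closed: "\<And>u c. u \<in> U \<Longrightarrow> T *\<^sub>v u - c \<cdot>\<^sub>v u \<in> U"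
  shows "\<exists>w\<in>U. \<exists>\<mu>. w \<noteq> 0\<^sub>v d \<and> T *\<^sub>v w = \<mu> \<cdot>\<^sub>v w"
proof -
  obtain es where "char_poly T = (\<Prod>a\<leftarrow>es. [:- a, 1:])"
    using char_poly_factorized[OF T] by blast
  from schur_decomposition_exists[OF T this]
  obtain B where B: "B \<in> carrier_mat d d" "upper_triangular B" "similar_mat T B" by blast
  obtain d' P Q where "{T, B, P, Q} \<subseteq> carrier_mat d' d'" "P * Q = 1\<^sub>m d'" "Q * P = 1\<^sub>m d'" "T = P * B * Q"
    using similar_matD[OF B(3)] by blast
  moreover from this have "d' = d" using T by (metis carrier_matD(1) insert_subset)
  ultimately have PQ: "P \<in> carrier_mat d d" "Q \<in> carrier_mat d d"
      "P * Q = 1\<^sub>m d" "Q * P = 1\<^sub>m d" "T = P * B * Q"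
    by simp_all
  have QT: "Q * T = B * Q"
  proof -
    have "Q * (P * B * Q) = (Q * P) * (B * Q)"
      using PQ(1,2) B(1) by (simp add: assoc_mult_mat[of _ d d _ d _ d])
    then show ?thesis using PQ B(1) by simp
  qed
  define ok where "ok k u \<longleftrightarrow> u \<in> U \<and> u \<noteq> 0\<^sub>v d \<and> (\<forall>i. k \<le> i \<longrightarrow> i < d \<longrightarrow> (Q *\<^sub>v u) $ i = 0)" for k u
  have "ok d v" using v by (auto simp: ok_def)
  define k where "k = (LEAST k. \<exists>u. ok k u)"
  have "\<exists>k u. ok k u" using \<open>ok d v\<close> by (intro exI)
  then have "\<exists>u. ok k u" unfolding k_def by (rule LeastI_ex)
  then obtain u where u: "ok k u" by blast
  have min: "\<not> ok k' u'" if "k' < k" for k' u'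
    using not_less_Least[of k' "\<lambda>k. \<exists>u. ok k u"] that unfolding k_def by blast
  have kd: "k \<le> d" unfolding k_def using \<open>ok d v\<close> by (intro Least_le exI)
  have uc: "u \<in> carrier_vec d" using u U by (auto simp: ok_def)
  have "k \<noteq> 0"
  proof
    assume "k = 0"
    then have "Q *\<^sub>v u = 0\<^sub>v d" using u PQ by (intro eq_vecI) (auto simp: ok_def)
    then have "P *\<^sub>v (Q *\<^sub>v u) = 0\<^sub>v d" using PQ by (simp add: mult_mat_zero_vec)
    then have "(P * Q) *\<^sub>v u = 0\<^sub>v d" using PQ(1,2) uc by (simp add: assoc_mult_mat_vec[of _ d d _ d])
    then show False using u PQ uc by (simp add: ok_def)
  qed
  define x where "x = Q *\<^sub>v u"
  have x: "x \<in> carrier_vec d" "\<And>i. k \<le> i \<Longrightarrow> i < d \<Longrightarrow> x $ i = 0"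
    using u PQ by (auto simp: x_def ok_def)
  define \<mu> where "\<mu> = B $$ (k - 1, k - 1)"
  define w where "w = T *\<^sub>v u - \<mu> \<cdot>\<^sub>v u"
  have wU: "w \<in> U" using u closed by (auto simp: ok_def w_def)
  have "Q *\<^sub>v w = Q *\<^sub>v (T *\<^sub>v u) - \<mu> \<cdot>\<^sub>v x"
    using PQ T uc by (simp add: w_def x_def mult_minus_distrib_mat_vec[of _ d d] mult_mat_vec_smult[of _ d d])
  also have "Q *\<^sub>v (T *\<^sub>v u) = B *\<^sub>v x"
  proof -
    have "Q *\<^sub>v (T *\<^sub>v u) = (Q * T) *\<^sub>v u" using PQ(2) T uc by (simp add: assoc_mult_mat_vec[of _ d d _ d])
    then show ?thesis using PQ(2) B(1) uc unfolding QT by (simp add: x_def assoc_mult_mat_vec[of _ d d _ d])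
  qed
  finally have Qw: "Q *\<^sub>v w = B *\<^sub>v x - \<mu> \<cdot>\<^sub>v x" .
  have Qwi: "(Q *\<^sub>v w) $ i = 0" if i: "k - 1 \<le> i" "i < d" for i
  proof -
    have "(B *\<^sub>v x) $ i = (\<Sum>j<d. B $$ (i, j) * x $ j)"
      by (rule index_mult_vec_sum[OF B(1) x(1) i(2)])
    also have "\<dots> = (\<Sum>j<d. if j = k - 1 then B $$ (i, j) * x $ j else 0)"
    proof (intro sum.cong refl)
      fix j assume j: "j \<in> {..<d}"
      show "B $$ (i, j) * x $ j = (if j = k - 1 then B $$ (i, j) * x $ j else 0)"
      proof (cases "j \<ge> k")
        case True then show ?thesis using x j by simp
      next
        case False
        then show ?thesis using upper_triangularD[OF B(2), of j i] B(1) i by auto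
      qed
    qed
    also have "\<dots> = B $$ (i, k - 1) * x $ (k - 1)"
      using \<open>k \<noteq> 0\<close> kd by (simp add: sum.delta)
    also have "\<dots> = \<mu> * x $ i"
    proof (cases "i = k - 1")
      case False
      then have "B $$ (i, k - 1) = 0" using upper_triangularD[OF B(2), of "k - 1" i] B(1) i by auto
      then show ?thesis using x(2)[of i] i False by simp
    qed (simp add: \<mu>_def)
    finally show ?thesis using x i B by (simp add: Qw)
  qed
  have "w = 0\<^sub>v d"
  proof (rule ccontr)
    assume "w \<noteq> 0\<^sub>v d"
    then have "ok (k - 1) w" using wU Qwi by (auto simp: ok_def)
    then show False using min[of "k - 1" w] \<open>k \<noteq> 0\<close> by simp
  qed
  then have "T *\<^sub>v u = \<mu> \<cdot>\<^sub>v u"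
  proof (intro eq_vecI, goal_cases)
    case (1 i)
    then have i: "i < d" using uc by simp
    have "w $ i = 0" using i by (simp add: \<open>w = 0\<^sub>v d\<close>)
    moreover have "w $ i = (T *\<^sub>v u) $ i - (\<mu> \<cdot>\<^sub>v u) $ i"
      unfolding w_def by (rule index_minus_vec) (use i uc in simp)
    ultimately show ?case by simp
  qed (use uc T in auto)
  moreover have "u \<in> U" "u \<noteq> 0\<^sub>v d" using u by (simp_all add: ok_def)
  ultimately show ?thesis by blast
qed

lemma irreducible_repD:
  assumes "irreducible_rep G n \<rho> d"
  shows "\<And>g. g \<in> G \<Longrightarrow> \<rho> g \<in> carrier_mat d d" "\<rho> (1\<^sub>m n) = 1\<^sub>m d"
    "\<And>g h. g \<in> G \<Longrightarrow> h \<in> G \<Longrightarrow> \<rho> (g * h) = \<rho> g * \<rho> h" "d > 0"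
    "\<And>W. invariant_subspace G \<rho> d W \<Longrightarrow> W = {0\<^sub>v d} \<or> W = carrier_vec d"
  using assms by (auto simp: irreducible_rep_def is_rep_def)

lemma irreducible_rep_dichotomy:
  assumes irr: "irreducible_rep G n \<rho> d"
    and closed: "\<And>g h. g \<in> G \<Longrightarrow> h \<in> G \<Longrightarrow> g * h \<in> G"
    and C: "C \<in> carrier_mat d' d"
    and Z: "0\<^sub>v d' \<in> Z" "\<And>u v. u \<in> Z \<Longrightarrow> v \<in> Z \<Longrightarrow> u + v \<in> Z" "\<And>c v. v \<in> Z \<Longrightarrow> c \<cdot>\<^sub>v v \<in> Z"
    and w: "w \<in> carrier_vec d" "w \<noteq> 0\<^sub>v d" "\<And>h. h \<in> G \<Longrightarrow> C *\<^sub>v (\<rho> h *\<^sub>v w) \<in> Z"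
    and v: "v \<in> carrier_vec d" "h \<in> G"
  shows "C *\<^sub>v (\<rho> h *\<^sub>v v) \<in> Z"
proof -
  note rep = irreducible_repD[OF irr]
  define W where "W = {w \<in> carrier_vec d. \<forall>h\<in>G. C *\<^sub>v (\<rho> h *\<^sub>v w) \<in> Z}"
  have "invariant_subspace G \<rho> d W"
    unfolding invariant_subspace_def
  proof (intro conjI ballI allI)
    show "0\<^sub>v d \<in> W" using Z rep(1) C by (auto simp: W_def mult_mat_zero_vec[of _ d d] mult_mat_zero_vec[of _ d' d])
  next
    fix v w assume vw: "v \<in> W" "w \<in> W"
    have "C *\<^sub>v (\<rho> h *\<^sub>v (v + w)) \<in> Z" if h: "h \<in> G" for h
      using vw rep(1)[OF h] C Z(2) h
      by (simp add: W_def mult_add_distrib_mat_vec[of _ d d] mult_add_distrib_mat_vec[of _ d' d])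
    then show "v + w \<in> W" using vw by (simp add: W_def)
  next
    fix c v assume v: "v \<in> W"
    have "C *\<^sub>v (\<rho> h *\<^sub>v (c \<cdot>\<^sub>v v)) \<in> Z" if h: "h \<in> G" for h
      using v rep(1)[OF h] C Z(3) h
      by (simp add: W_def mult_mat_vec_smult[of _ d d] mult_mat_vec_smult[of _ d' d])
    then show "c \<cdot>\<^sub>v v \<in> W" using v by (simp add: W_def)
  next
    fix g v assume g: "g \<in> G" and v: "v \<in> W"
    have "C *\<^sub>v (\<rho> h *\<^sub>v (\<rho> g *\<^sub>v v)) \<in> Z" if h: "h \<in> G" for h
    proof -
      have "\<rho> h *\<^sub>v (\<rho> g *\<^sub>v v) = \<rho> (h * g) *\<^sub>v v"
        using v rep(1)[OF h] rep(1)[OF g] rep(3)[OF h g] by (simp add: W_def assoc_mult_mat_vec[of _ d d _ d])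
      then show ?thesis using v closed[OF h g] by (simp add: W_def)
    qed
    then show "\<rho> g *\<^sub>v v \<in> W" using v rep(1)[OF g] by (simp add: W_def)
  qed (auto simp: W_def)
  then have "W = {0\<^sub>v d} \<or> W = carrier_vec d" by (rule rep(5))
  moreover have "w \<in> W" using w by (simp add: W_def)
  ultimately have "v \<in> W" using w v by auto
  then show ?thesis using v by (simp add: W_def)
qed

text \<open>Commuting operators \<open>E \<rho>(g) E\<close> are scalars on the image of \<open>E\<close> by Schur's lemma; applied to one
  vector of the image they span the whole image.\<close>

lemma corner_rank_le_1_if_commuting:
  fixes \<rho> :: "'r :: comm_ring_1 mat \<Rightarrow> complex mat"
  assumes irr: "irreducible_rep G n \<rho> d"
    and G: "\<And>g h. g \<in> G \<Longrightarrow> h \<in> G \<Longrightarrow> g * h \<in> G" "1\<^sub>m n \<in> G"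
    and E: "E \<in> carrier_mat d d" "E * E = E"
    and comm: "\<And>g h. g \<in> G \<Longrightarrow> h \<in> G \<Longrightarrow> E * \<rho> g * E * (E * \<rho> h * E) = E * \<rho> h * E * (E * \<rho> g * E)"
  shows "\<exists>w\<in>carrier_vec d. \<forall>v\<in>carrier_vec d. \<exists>k. E *\<^sub>v v = k \<cdot>\<^sub>v w"
proof (cases "E = 0\<^sub>m d d")
  case True
  have "E *\<^sub>v v = 0 \<cdot>\<^sub>v 0\<^sub>v d" if "v \<in> carrier_vec d" for v
    using that True by (intro eq_vecI) auto
  then show ?thesis by (intro bexI[of _ "0\<^sub>v d"]) auto
next
  case False
  note rep = irreducible_repD[OF irr]
  obtain v0 where v0: "v0 \<in> carrier_vec d" "E *\<^sub>v v0 \<noteq> 0\<^sub>v d"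
    using mat_eq_0I[OF E(1)] False by blast
  define w0 where "w0 = E *\<^sub>v v0"
  have w0: "w0 \<in> carrier_vec d" "w0 \<noteq> 0\<^sub>v d" "E *\<^sub>v w0 = w0"
    using v0 E by (simp_all add: w0_def flip: assoc_mult_mat_vec[of _ d d _ d])
  have scalar: "\<exists>\<mu>. \<forall>u\<in>carrier_vec d. E *\<^sub>v u = u \<longrightarrow> E *\<^sub>v (\<rho> g *\<^sub>v u) = \<mu> \<cdot>\<^sub>v u" if g: "g \<in> G" for g
  proof -
    define T where "T = E * \<rho> g * E"
    have T: "T \<in> carrier_mat d d" using E rep(1)[OF g] by (simp add: T_def)
    have ET: "E * T = T" "T * E = T" using E rep(1)[OF g]
      by (simp_all add: T_def assoc_mult_mat[of _ d d _ d _ d] flip: assoc_mult_mat[of E d d E d _ d])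
    define U where "U = {u \<in> carrier_vec d. E *\<^sub>v u = u}"
    have "\<exists>w\<in>U. \<exists>\<mu>. w \<noteq> 0\<^sub>v d \<and> T *\<^sub>v w = \<mu> \<cdot>\<^sub>v w"
    proof (rule ex_eigenvector_in_invariant_set[OF T])
      show "w0 \<in> U" "w0 \<noteq> 0\<^sub>v d" using w0 by (auto simp: U_def)
      fix u c assume "u \<in> U"
      then show "T *\<^sub>v u - c \<cdot>\<^sub>v u \<in> U" using E T
        by (auto simp: U_def mult_minus_distrib_mat_vec[of _ d d] mult_mat_vec_smult[of _ d d] ET
            simp flip: assoc_mult_mat_vec[of _ d d _ d])
    qed (auto simp: U_def)
    then obtain w \<mu> where w: "w \<in> carrier_vec d" "E *\<^sub>v w = w" "w \<noteq> 0\<^sub>v d" "T *\<^sub>v w = \<mu> \<cdot>\<^sub>v w"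
      by (auto simp: U_def)
    define Z where "Z = {u \<in> carrier_vec d. T *\<^sub>v u = \<mu> \<cdot>\<^sub>v u}"
    have inZ: "E *\<^sub>v (\<rho> h *\<^sub>v v) \<in> Z" if v: "v \<in> carrier_vec d" "h \<in> G" for v h
    proof (rule irreducible_rep_dichotomy[OF irr G(1) E(1) _ _ _ w(1,3) _ v])
      have "\<mu> \<cdot>\<^sub>v 0\<^sub>v d = 0\<^sub>v d" by (intro eq_vecI) simp_all
      then show "0\<^sub>v d \<in> Z" using T by (simp add: Z_def mult_mat_zero_vec)
      show "u + v \<in> Z" if "u \<in> Z" "v \<in> Z" for u v
        using that T by (auto simp: Z_def mult_add_distrib_mat_vec[of _ d d] smult_add_distrib_vec[of _ d])
      show "c \<cdot>\<^sub>v v \<in> Z" if "v \<in> Z" for c v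
        using that T by (auto simp: Z_def mult_mat_vec_smult[of _ d d] smult_smult_assoc mult.commute)
    next
      fix h assume h: "h \<in> G"
      define F where "F = E * \<rho> h * E"
      have F: "F \<in> carrier_mat d d" using E rep(1)[OF h] by (simp add: F_def)
      have "E *\<^sub>v (\<rho> h *\<^sub>v w) = E *\<^sub>v (\<rho> h *\<^sub>v (E *\<^sub>v w))" using w by simp
      also have "\<dots> = F *\<^sub>v w"
        using E rep(1)[OF h] w(1) by (simp add: F_def assoc_mult_mat_vec[of _ d d _ d])
      finally have 1: "E *\<^sub>v (\<rho> h *\<^sub>v w) = F *\<^sub>v w" .
      have "T *\<^sub>v (F *\<^sub>v w) = F *\<^sub>v (T *\<^sub>v w)"
      proof -
        have "T * F = F * T" using comm[OF g h] unfolding T_def[symmetric] F_def[symmetric] .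
        then have "(T * F) *\<^sub>v w = (F * T) *\<^sub>v w" by simp
        then show ?thesis using T F w(1) by (simp add: assoc_mult_mat_vec[of _ d d _ d])
      qed
      also have "\<dots> = \<mu> \<cdot>\<^sub>v (F *\<^sub>v w)" using w F by (simp add: mult_mat_vec_smult[of _ d d])
      finally show "E *\<^sub>v (\<rho> h *\<^sub>v w) \<in> Z" unfolding 1 Z_def using F w by simp
    qed
    have "E *\<^sub>v (\<rho> g *\<^sub>v u) = \<mu> \<cdot>\<^sub>v u" if u: "u \<in> carrier_vec d" "E *\<^sub>v u = u" for u
    proof -
      have "E *\<^sub>v (\<rho> (1\<^sub>m n) *\<^sub>v u) \<in> Z" by (rule inZ[OF u(1) G(2)])
      then have "T *\<^sub>v u = \<mu> \<cdot>\<^sub>v u" using u rep(2) by (simp add: Z_def)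
      moreover have "T *\<^sub>v u = E *\<^sub>v (\<rho> g *\<^sub>v (E *\<^sub>v u))"
        using E rep(1)[OF g] u(1) by (simp add: T_def assoc_mult_mat_vec[of _ d d _ d])
      ultimately show ?thesis using u by simp
    qed
    then show ?thesis by blast
  qed
  define Z where "Z = {u. \<exists>k. u = k \<cdot>\<^sub>v w0}"
  have "E *\<^sub>v (\<rho> (1\<^sub>m n) *\<^sub>v v) \<in> Z" if v: "v \<in> carrier_vec d" for v
  proof (rule irreducible_rep_dichotomy[OF irr G(1) E(1) _ _ _ w0(1,2) _ v G(2)])
    have "0\<^sub>v d = 0 \<cdot>\<^sub>v w0" using w0 by (intro eq_vecI) auto
    then show "0\<^sub>v d \<in> Z" by (auto simp: Z_def)
    show "u + v \<in> Z" if "u \<in> Z" "v \<in> Z" for u v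
      using that by (auto simp: Z_def simp flip: add_smult_distrib_vec)
    show "c \<cdot>\<^sub>v v \<in> Z" if "v \<in> Z" for c v
      using that by (auto simp: Z_def smult_smult_assoc)
    show "E *\<^sub>v (\<rho> h *\<^sub>v w0) \<in> Z" if "h \<in> G" for h
      using scalar[OF that] w0 by (auto simp: Z_def)
  qed
  then show ?thesis using w0 rep(2) by (intro bexI[of _ w0]) (auto simp: Z_def)
qed

lemma mult_vec_msum_mult_vec:
  assumes M: "M \<in> carrier_mat d e" and v: "v \<in> carrier_vec e"
    and f: "\<And>x. x \<in> I \<Longrightarrow> f x \<in> carrier_mat e e" and i: "i < d"
  shows "(M *\<^sub>v (msum e f I *\<^sub>v v)) $ i = (\<Sum>x\<in>I. (M *\<^sub>v (f x *\<^sub>v v)) $ i)"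
proof -
  have "(M *\<^sub>v (msum e f I *\<^sub>v v)) $ i = (\<Sum>k<e. M $$ (i, k) * (msum e f I *\<^sub>v v) $ k)"
    by (rule index_mult_vec_sum[OF M _ i]) simp
  also have "\<dots> = (\<Sum>k<e. M $$ (i, k) * (\<Sum>x\<in>I. (f x *\<^sub>v v) $ k))"
    by (intro sum.cong refl arg_cong2[where f = times] msum_mult_vec[OF v f]) auto
  also have "\<dots> = (\<Sum>x\<in>I. \<Sum>k<e. M $$ (i, k) * (f x *\<^sub>v v) $ k)"
    by (subst sum.swap) (simp add: sum_distrib_left)
  also have "\<dots> = (\<Sum>x\<in>I. (M *\<^sub>v (f x *\<^sub>v v)) $ i)"
    using f by (intro sum.cong refl index_mult_vec_sum[OF M _ i, symmetric]) auto
  finally show ?thesis .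
qed

lemma multiplicity_free_if_rank_1:
  fixes \<rho> :: "'r :: comm_ring_1 mat \<Rightarrow> complex mat"
  assumes irr: "irreducible_rep G n \<rho> d"
    and G: "\<And>g h. g \<in> G \<Longrightarrow> h \<in> G \<Longrightarrow> g * h \<in> G" "1\<^sub>m n \<in> G" "G \<subseteq> carrier_mat n n"
    and H: "H \<subseteq> G" "\<And>g. g \<in> G \<Longrightarrow> \<exists>g'\<in>G. g' * g = 1\<^sub>m n \<and> g * g' = 1\<^sub>m n \<and> (\<forall>h\<in>H. g' * h * g \<in> H)"
    and A: "A = msum d (\<lambda>x. c x \<cdot>\<^sub>m \<rho> (b x)) I" "\<And>x. x \<in> I \<Longrightarrow> b x \<in> H" "A \<noteq> 0\<^sub>m d d"
    and w: "w \<in> carrier_vec d" "\<And>v. v \<in> carrier_vec d \<Longrightarrow> \<exists>k. A *\<^sub>v v = k \<cdot>\<^sub>v w"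
  shows "multiplicity_free_restriction H n \<rho> d"
  unfolding multiplicity_free_restriction_def
proof (intro allI impI ballI)
  fix \<sigma> e T1 T2
  assume irr': "irreducible_rep H n \<sigma> e"
    and "T1 \<in> intertwiners H \<sigma> e \<rho> d" "T2 \<in> intertwiners H \<sigma> e \<rho> d"
  then have T: "T1 \<in> carrier_mat d e" "T2 \<in> carrier_mat d e"
      "\<And>h. h \<in> H \<Longrightarrow> T1 * \<sigma> h = \<rho> h * T1" "\<And>h. h \<in> H \<Longrightarrow> T2 * \<sigma> h = \<rho> h * T2"
    by (auto simp: intertwiners_def)
  note rep = irreducible_repD[OF irr] and rep' = irreducible_repD[OF irr']
  show "\<exists>a b. (a \<noteq> 0 \<or> b \<noteq> 0) \<and> a \<cdot>\<^sub>m T1 + b \<cdot>\<^sub>m T2 = 0\<^sub>m d e"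
  proof (cases "T1 = 0\<^sub>m d e")
    case True
    then have "1 \<cdot>\<^sub>m T1 + 0 \<cdot>\<^sub>m T2 = 0\<^sub>m d e" using T(2) by (intro eq_matI) auto
    then show ?thesis by (metis one_neq_zero)
  next
    case False
    obtain w0 where w0: "w0 \<in> carrier_vec e" "T1 *\<^sub>v w0 \<noteq> 0\<^sub>v d"
      using mat_eq_0I[OF T(1)] False by blast
    have Ac: "A \<in> carrier_mat d d" by (simp add: A)
    obtain v1 where v1: "v1 \<in> carrier_vec d" "A *\<^sub>v v1 \<noteq> 0\<^sub>v d"
      using mat_eq_0I[OF Ac] A(3) by blast
    have "\<exists>g\<in>G. A *\<^sub>v (\<rho> g *\<^sub>v (T1 *\<^sub>v w0)) \<noteq> 0\<^sub>v d"
    proof (rule ccontr)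
      assume *: "\<not> ?thesis"
      have "A *\<^sub>v (\<rho> (1\<^sub>m n) *\<^sub>v v1) \<in> {0\<^sub>v d}"
        by (rule irreducible_rep_dichotomy[OF irr G(1) Ac _ _ _ _ w0(2) _ v1(1) G(2)])
          (use * w0 T in auto)
      then show False using v1 rep by simp
    qed
    then obtain g where g: "g \<in> G" "A *\<^sub>v (\<rho> g *\<^sub>v (T1 *\<^sub>v w0)) \<noteq> 0\<^sub>v d" by blast
    obtain g' where g': "g' \<in> G" "g' * g = 1\<^sub>m n" "g * g' = 1\<^sub>m n" "\<And>h. h \<in> H \<Longrightarrow> g' * h * g \<in> H"
      using H(2)[OF g(1)] by blast
    define P where "P = msum e (\<lambda>x. c x \<cdot>\<^sub>m \<sigma> (g' * b x * g)) I"
    have Pc: "P \<in> carrier_mat e e" by (simp add: P_def)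
    have AT: "A *\<^sub>v (\<rho> g *\<^sub>v (T *\<^sub>v u)) = \<rho> g *\<^sub>v (T *\<^sub>v (P *\<^sub>v u))"
      if T: "T \<in> carrier_mat d e" "\<And>h. h \<in> H \<Longrightarrow> T * \<sigma> h = \<rho> h * T" and u: "u \<in> carrier_vec e" for T u
    proof (rule eq_vecI, goal_cases)
      case (1 i)
      then have i: "i < d" using rep(1)[OF g(1)] by simp
      have trm: "(c x \<cdot>\<^sub>m \<rho> (b x)) *\<^sub>v (\<rho> g *\<^sub>v (T *\<^sub>v u)) = (\<rho> g * T) *\<^sub>v ((c x \<cdot>\<^sub>m \<sigma> (g' * b x * g)) *\<^sub>v u)"
        if x: "x \<in> I" for x
      proof -
        define h where "h = g' * b x * g"
        have bG: "b x \<in> G" using A(2)[OF x] H(1) by auto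
        have h: "h \<in> H" "h \<in> G" using g'(4) A(2)[OF x] H(1) by (auto simp: h_def)
        have "g * h = (g * g') * (b x * g)"
          using subsetD[OF G(3) g(1)] subsetD[OF G(3) g'(1)] subsetD[OF G(3) bG] unfolding h_def
          by (simp add: assoc_mult_mat[of _ n n _ n _ n])
        also have "\<dots> = b x * g" using subsetD[OF G(3) bG] by (simp add: g'(3))
        finally have bg: "b x * g = g * h" by simp
        have "\<rho> (b x) *\<^sub>v (\<rho> g *\<^sub>v (T *\<^sub>v u)) = (\<rho> (b x * g) * T) *\<^sub>v u"
          using rep(1)[OF bG] rep(1)[OF g(1)] rep(3)[OF bG g(1)] T u
          by (simp add: assoc_mult_mat_vec[of _ d d _ e] assoc_mult_mat_vec[of _ d d _ d])
        also have "\<rho> (b x * g) * T = \<rho> g * (T * \<sigma> h)"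
          using rep(1)[OF h(2)] rep(1)[OF g(1)] rep(3)[OF g(1) h(2)] T h
          by (simp add: bg assoc_mult_mat[of _ d d _ d _ e])
        also have "\<dots> *\<^sub>v u = (\<rho> g * T) *\<^sub>v (\<sigma> h *\<^sub>v u)"
          using rep'(1)[OF h(1)] rep(1)[OF g(1)] T(1) u
          by (simp add: assoc_mult_mat_vec[of _ d e _ e] assoc_mult_mat_vec[of _ d d _ e])
        finally show ?thesis unfolding h_def[symmetric]
          using rep(1)[OF bG] rep'(1)[OF h(1)] rep(1)[OF g(1)] T(1) u
          by (simp add: smult_mat_mult_vec[of _ d d] smult_mat_mult_vec[of _ e e] mult_mat_vec_smult[of _ d e])
      qed
      have "(A *\<^sub>v (\<rho> g *\<^sub>v (T *\<^sub>v u))) $ i = (\<Sum>x\<in>I. ((c x \<cdot>\<^sub>m \<rho> (b x)) *\<^sub>v (\<rho> g *\<^sub>v (T *\<^sub>v u))) $ i)"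
        unfolding A(1) using subsetD[OF H(1) A(2)] rep(1) T(1) u i rep(1)[OF g(1)] by (intro msum_mult_vec) simp_all
      also have "\<dots> = (\<Sum>x\<in>I. ((\<rho> g * T) *\<^sub>v ((c x \<cdot>\<^sub>m \<sigma> (g' * b x * g)) *\<^sub>v u)) $ i)"
        by (intro sum.cong refl) (simp only: trm)
      also have "\<dots> = ((\<rho> g * T) *\<^sub>v (P *\<^sub>v u)) $ i"
        unfolding P_def using rep(1)[OF g(1)] T(1) u i rep'(1) g'(4) A(2)
        by (intro mult_vec_msum_mult_vec[symmetric]) auto
      also have "(\<rho> g * T) *\<^sub>v (P *\<^sub>v u) = \<rho> g *\<^sub>v (T *\<^sub>v (P *\<^sub>v u))"
        using rep(1)[OF g(1)] T(1) u Pc by (intro assoc_mult_mat_vec) auto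
      finally show ?case .
    qed (use rep(1)[OF g(1)] Ac in auto)
    obtain k1 where k1: "A *\<^sub>v (\<rho> g *\<^sub>v (T1 *\<^sub>v w0)) = k1 \<cdot>\<^sub>v w"
      using w(2) rep(1)[OF g(1)] T w0 by (meson mult_mat_vec_carrier)
    obtain k2 where k2: "A *\<^sub>v (\<rho> g *\<^sub>v (T2 *\<^sub>v w0)) = k2 \<cdot>\<^sub>v w"
      using w(2) rep(1)[OF g(1)] T w0 by (meson mult_mat_vec_carrier)
    define T where "T = k2 \<cdot>\<^sub>m T1 + (- k1) \<cdot>\<^sub>m T2"
    have Tc: "T \<in> carrier_mat d e" using T by (simp add: T_def)
    have Tv: "T *\<^sub>v u = k2 \<cdot>\<^sub>v (T1 *\<^sub>v u) + (- k1) \<cdot>\<^sub>v (T2 *\<^sub>v u)" if "u \<in> carrier_vec e" for u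
      using T that by (simp add: T_def add_mult_distrib_mat_vec[of _ d e] smult_mat_mult_vec[of _ d e])
    have "0 \<cdot>\<^sub>v w = 0\<^sub>v d" using w(1) by (intro eq_vecI) auto
    then have k10: "k1 \<noteq> 0" using g(2) k1 by auto
    define u where "u = P *\<^sub>v w0"
    have uc: "u \<in> carrier_vec e" using Pc w0 by (simp add: u_def)
    have "u \<noteq> 0\<^sub>v e"
      using g(2) AT[OF T(1,3) w0(1)] rep(1)[OF g(1)] T(1) by (auto simp: u_def mult_mat_zero_vec)
    have "\<rho> g *\<^sub>v (T *\<^sub>v u) = 0\<^sub>v d"
    proof -
      have "\<rho> g *\<^sub>v (T *\<^sub>v u) = k2 \<cdot>\<^sub>v (\<rho> g *\<^sub>v (T1 *\<^sub>v u)) + (- k1) \<cdot>\<^sub>v (\<rho> g *\<^sub>v (T2 *\<^sub>v u))"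
        using Tv[OF uc] rep(1)[OF g(1)] T uc
        by (simp add: mult_add_distrib_mat_vec[of _ d d] mult_mat_vec_smult[of _ d d])
      also have "\<dots> = k2 \<cdot>\<^sub>v (k1 \<cdot>\<^sub>v w) + (- k1) \<cdot>\<^sub>v (k2 \<cdot>\<^sub>v w)"
        using AT[OF T(1,3) w0(1)] AT[OF T(2,4) w0(1)] k1 k2 by (simp add: u_def)
      also have "\<dots> = 0\<^sub>v d" using w(1) by (intro eq_vecI) auto
      finally show ?thesis .
    qed
    then have "\<rho> g' *\<^sub>v (\<rho> g *\<^sub>v (T *\<^sub>v u)) = 0\<^sub>v d"
      using rep(1)[OF g'(1)] by (simp add: mult_mat_zero_vec)
    moreover have "\<rho> g' *\<^sub>v (\<rho> g *\<^sub>v (T *\<^sub>v u)) = \<rho> (g' * g) *\<^sub>v (T *\<^sub>v u)"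
      using rep(1)[OF g'(1)] rep(1)[OF g(1)] rep(3)[OF g'(1) g(1)] Tc uc
      by (simp add: assoc_mult_mat_vec[of _ d d _ d])
    ultimately have Tu: "T *\<^sub>v u = 0\<^sub>v d" using g' rep(2) Tc uc by simp
    have "T = 0\<^sub>m d e"
    proof (rule mat_eq_0I[OF Tc])
      fix v :: "complex vec" assume v: "v \<in> carrier_vec e"
      have int: "T *\<^sub>v (\<sigma> h *\<^sub>v u) = \<rho> h *\<^sub>v (T *\<^sub>v u)" if h: "h \<in> H" "u \<in> carrier_vec e" for h u
      proof -
        have \<rho>h: "\<rho> h \<in> carrier_mat d d" using rep(1) H(1) h by auto
        have "T * \<sigma> h = \<rho> h * T"
          using T(1,2) T(3,4)[OF h(1)] rep'(1)[OF h(1)] \<rho>h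
          by (simp add: T_def add_mult_distrib_mat[of _ d e _ _ e] mult_add_distrib_mat[of _ d d _ e]
              mult_smult_assoc_mat[of _ d e _ e] mult_smult_distrib[of _ d d _ e])
        then have "(T * \<sigma> h) *\<^sub>v u = (\<rho> h * T) *\<^sub>v u" by simp
        then show ?thesis using Tc rep'(1)[OF h(1)] \<rho>h h(2)
          by (simp add: assoc_mult_mat_vec[of _ d e _ e] assoc_mult_mat_vec[of _ d d _ e])
      qed
      define W where "W = {v \<in> carrier_vec e. T *\<^sub>v v = 0\<^sub>v d}"
      have "T *\<^sub>v (\<sigma> h *\<^sub>v v) = 0\<^sub>v d" if "h \<in> H" "v \<in> W" for h v
        using int[of h v] that rep(1)[of h] H(1) by (auto simp: W_def mult_mat_zero_vec)
      then have "invariant_subspace H \<sigma> e W"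
        unfolding invariant_subspace_def
        using Tc rep'(1)
        by (auto simp: W_def mult_mat_zero_vec mult_add_distrib_mat_vec[of _ d e] mult_mat_vec_smult[of _ d e])
      then have "W = {0\<^sub>v e} \<or> W = carrier_vec e" by (rule rep'(5))
      moreover have "u \<in> W" using uc Tu by (simp add: W_def)
      ultimately show "T *\<^sub>v v = 0\<^sub>v d" using v \<open>u \<noteq> 0\<^sub>v e\<close> by (auto simp: W_def)
    qed
    then show ?thesis using k10 unfolding T_def by (intro exI[of _ k2] exI[of _ "- k1"]) auto
  qed
qed

subsection \<open>Cyclic vectors\<close>

lemma poly_ideal_generator:
  fixes I :: "'k :: field poly set"
  assumes "p0 \<in> I" "p0 \<noteq> 0"
    and diff: "\<And>p q. p \<in> I \<Longrightarrow> q \<in> I \<Longrightarrow> p - q \<in> I"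
    and mult: "\<And>p h. p \<in> I \<Longrightarrow> h * p \<in> I"
  shows "\<exists>f\<in>I. f \<noteq> 0 \<and> (\<forall>p\<in>I. f dvd p)"
proof -
  have "\<exists>p. p \<in> I \<and> p \<noteq> 0" using assms by blast
  from ex_has_least_nat[of "\<lambda>p. p \<in> I \<and> p \<noteq> 0", OF this[THEN someI_ex], of degree]
  obtain f where f: "f \<in> I" "f \<noteq> 0" "\<And>p. p \<in> I \<Longrightarrow> p \<noteq> 0 \<Longrightarrow> degree f \<le> degree p" by blast
  have "f dvd p" if "p \<in> I" for p
  proof -
    have "p mod f = p - (p div f) * f" by (simp add: minus_div_mult_eq_mod)
    then have "p mod f \<in> I" using diff[OF that mult[OF f(1)]] by simp
    moreover have "p mod f = 0 \<or> degree (p mod f) < degree f" by (rule degree_mod_less[OF f(2)])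
    ultimately have "p mod f = 0" by (metis f(3) not_le)
    then show ?thesis by (simp add: dvd_eq_mod_eq_0)
  qed
  then show ?thesis using f by blast
qed

lemma poly_bezout_power:
  fixes p x :: "'k :: field poly"
  assumes p: "p \<noteq> 0" "\<And>d. d dvd p \<Longrightarrow> degree d = 0 \<or> degree d = degree p" and x: "\<not> p dvd x"
  shows "\<exists>s t. s * p ^ k + t * x = 1"
proof (induction k)
  case 0
  show ?case by (intro exI[of _ 1] exI[of _ 0]) simp
next
  case (Suc k)
  define I where "I = {s * p + t * x | s t. True}"
  have "p \<in> I" by (auto simp: I_def intro: exI[of _ 1] exI[of _ 0])
  have "x \<in> I" by (auto simp: I_def intro: exI[of _ 1] exI[of _ 0])
  have "\<exists>f\<in>I. f \<noteq> 0 \<and> (\<forall>p\<in>I. f dvd p)"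
  proof (rule poly_ideal_generator[OF \<open>p \<in> I\<close> p(1)])
    fix a b assume "a \<in> I" "b \<in> I"
    then obtain s t s' t' where "a = s * p + t * x" "b = s' * p + t' * x" by (auto simp: I_def)
    then have "a - b = (s - s') * p + (t - t') * x" by (simp add: algebra_simps)
    then show "a - b \<in> I" by (auto simp: I_def)
  next
    fix a h assume "a \<in> I"
    then obtain s t where "a = s * p + t * x" by (auto simp: I_def)
    then have "h * a = (h * s) * p + (h * t) * x" by (simp add: algebra_simps)
    then show "h * a \<in> I" unfolding I_def by blast
  qed
  then obtain f where f: "f \<in> I" "f \<noteq> 0" "f dvd p" "f dvd x" using \<open>p \<in> I\<close> \<open>x \<in> I\<close> by blast
  have "degree f = 0"
  proof (rule ccontr)
    assume "degree f \<noteq> 0"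
    then have deg: "degree f = degree p" using p(2)[OF f(3)] by simp
    obtain c where c: "p = f * c" using f(3) by (rule dvdE)
    then have "c \<noteq> 0" using p(1) by auto
    then have "degree c = 0" using deg c f(2) by (simp add: degree_mult_eq)
    then have "is_unit c" using \<open>c \<noteq> 0\<close> by (simp add: is_unit_iff_degree)
    then have "p dvd f" using c by (simp add: mult_unit_dvd_iff)
    then show False using x f(4) dvd_trans by blast
  qed
  then have "is_unit f" using f(2) by (simp add: is_unit_iff_degree)
  then obtain u where u: "1 = f * u" by (rule dvdE)
  obtain s t where "f = s * p + t * x" using f(1) by (auto simp: I_def)
  then have 1: "(u * s) * p + (u * t) * x = 1" using u by (simp add: algebra_simps)
  obtain s' t' where 2: "s' * p ^ k + t' * x = 1" using Suc.IH by blast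
  have "1 = (s' * p ^ k + t' * x) * ((u * s) * p + (u * t) * x)" unfolding 1 2 by simp
  also have "\<dots> = (s' * (u * s)) * p ^ Suc k + (s' * p ^ k * (u * t) + t' * ((u * s) * p + (u * t) * x)) * x"
    by (simp add: algebra_simps)
  finally show ?case by metis
qed

lemma poly_factor_out_power:
  fixes p f :: "'k :: field poly"
  assumes "f \<noteq> 0" "degree p > 0"
  shows "\<exists>a f0. f = p ^ a * f0 \<and> \<not> p dvd f0"
  using assms(1)
proof (induction "degree f" arbitrary: f rule: less_induct)
  case less
  show ?case
  proof (cases "p dvd f")
    case False
    then show ?thesis by (intro exI[of _ 0] exI[of _ f]) simp
  next
    case True
    then obtain g where g: "f = p * g" by (rule dvdE)
    then have "g \<noteq> 0" "p \<noteq> 0" using less.prems by auto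
    then have "degree g < degree f" using g assms(2) by (simp add: degree_mult_eq)
    then obtain a f0 where "g = p ^ a * f0" "\<not> p dvd f0" using less.hyps[OF _ \<open>g \<noteq> 0\<close>] by blast
    then show ?thesis using g by (intro exI[of _ "Suc a"] exI[of _ f0]) (simp add: mult.assoc)
  qed
qed

locale poly_action =
  fixes V :: "'k :: field vec set" and act :: "'k poly \<Rightarrow> 'k vec \<Rightarrow> 'k vec" and n :: nat
  assumes V: "V = carrier_vec n"
    and act_V: "v \<in> V \<Longrightarrow> act p v \<in> V"
    and act_add: "v \<in> V \<Longrightarrow> act (p + q) v = act p v + act q v"
    and act_mult: "v \<in> V \<Longrightarrow> act (p * q) v = act p (act q v)"
    and act_const: "v \<in> V \<Longrightarrow> act [:c:] v = c \<cdot>\<^sub>v v"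
    and act_vadd: "v \<in> V \<Longrightarrow> w \<in> V \<Longrightarrow> act p (v + w) = act p v + act p w"
    and act_0: "act p (0\<^sub>v n) = 0\<^sub>v n"
begin

lemma act_1: "v \<in> V \<Longrightarrow> act 1 v = v"
  using act_const[of v 1] by (simp add: one_pCons)

lemma act_uminus: "v \<in> V \<Longrightarrow> act (- p) v = - act p v"
proof -
  assume v: "v \<in> V"
  have "act (- p) v = act ([:-1:] * p) v" by simp
  also have "\<dots> = (-1) \<cdot>\<^sub>v act p v" using v by (simp only: act_mult act_const act_V)
  also have "\<dots> = - act p v" by (intro eq_vecI) auto
  finally show ?thesis .
qed

lemma act_diff: "v \<in> V \<Longrightarrow> act (p - q) v = act p v - act q v"
  using act_add[of v p "- q"] act_uminus[of v q] act_V[of v p] act_V[of v q] V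
  by (simp add: minus_add_uminus_vec)

lemma act_comm: "v \<in> V \<Longrightarrow> act p (act q v) = act q (act p v)"
  by (simp flip: act_mult add: mult.commute)

lemma act_dvd: "v \<in> V \<Longrightarrow> p dvd q \<Longrightarrow> act p v = 0\<^sub>v n \<Longrightarrow> act q v = 0\<^sub>v n"
  by (auto simp: act_mult act_comm act_0 elim!: dvdE)

lemma annihilator:
  assumes "\<chi> \<noteq> 0" "v \<in> V" "act \<chi> v = 0\<^sub>v n"
  shows "\<exists>f. f \<noteq> 0 \<and> (\<forall>p. act p v = 0\<^sub>v n \<longleftrightarrow> f dvd p)"
proof -
  have "\<exists>f\<in>{p. act p v = 0\<^sub>v n}. f \<noteq> 0 \<and> (\<forall>p\<in>{p. act p v = 0\<^sub>v n}. f dvd p)"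
    by (rule poly_ideal_generator[of \<chi>]) (use assms V in \<open>auto simp: act_diff act_mult act_0\<close>)
  then show ?thesis using act_dvd[OF assms(2)] by blast
qed

text \<open>Let \<open>v\<close> have an annihilator \<open>f\<close> of maximal degree. If \<open>f\<close> does not kill everything, there are \<open>w\<close>
  and an irreducible \<open>p\<close> such that \<open>f p\<close> kills \<open>w\<close> and \<open>f\<close> does not. With \<open>f = p ^ a f0\<close> and
  \<open>f0\<close> prime to \<open>p\<close>, the vector \<open>p ^ a v + f0 w\<close> has the annihilator \<open>p f\<close>.\<close>

lemma ex_vector_with_full_annihilator:
  assumes \<chi>: "\<chi> \<noteq> 0" "\<And>v. v \<in> V \<Longrightarrow> act \<chi> v = 0\<^sub>v n"
  shows "\<exists>v\<in>V. \<exists>f. f \<noteq> 0 \<and> (\<forall>p. act p v = 0\<^sub>v n \<longleftrightarrow> f dvd p) \<and> (\<forall>w\<in>V. act f w = 0\<^sub>v n)"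
proof -
  define ann where "ann v = (SOME f. f \<noteq> 0 \<and> (\<forall>p. act p v = 0\<^sub>v n \<longleftrightarrow> f dvd p))" for v
  have ann: "ann v \<noteq> 0" "act p v = 0\<^sub>v n \<longleftrightarrow> ann v dvd p" if "v \<in> V" for v p
    using someI_ex[OF annihilator[OF \<chi>(1) that \<chi>(2)[OF that]]] unfolding ann_def by blast+
  have le: "degree (ann v) \<le> degree \<chi>" if "v \<in> V" for v
    using ann(2)[OF that, of \<chi>] \<chi>(2)[OF that] \<chi>(1) by (auto intro: dvd_imp_degree_le)
  have "0\<^sub>v n \<in> V" using V by simp
  from ex_has_greatest_nat[of "\<lambda>v. v \<in> V", OF this, of "\<lambda>v. degree (ann v)" "degree \<chi> + 1"] le
  obtain v where v: "v \<in> V" "\<And>w. w \<in> V \<Longrightarrow> degree (ann w) \<le> degree (ann v)" by (auto simp: less_Suc_eq_le)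
  define f where "f = ann v"
  have f: "f \<noteq> 0" "\<And>p. act p v = 0\<^sub>v n \<longleftrightarrow> f dvd p" using ann[OF v(1)] by (auto simp: f_def)
  have "act f w = 0\<^sub>v n" if "w \<in> V" for w
  proof (rule ccontr)
    assume "act f w \<noteq> 0\<^sub>v n"
    then have ex: "w \<in> V \<and> act f w \<noteq> 0\<^sub>v n" using that by blast
    obtain w where w: "w \<in> V" "act f w \<noteq> 0\<^sub>v n"
        "\<And>w'. w' \<in> V \<Longrightarrow> act f w' \<noteq> 0\<^sub>v n \<Longrightarrow> degree (ann w) \<le> degree (ann w')"
      using ex_has_least_nat[of "\<lambda>w. w \<in> V \<and> act f w \<noteq> 0\<^sub>v n", OF ex, of "\<lambda>w. degree (ann w)"] by blast
    define g where "g = ann w"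
    have g: "g \<noteq> 0" "act g w = 0\<^sub>v n" using ann[OF w(1)] by (auto simp: g_def)
    have "degree g > 0"
    proof (rule ccontr)
      assume "\<not> degree g > 0"
      then have "is_unit g" using g(1) by (simp add: is_unit_iff_degree)
      then have "g dvd f" by (rule unit_imp_dvd)
      then show False using act_dvd[OF w(1) _ g(2)] w(2) by blast
    qed
    then have ex: "g dvd g \<and> degree g > 0" by simp
    obtain p where p: "p dvd g" "degree p > 0" "\<And>d. d dvd g \<Longrightarrow> degree d > 0 \<Longrightarrow> degree p \<le> degree d"
      using ex_has_least_nat[of "\<lambda>d. d dvd g \<and> degree d > 0", OF ex, of degree] by blast
    have p0: "p \<noteq> 0" using p(2) by auto
    have irr: "degree d = 0 \<or> degree d = degree p" if "d dvd p" for d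
      using p(3)[of d] that p(1) dvd_imp_degree_le[OF that p0] dvd_trans by fastforce
    obtain q where q: "g = p * q" using p(1) by (rule dvdE)
    have q0: "q \<noteq> 0" using g(1) q by auto
    have pw: "act p w \<in> V" by (rule act_V[OF w(1)])
    have "act q (act p w) = 0\<^sub>v n" using g(2) w(1) by (simp add: q act_mult act_comm)
    then have "ann (act p w) dvd q" using ann(2)[OF pw] by simp
    then have "degree (ann (act p w)) \<le> degree q" by (rule dvd_imp_degree_le[OF _ q0])
    also have "\<dots> < degree g" using q p0 q0 p(2) by (simp add: degree_mult_eq)
    finally have fpw: "act f (act p w) = 0\<^sub>v n" using w(3)[OF pw] by (auto simp: g_def)
    obtain a f0 where a: "f = p ^ a * f0" "\<not> p dvd f0" using poly_factor_out_power[OF f(1) p(2)] by blast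
    define w1 where "w1 = act f0 w"
    define v1 where "v1 = act (p ^ a) v"
    have w1: "w1 \<in> V" "act (p ^ Suc a) w1 = 0\<^sub>v n" "act (p ^ a) w1 \<noteq> 0\<^sub>v n"
    proof -
      show "w1 \<in> V" using act_V w(1) by (simp add: w1_def)
      have "act (p ^ Suc a) w1 = act (p ^ Suc a * f0) w" using w(1) by (simp only: w1_def act_mult)
      also have "p ^ Suc a * f0 = f * p" by (simp add: a mult_ac)
      finally show "act (p ^ Suc a) w1 = 0\<^sub>v n" using fpw w(1) by (simp only: act_mult)
      have "act (p ^ a) w1 = act f w" using w(1) by (simp only: w1_def act_mult a)
      then show "act (p ^ a) w1 \<noteq> 0\<^sub>v n" using w(2) by simp
    qed
    have v1: "v1 \<in> V" using act_V v(1) by (simp add: v1_def)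
    have f0v1: "act f0 v1 = 0\<^sub>v n"
      using f(2)[of f] v(1) by (simp add: v1_def a act_mult act_comm)
    define u where "u = v1 + w1"
    have u: "u \<in> V" using v1 w1 V by (simp add: u_def)
    define h where "h = ann u"
    have h: "h \<noteq> 0" "act h u = 0\<^sub>v n" using ann[OF u] by (auto simp: h_def)
    have hu: "act h v1 + act h w1 = 0\<^sub>v n" using h(2) act_vadd[OF v1 w1(1)] by (simp add: u_def)
    have zero_l: "act k (act h v1) = 0\<^sub>v n" if "act k (act h w1) = 0\<^sub>v n" for k
    proof -
      have "act k (act h v1) + act k (act h w1) = 0\<^sub>v n"
        using act_vadd[OF act_V[OF v1] act_V[OF w1(1)], of k h h] hu act_0 by simp
      then show ?thesis using that act_V[OF act_V[OF v1]] V by simp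
    qed
    have zero_r: "act k (act h w1) = 0\<^sub>v n" if "act k (act h v1) = 0\<^sub>v n" for k
    proof -
      have "act k (act h v1) + act k (act h w1) = 0\<^sub>v n"
        using act_vadd[OF act_V[OF v1] act_V[OF w1(1)], of k h h] hu act_0 by simp
      then show ?thesis using that act_V[OF act_V[OF w1(1)]] V by simp
    qed
    have f0h: "f0 dvd h"
    proof -
      have "act (p ^ Suc a) (act h w1) = 0\<^sub>v n"
        using w1 by (simp only: act_comm[OF w1(1), of "p ^ Suc a" h] act_0)
      then have "act (p ^ Suc a) (act h v1) = 0\<^sub>v n" by (rule zero_l)
      then have "act (p ^ Suc a * h * p ^ a) v = 0\<^sub>v n" using v(1) by (simp only: v1_def act_mult act_V)
      then have "f dvd p ^ Suc a * h * p ^ a" using f(2) by blast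
      then have 1: "f0 dvd p ^ (Suc a + a) * h" unfolding power_add
        by (metis a(1) dvd_mult_right mult.assoc mult.commute)
      obtain s t where "s * p ^ (Suc a + a) + t * f0 = 1" using poly_bezout_power[OF p0 irr a(2)] by blast
      then have eq: "h = s * (p ^ (Suc a + a) * h) + (t * h) * f0"
        by (metis (no_types, lifting) distrib_right mult.assoc mult.commute mult_1)
      have "f0 dvd s * (p ^ (Suc a + a) * h) + (t * h) * f0" by (rule dvd_add[OF dvd_mult[OF 1] dvd_triv_right])
      then show ?thesis by (subst eq)
    qed
    obtain s t where st: "s * p ^ Suc a + t * f0 = 1" using poly_bezout_power[OF p0 irr a(2)] by blast
    have hw1: "act h w1 = 0\<^sub>v n"
    proof -
      have "act f0 (act h v1) = 0\<^sub>v n" using act_comm[OF v1, of f0 h] f0v1 act_0 by simp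
      then have 1: "act f0 (act h w1) = 0\<^sub>v n" by (rule zero_r)
      have 2: "act (p ^ Suc a) (act h w1) = 0\<^sub>v n"
        using w1 by (simp only: act_comm[OF w1(1), of "p ^ Suc a" h] act_0)
      have "act (s * p ^ Suc a + t * f0) (act h w1) = 0\<^sub>v n + 0\<^sub>v n"
        using act_V[OF w1(1), of h] by (simp only: act_add act_mult 1 2 act_0)
      then show ?thesis using act_V[OF w1(1), of h] unfolding st by (simp add: act_1)
    qed
    have pah: "p ^ Suc a dvd h"
    proof -
      obtain b h0 where b: "h = p ^ b * h0" "\<not> p dvd h0" using poly_factor_out_power[OF h(1) p(2)] by blast
      have "\<not> b \<le> a"
      proof
        assume "b \<le> a"
        obtain s t where "s * p ^ Suc a + t * h0 = 1" using poly_bezout_power[OF p0 irr b(2)] by blast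
        then have "p ^ b * (s * p ^ Suc a + t * h0) = p ^ b" by (simp only: mult_1_right)
        moreover have "p ^ b * (s * p ^ Suc a + t * h0) = (s * p ^ b) * p ^ Suc a + t * h"
          by (simp add: b(1) algebra_simps)
        ultimately have "act (p ^ b) w1 = act ((s * p ^ b) * p ^ Suc a + t * h) w1" by (simp only:)
        also have "\<dots> = 0\<^sub>v n + 0\<^sub>v n" using w1(1) by (simp only: act_add act_mult w1(2) hw1 act_0)
        finally have "act (p ^ b) w1 = 0\<^sub>v n" by simp
        then have "act (p ^ a) w1 = 0\<^sub>v n" using \<open>b \<le> a\<close> act_dvd[OF w1(1) le_imp_power_dvd] by blast
        then show False using w1(3) by simp
      qed
      then have "p ^ Suc a dvd p ^ b" by (intro le_imp_power_dvd) simp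
      then show ?thesis unfolding b(1) by (rule dvd_mult2)
    qed
    have "p ^ Suc a * f0 dvd h"
    proof -
      have "h = s * (p ^ Suc a * h) + t * (h * f0)"
        using st by (metis (no_types, lifting) distrib_right mult.assoc mult.commute mult_1)
      moreover have "p ^ Suc a * f0 dvd s * (p ^ Suc a * h) + t * (h * f0)"
        using f0h pah by (intro dvd_add dvd_mult mult_dvd_mono) auto
      ultimately show ?thesis by simp
    qed
    then have "p * f dvd h" by (simp add: a mult_ac)
    then have "degree (p * f) \<le> degree h" by (rule dvd_imp_degree_le[OF _ h(1)])
    also have "\<dots> \<le> degree f" using v(2)[OF u] by (simp add: h_def f_def)
    finally show False using p0 f(1) p(2) by (simp add: degree_mult_eq)
  qed
  then show ?thesis using v(1) f by blast
qed

end

definition poly_mat :: "nat \<Rightarrow> 'a :: comm_ring_1 mat \<Rightarrow> 'a poly \<Rightarrow> 'a mat" where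
  "poly_mat n A p = msum n (\<lambda>k. coeff p k \<cdot>\<^sub>m A ^\<^sub>m k) {..degree p}"

lemma poly_eval_mat_eq: "A \<in> carrier_mat n n \<Longrightarrow> poly_eval_mat p A = poly_mat n A p"
  unfolding poly_eval_mat_def poly_mat_def
  by (rule eq_matI) (auto simp: pow_mat_dim intro!: sum.cong)

lemma poly_mat_index:
  assumes "A \<in> carrier_mat n n" "i < n" "j < n" "degree p \<le> N"
  shows "poly_mat n A p $$ (i, j) = (\<Sum>k\<le>N. coeff p k * (A ^\<^sub>m k) $$ (i, j))"
proof -
  have "(\<Sum>k\<le>N. coeff p k * (A ^\<^sub>m k) $$ (i, j)) = (\<Sum>k\<le>degree p. coeff p k * (A ^\<^sub>m k) $$ (i, j))"
    using assms by (intro sum.mono_neutral_right) (auto simp: coeff_eq_0)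
  then show ?thesis using assms by (simp add: poly_mat_def pow_mat_dim)
qed

lemma poly_mat_carrier [simp]: "poly_mat n A p \<in> carrier_mat n n"
  by (simp add: poly_mat_def)

lemma poly_mat_dim [simp]: "dim_row (poly_mat n A p) = n" "dim_col (poly_mat n A p) = n"
  by (simp_all add: poly_mat_def)

lemma poly_mat_add:
  assumes A: "A \<in> carrier_mat n n"
  shows "poly_mat n A (p + q) = poly_mat n A p + poly_mat n A q"
proof (rule eq_matI, goal_cases)
  case (1 i j)
  then have ij: "i < n" "j < n" by simp_all
  let ?N = "max (degree p) (degree q)"
  show ?case using ij
    by (simp add: poly_mat_index[OF A, of _ _ _ ?N] degree_add_le_max algebra_simps sum.distrib)
qed simp_all

lemma poly_mat_smult:
  assumes A: "A \<in> carrier_mat n n"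
  shows "poly_mat n A (Polynomial.smult a p) = a \<cdot>\<^sub>m poly_mat n A p"
proof (rule eq_matI, goal_cases)
  case (1 i j)
  then have ij: "i < n" "j < n" by simp_all
  show ?case using ij
    by (simp add: poly_mat_index[OF A, of _ _ _ "degree p"] degree_smult_le sum_distrib_left mult.assoc)
qed simp_all

lemma pow_mat_Suc_left:
  assumes "A \<in> carrier_mat n n"
  shows "A ^\<^sub>m Suc k = A * A ^\<^sub>m k"
proof (induction k)
  case (Suc k)
  have "A ^\<^sub>m Suc (Suc k) = (A * A ^\<^sub>m k) * A" using Suc by simp
  also have "\<dots> = A * (A ^\<^sub>m k * A)" using assms by (intro assoc_mult_mat) auto
  finally show ?case by simp
qed (use assms in simp)

lemma poly_mat_pCons:
  assumes A: "A \<in> carrier_mat n n"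
  shows "poly_mat n A (pCons a p) = a \<cdot>\<^sub>m 1\<^sub>m n + A * poly_mat n A p"
proof (rule eq_matI, goal_cases)
  case (1 i j)
  then have ij: "i < n" "j < n" using A by simp_all
  have "poly_mat n A (pCons a p) $$ (i, j) = (\<Sum>k\<le>Suc (degree p). coeff (pCons a p) k * (A ^\<^sub>m k) $$ (i, j))"
    by (rule poly_mat_index[OF A ij]) (simp add: degree_pCons_le)
  also have "\<dots> = a * (1\<^sub>m n $$ (i, j)) + (\<Sum>k\<le>degree p. coeff p k * (A ^\<^sub>m Suc k) $$ (i, j))"
    using A by (subst sum.atMost_Suc_shift) simp
  also have "(\<Sum>k\<le>degree p. coeff p k * (A ^\<^sub>m Suc k) $$ (i, j)) =
      (\<Sum>k\<le>degree p. (A * (coeff p k \<cdot>\<^sub>m A ^\<^sub>m k)) $$ (i, j))"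
    using A ij by (intro sum.cong refl)
      (simp only: pow_mat_Suc_left[OF A], subst mult_smult_distrib[of _ n n _ n], auto)
  also have "\<dots> = (A * poly_mat n A p) $$ (i, j)"
    unfolding poly_mat_def using A ij by (subst mult_msum) auto
  finally show ?case using A ij by simp
qed (use A in simp_all)

lemma poly_mat_0: "A \<in> carrier_mat n n \<Longrightarrow> poly_mat n A 0 = 0\<^sub>m n n"
  by (rule eq_matI) (auto simp: poly_mat_def pow_mat_dim)

lemma poly_mat_const: "A \<in> carrier_mat n n \<Longrightarrow> poly_mat n A [:c:] = c \<cdot>\<^sub>m 1\<^sub>m n"
  using poly_mat_pCons[of A n c 0] by (auto simp: poly_mat_0 intro!: eq_matI)

lemma poly_mat_mult:
  assumes A: "A \<in> carrier_mat n n"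
  shows "poly_mat n A (p * q) = poly_mat n A p * poly_mat n A q"
proof (induction p)
  case 0
  show ?case using A by (simp add: poly_mat_0)
next
  case (pCons a p)
  have "poly_mat n A (pCons a p * q) = a \<cdot>\<^sub>m poly_mat n A q + A * (poly_mat n A p * poly_mat n A q)"
    using A by (simp add: poly_mat_add poly_mat_smult poly_mat_pCons pCons.IH)
      (auto intro!: eq_matI)
  also have "\<dots> = (a \<cdot>\<^sub>m 1\<^sub>m n + A * poly_mat n A p) * poly_mat n A q"
    using A by (simp add: add_mult_distrib_mat[of _ n n _ _ n] mult_smult_assoc_mat[of _ n n _ n]
        assoc_mult_mat[of _ n n _ n _ n])
  finally show ?case using A by (simp add: poly_mat_pCons)
qed

lemma ex_cyclic_vector:
  fixes A :: "'k :: field mat"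
  assumes A: "A \<in> carrier_mat n n" and reg: "regular_mat A"
  shows "\<exists>v\<in>carrier_vec n. det (mat n n (\<lambda>(i, j). (A ^\<^sub>m j *\<^sub>v v) $ i)) \<noteq> 0"
proof -
  define act where "act p v = poly_mat n A p *\<^sub>v v" for p v
  interpret poly_action "carrier_vec n" act n
  proof
    show "act p (0\<^sub>v n) = 0\<^sub>v n" for p by (auto simp: act_def intro!: eq_vecI)
  next
    fix v w :: "'k vec" and p q assume v: "v \<in> carrier_vec n"
    show "act (p + q) v = act p v + act q v"
      using v A by (simp add: act_def poly_mat_add add_mult_distrib_mat_vec[of _ n n])
    show "act (p * q) v = act p (act q v)"
      using v A by (simp add: act_def poly_mat_mult assoc_mult_mat_vec[of _ n n _ n])
    show "act [:c:] v = c \<cdot>\<^sub>v v" for c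
      using v A by (auto simp: act_def poly_mat_const intro!: eq_vecI)
    show "act p (v + w) = act p v + act p w" if "w \<in> carrier_vec n"
      using v that by (simp add: act_def mult_add_distrib_mat_vec[of _ n n])
  qed (auto simp: act_def intro!: carrier_vecI)
  have dimA: "dim_row A = n" using A by simp
  have \<chi>: "monic (char_poly A)" "poly_mat n A (char_poly A) = 0\<^sub>m n n"
    and min: "\<And>q. q \<noteq> 0 \<Longrightarrow> poly_mat n A q = 0\<^sub>m n n \<Longrightarrow> n \<le> degree q"
    using reg degree_monic_char_poly[OF A]
    by (auto simp: regular_mat_def is_minimal_poly_def poly_eval_mat_eq[OF A] dimA)
  have "act (char_poly A) v = 0\<^sub>v n" if "v \<in> carrier_vec n" for v
    using that by (auto simp: act_def \<chi> intro!: eq_vecI)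
  moreover have "char_poly A \<noteq> 0" using \<chi>(1) by auto
  ultimately obtain v f where v: "v \<in> carrier_vec n" and f: "f \<noteq> 0"
      "\<And>p. act p v = 0\<^sub>v n \<longleftrightarrow> f dvd p" "\<And>w. w \<in> carrier_vec n \<Longrightarrow> act f w = 0\<^sub>v n"
    using ex_vector_with_full_annihilator[of "char_poly A"] by blast
  have "poly_mat n A f = 0\<^sub>m n n"
  proof (rule eq_matI, goal_cases)
    case (1 i j)
    then have "act f (unit_vec n j) $ i = 0" using f(3)[of "unit_vec n j"] by simp
    then show ?case using 1 by (simp add: act_def)
  qed simp_all
  then have nf: "n \<le> degree f" using min f(1) by blast
  define K where "K = mat n n (\<lambda>(i, j). (A ^\<^sub>m j *\<^sub>v v) $ i)"
  have K: "K \<in> carrier_mat n n" by (simp add: K_def)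
  have "det K \<noteq> 0"
  proof
    assume "det K = 0"
    then obtain c where c: "c \<in> carrier_vec n" "c \<noteq> 0\<^sub>v n" "K *\<^sub>v c = 0\<^sub>v n"
      using det_0_iff_vec_prod_zero_field[OF K] by blast
    define q where "q = (\<Sum>j<n. monom (c $ j) j)"
    have cq: "coeff q k = (if k < n then c $ k else 0)" for k
      by (auto simp: q_def coeff_sum sum.delta)
    have "n > 0" using c by (metis carrier_vecD gr0I vec_of_dim_0)
    have dq: "degree q \<le> n - 1" by (rule degree_le) (auto simp: cq)
    have "q \<noteq> 0"
    proof
      assume "q = 0"
      then have "c $ k = 0" if "k < n" for k using cq[of k] that by simp
      then show False using c by (auto intro!: eq_vecI)
    qed
    have "act q v = 0\<^sub>v n"
    proof (rule eq_vecI, goal_cases)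
      case (1 i)
      then have i: "i < n" by simp
      have "act q v $ i = (\<Sum>j<n. poly_mat n A q $$ (i, j) * v $ j)"
        unfolding act_def by (rule index_mult_vec_sum[OF _ v i]) simp
      also have "\<dots> = (\<Sum>j<n. (\<Sum>k<n. c $ k * (A ^\<^sub>m k) $$ (i, j)) * v $ j)"
      proof (intro sum.cong refl, goal_cases)
        case (1 j)
        then have "poly_mat n A q $$ (i, j) = (\<Sum>k\<le>n - 1. coeff q k * (A ^\<^sub>m k) $$ (i, j))"
          by (intro poly_mat_index[OF A i _ dq]) simp
        also have "{..n - 1} = {..<n}" using \<open>n > 0\<close> by auto
        finally show ?case by (simp add: cq)
      qed
      also have "\<dots> = (\<Sum>k<n. (\<Sum>j<n. (A ^\<^sub>m k) $$ (i, j) * v $ j) * c $ k)"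
        unfolding sum_distrib_right by (subst sum.swap) (simp add: mult_ac)
      also have "\<dots> = (\<Sum>k<n. K $$ (i, k) * c $ k)"
      proof (intro sum.cong refl, goal_cases)
        case (1 k)
        have "(A ^\<^sub>m k *\<^sub>v v) $ i = (\<Sum>j<n. (A ^\<^sub>m k) $$ (i, j) * v $ j)"
          by (rule index_mult_vec_sum[OF pow_carrier_mat[OF A] v i])
        then show ?case using 1 i by (simp add: K_def)
      qed
      also have "\<dots> = (K *\<^sub>v c) $ i" by (rule index_mult_vec_sum[OF K c(1) i, symmetric])
      finally show ?case using c(3) i by simp
    qed (simp add: act_def)
    then have "f dvd q" using f(2) by blast
    then have "degree f \<le> degree q" by (rule dvd_imp_degree_le[OF _ \<open>q \<noteq> 0\<close>])
    then show False using nf dq \<open>n > 0\<close> by simp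
  qed
  then show ?thesis using v unfolding K_def by blast
qed

subsection \<open>The general linear group\<close>

lemma minus_carrier_mat_iff [simp]:
  "A - B \<in> carrier_mat nr nc \<longleftrightarrow> dim_row B = nr \<and> dim_col B = nc"
  unfolding carrier_mat_def by simp

lemma GL_carrier: "g \<in> GL n \<Longrightarrow> g \<in> carrier_mat n n"
  by (simp add: GL_def)

lemma GL_one: "1\<^sub>m n \<in> GL n"
  by (simp add: GL_def)

lemma GL_mult: "g \<in> GL n \<Longrightarrow> h \<in> GL n \<Longrightarrow> g * h \<in> GL n"
  unfolding GL_def using mult_dvd_mono[of "det g" 1 "det h" 1] by (auto simp: det_mult)

lemma GL_inverse:
  assumes "g \<in> GL n"
  shows "\<exists>g'\<in>GL n. g' * g = 1\<^sub>m n \<and> g * g' = 1\<^sub>m n"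
proof -
  have g: "g \<in> carrier_mat n n" using assms by (rule GL_carrier)
  obtain u where u: "1 = det g * u" using assms by (auto simp: GL_def elim: dvdE)
  define g' where "g' = u \<cdot>\<^sub>m adj_mat g"
  have g': "g' \<in> carrier_mat n n" using adj_mat(1)[OF g] by (simp add: g'_def)
  have 1: "g * g' = 1\<^sub>m n" "g' * g = 1\<^sub>m n"
    using adj_mat[OF g] g u
    by (auto simp: g'_def mult_smult_distrib[of _ n n _ n] mult_smult_assoc_mat[of _ n n _ n] smult_smult_mat mult.commute[of u])
  have "det g * det g' = 1" using 1(1) det_mult[OF g g'] by simp
  then have "g' \<in> GL n" using g' by (simp add: GL_def) (metis dvdI mult.commute)
  then show ?thesis using 1 by blast
qed

lemma SL_subset_GL: "SL n \<subseteq> GL n"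
  by (auto simp: SL_def GL_def)

lemma SL_normal:
  assumes "g' \<in> GL n" "g \<in> GL n" "g' * g = 1\<^sub>m n" "h \<in> SL n"
  shows "g' * h * g \<in> SL n"
proof -
  have c: "g' \<in> carrier_mat n n" "g \<in> carrier_mat n n" "h \<in> carrier_mat n n"
    using assms by (auto simp: GL_def SL_def)
  have "det g' * det g = 1" using det_mult[OF c(1,2)] assms(3) by simp
  moreover have "det (g' * h * g) = det g' * det h * det g"
    using c by (simp add: det_mult[of _ n])
  ultimately show ?thesis using assms(4) c by (simp add: SL_def mult_ac)
qed

definition strict_upper :: "nat \<Rightarrow> 'a :: comm_ring_1 mat set" where
  "strict_upper n = {\<nu> \<in> carrier_mat n n. \<forall>i<n. \<forall>j\<le>i. \<nu> $$ (i, j) = 0}"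

lemma strict_upperD:
  "\<nu> \<in> strict_upper n \<Longrightarrow> \<nu> \<in> carrier_mat n n"
  "\<nu> \<in> strict_upper n \<Longrightarrow> i < n \<Longrightarrow> j \<le> i \<Longrightarrow> \<nu> $$ (i, j) = 0"
  by (auto simp: strict_upper_def)

lemma strict_upper_zero: "0\<^sub>m n n \<in> strict_upper n"
  by (auto simp: strict_upper_def)

lemma strict_upper_add:
  "\<nu> \<in> strict_upper n \<Longrightarrow> \<mu> \<in> strict_upper n \<Longrightarrow> \<nu> + \<mu> \<in> strict_upper n"
  by (auto simp: strict_upper_def)

lemma strict_upper_smult: "\<nu> \<in> strict_upper n \<Longrightarrow> a \<cdot>\<^sub>m \<nu> \<in> strict_upper n"
  by (auto simp: strict_upper_def)

lemma strict_upper_mult_index: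
  assumes "\<nu> \<in> strict_upper n" "\<mu> \<in> strict_upper n" "i < n" "j \<le> Suc i" "j < n"
  shows "(\<nu> * \<mu>) $$ (i, j) = 0"
proof -
  have "(\<nu> * \<mu>) $$ (i, j) = (\<Sum>k<n. \<nu> $$ (i, k) * \<mu> $$ (k, j))"
    using assms by (intro index_mult_sum[of _ n n _ n]) (auto dest: strict_upperD)
  also have "\<dots> = 0"
  proof (intro sum.neutral ballI)
    fix k assume "k \<in> {..<n}"
    then show "\<nu> $$ (i, k) * \<mu> $$ (k, j) = 0"
      using assms strict_upperD(2)[OF assms(1,3), of k] strict_upperD(2)[OF assms(2), of k j]
      by (cases "k \<le> i") auto
  qed
  finally show ?thesis .
qed

lemma strict_upper_mult:
  "\<nu> \<in> strict_upper n \<Longrightarrow> \<mu> \<in> strict_upper n \<Longrightarrow> \<nu> * \<mu> \<in> strict_upper n"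
  using strict_upper_mult_index[of \<nu> n \<mu>] strict_upperD(1)[of \<nu> n] strict_upperD(1)[of \<mu> n]
  by (subst strict_upper_def) (auto simp del: index_mult_mat(1))

lemma det_one_plus_strict_upper:
  assumes "\<nu> \<in> strict_upper n"
  shows "det (1\<^sub>m n + \<nu>) = 1"
proof -
  have c: "1\<^sub>m n + \<nu> \<in> carrier_mat n n" using assms by (auto dest: strict_upperD)
  have "upper_triangular (1\<^sub>m n + \<nu>)"
    using assms c by (auto simp: upper_triangular_def strict_upper_def)
  then have "det (1\<^sub>m n + \<nu>) = prod_list (diag_mat (1\<^sub>m n + \<nu>))"
    by (rule det_upper_triangular[OF _ c])
  also have "\<dots> = (\<Prod>i = 0..<n. (1\<^sub>m n + \<nu>) $$ (i, i))"
    using c by (simp only: prod_list_diag_prod carrier_matD)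
  also have "\<dots> = 1" using assms by (intro prod.neutral) (auto simp: strict_upper_def)
  finally show ?thesis .
qed

lemma one_plus_strict_upper_SL: "\<nu> \<in> strict_upper n \<Longrightarrow> 1\<^sub>m n + \<nu> \<in> SL n"
  using det_one_plus_strict_upper by (auto simp: SL_def dest: strict_upperD)

subsection \<open>Companion matrices\<close>

definition companion :: "nat \<Rightarrow> 'a :: comm_ring_1 mat \<Rightarrow> bool" where
  "companion n X \<longleftrightarrow> X \<in> carrier_mat n n \<and>
     (\<forall>i<n. \<forall>j. Suc j < n \<longrightarrow> X $$ (i, j) = (if i = Suc j then 1 else 0))"

lemma companionD:
  "companion n X \<Longrightarrow> X \<in> carrier_mat n n"
  "companion n X \<Longrightarrow> i < n \<Longrightarrow> Suc j < n \<Longrightarrow> X $$ (i, j) = (if i = Suc j then 1 else 0)"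
  by (auto simp: companion_def)

lemma mult_companion_index:
  assumes X: "companion n X" and A: "A \<in> carrier_mat n n" and ij: "i < n" "Suc j < n"
  shows "(A * X) $$ (i, j) = A $$ (i, Suc j)"
proof -
  have "(A * X) $$ (i, j) = (\<Sum>k<n. A $$ (i, k) * X $$ (k, j))"
    using companionD(1)[OF X] A ij by (intro index_mult_sum[of _ n n _ n]) auto
  also have "\<dots> = (\<Sum>k<n. if k = Suc j then A $$ (i, k) else 0)"
    using companionD(2)[OF X _ ij(2)] by (intro sum.cong) auto
  also have "\<dots> = A $$ (i, Suc j)" using ij by (simp add: sum.delta)
  finally show ?thesis .
qed

lemma companion_pow_first_col:
  assumes X: "companion n X" and "k < n" "i < n"
  shows "(X ^\<^sub>m k) $$ (i, 0) = (if i = k then 1 else 0)"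
  using assms(2,3)
proof (induction k arbitrary: i)
  case 0
  then show ?case using companionD(1)[OF X] by simp
next
  case (Suc k)
  have Xc: "X \<in> carrier_mat n n" by (rule companionD(1)[OF X])
  have "(X ^\<^sub>m Suc k) $$ (i, 0) = (\<Sum>j<n. X $$ (i, j) * (X ^\<^sub>m k) $$ (j, 0))"
    unfolding pow_mat_Suc_left[OF Xc] using Suc.prems Xc by (intro index_mult_sum[of _ n n _ n]) auto
  also have "\<dots> = (\<Sum>j<n. if j = k then X $$ (i, j) else 0)"
    using Suc by (intro sum.cong) auto
  also have "\<dots> = (if i = Suc k then 1 else 0)"
    using Suc.prems companionD(2)[OF X, of i k] by (simp add: sum.delta)
  finally show ?case .
qed

lemma commuting_companion_eq_0:
  assumes X: "companion n X" and A: "A \<in> carrier_mat n n"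
    and comm: "A * X = X * A" and col: "\<And>i. i < n \<Longrightarrow> A $$ (i, 0) = 0"
  shows "A = 0\<^sub>m n n"
proof -
  have "j < n \<Longrightarrow> \<forall>i<n. A $$ (i, j) = 0" for j
  proof (induction j)
    case (Suc j)
    show ?case
    proof (intro allI impI)
      fix i assume i: "i < n"
      have "A $$ (i, Suc j) = (X * A) $$ (i, j)"
        using mult_companion_index[OF X A i Suc.prems] comm by simp
      also have "\<dots> = (\<Sum>k<n. X $$ (i, k) * A $$ (k, j))"
        using companionD(1)[OF X] A i Suc.prems by (intro index_mult_sum[of _ n n _ n]) auto
      also have "\<dots> = 0" using Suc by (intro sum.neutral) auto
      finally show "A $$ (i, Suc j) = 0" .
    qed
  qed (use col in simp)
  then show ?thesis using A by (intro eq_matI) auto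
qed

definition mat_poly :: "nat \<Rightarrow> 'a :: comm_ring_1 mat \<Rightarrow> (nat \<Rightarrow> 'a) \<Rightarrow> 'a mat" where
  "mat_poly n X w = msum n (\<lambda>k. w k \<cdot>\<^sub>m X ^\<^sub>m k) {..<n}"

lemma mat_poly_carrier [simp]: "mat_poly n X w \<in> carrier_mat n n"
  by (simp add: mat_poly_def)

lemma mat_poly_dim [simp]: "dim_row (mat_poly n X w) = n" "dim_col (mat_poly n X w) = n"
  by (simp_all add: mat_poly_def)

lemma mat_poly_comm:
  assumes X: "X \<in> carrier_mat n n"
  shows "mat_poly n X w * X = X * mat_poly n X w"
proof -
  have "w k \<cdot>\<^sub>m X ^\<^sub>m k * X = X * (w k \<cdot>\<^sub>m X ^\<^sub>m k)" for k
    using X pow_mat_Suc_left[OF X, of k]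
    by (simp add: mult_smult_distrib[of _ n n _ n] mult_smult_assoc_mat[of _ n n _ n])
  then show ?thesis using X by (simp add: mat_poly_def mult_msum msum_mult)
qed

lemma mat_poly_first_col:
  assumes X: "companion n X" and i: "i < n"
  shows "mat_poly n X w $$ (i, 0) = w i"
proof -
  have Xc: "X \<in> carrier_mat n n" by (rule companionD(1)[OF X])
  have "mat_poly n X w $$ (i, 0) = (\<Sum>k<n. (w k \<cdot>\<^sub>m X ^\<^sub>m k) $$ (i, 0))"
    using i by (simp add: mat_poly_def)
  also have "\<dots> = (\<Sum>k<n. if k = i then w k else 0)"
    using companion_pow_first_col[OF X _ i] i Xc by (intro sum.cong) (auto simp: pow_mat_dim)
  also have "\<dots> = w i" using i by (simp add: sum.delta)
  finally show ?thesis .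
qed

lemma ex_commuting_with_first_col:
  assumes "companion n X"
  shows "\<exists>c\<in>carrier_mat n n. c * X = X * c \<and> (\<forall>i<n. c $$ (i, 0) = w i)"
  using mat_poly_comm[OF companionD(1)[OF assms]] mat_poly_first_col[OF assms]
  by (intro bexI[of _ "mat_poly n X w"]) auto

lemma smult_eq_0_if_commuting:
  assumes X: "companion n X" and A: "A \<in> carrier_mat n n"
    and comm: "\<kappa> \<cdot>\<^sub>m (A * X - X * A) = 0\<^sub>m n n" and col: "\<And>i. i < n \<Longrightarrow> \<kappa> * A $$ (i, 0) = 0"
  shows "\<kappa> \<cdot>\<^sub>m A = 0\<^sub>m n n"
proof (rule commuting_companion_eq_0[OF X])
  have Xc: "X \<in> carrier_mat n n" by (rule companionD(1)[OF X])
  have c: "A * X \<in> carrier_mat n n" "X * A \<in> carrier_mat n n" using A Xc by auto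
  have "\<kappa> \<cdot>\<^sub>m (A * X) = \<kappa> \<cdot>\<^sub>m (X * A)"
  proof (rule eq_matI, goal_cases)
    case (1 i j)
    then have ij: "i < n" "j < n" using A Xc by auto
    have "(\<kappa> \<cdot>\<^sub>m (A * X - X * A)) $$ (i, j) = \<kappa> * ((A * X) $$ (i, j) - (X * A) $$ (i, j))"
      using ij c A Xc by (simp del: index_mult_mat(1))
    then have "\<kappa> * ((A * X) $$ (i, j) - (X * A) $$ (i, j)) = 0" using ij by (simp only: comm index_zero_mat)
    then show ?case using ij A Xc by (simp del: index_mult_mat(1) add: right_diff_distrib)
  qed (use A Xc in auto)
  then show "\<kappa> \<cdot>\<^sub>m A * X = X * (\<kappa> \<cdot>\<^sub>m A)" using A Xc
    by (simp add: mult_smult_distrib[of _ n n _ n] mult_smult_assoc_mat[of _ n n _ n])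
  show "(\<kappa> \<cdot>\<^sub>m A) $$ (i, 0) = 0" if "i < n" for i using col[OF that] that A by simp
qed (use A in simp)

lemma commuting_diff:
  assumes "a \<in> carrier_mat n n" "c \<in> carrier_mat n n" "X \<in> carrier_mat n n" "c * X = X * c"
  shows "(a - c) * X - X * (a - c) = a * X - X * (a :: 'a :: comm_ring_1 mat)"
proof -
  have *: "(a - c) * X = a * X - X * c" "X * (a - c) = X * a - X * c"
    using assms by (simp_all add: minus_mult_distrib_mat[of _ n n _ _ n] mult_minus_distrib_mat[of _ n n _ n])
  have "a * X \<in> carrier_mat n n" "X * c \<in> carrier_mat n n" "X * a \<in> carrier_mat n n" using assms by auto
  then show ?thesis unfolding * by (intro eq_matI) (auto simp del: index_mult_mat(1))
qed

lemma commuting_approximation: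
  assumes X: "companion n X" and a: "a \<in> carrier_mat n n"
    and comm: "\<kappa> \<cdot>\<^sub>m (a * X - X * a) = 0\<^sub>m n n"
  shows "\<exists>c\<in>carrier_mat n n. c * X = X * c \<and> \<kappa> \<cdot>\<^sub>m (a - c) = 0\<^sub>m n n"
proof -
  obtain c where c: "c \<in> carrier_mat n n" "c * X = X * c" "\<And>i. i < n \<Longrightarrow> c $$ (i, 0) = a $$ (i, 0)"
    using ex_commuting_with_first_col[OF X, of "\<lambda>i. a $$ (i, 0)"] by blast
  have "\<kappa> \<cdot>\<^sub>m (a - c) = 0\<^sub>m n n"
  proof (rule smult_eq_0_if_commuting[OF X])
    show "a - c \<in> carrier_mat n n" using a c by simp
    show "\<kappa> \<cdot>\<^sub>m ((a - c) * X - X * (a - c)) = 0\<^sub>m n n"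
      using commuting_diff[OF a c(1) companionD(1)[OF X] c(2)] comm by simp
    show "\<kappa> * (a - c) $$ (i, 0) = 0" if "i < n" for i using that c a by simp
  qed
  then show ?thesis using c by blast
qed

lemma commutator_lower_zero:
  assumes X: "companion n X" and b: "b \<in> carrier_mat n n"
    and lower: "\<And>i j. i < n \<Longrightarrow> j < i \<Longrightarrow> \<kappa> * (b * X - X * b) $$ (i, j) = 0"
  shows "\<exists>\<nu>\<in>strict_upper n. \<exists>s\<in>carrier_mat n n. s * X = X * s \<and> \<kappa> \<cdot>\<^sub>m (b - \<nu> - s) = 0\<^sub>m n n"
proof -
  have Xc: "X \<in> carrier_mat n n" by (rule companionD(1)[OF X])
  obtain s where s: "s \<in> carrier_mat n n" "s * X = X * s" "\<And>i. i < n \<Longrightarrow> s $$ (i, 0) = b $$ (i, 0)"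
    using ex_commuting_with_first_col[OF X, of "\<lambda>i. b $$ (i, 0)"] by blast
  define a where "a = b - s"
  have a: "a \<in> carrier_mat n n" using b s by (simp add: a_def)
  have comm: "a * X - X * a = b * X - X * b" unfolding a_def by (rule commuting_diff[OF b s(1) Xc s(2)])
  have "j < n \<Longrightarrow> \<forall>i<n. j \<le> i \<longrightarrow> \<kappa> * a $$ (i, j) = 0" for j
  proof (induction j)
    case 0
    then show ?case using s b by (simp add: a_def)
  next
    case (Suc j)
    show ?case
    proof (intro allI impI)
      fix i assume i: "i < n" "Suc j \<le> i"
      have "(a * X - X * a) $$ (i, j) = a $$ (i, Suc j) - (X * a) $$ (i, j)"
        using a Xc i Suc.prems mult_companion_index[OF X a i(1) Suc.prems] by (simp del: index_mult_mat(1))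
      then have "\<kappa> * a $$ (i, Suc j) = \<kappa> * (X * a) $$ (i, j)"
        using lower[of i j] i by (simp add: comm right_diff_distrib)
      also have "(X * a) $$ (i, j) = (\<Sum>k<n. X $$ (i, k) * a $$ (k, j))"
        using a Xc i Suc.prems by (intro index_mult_sum[of _ n n _ n]) auto
      also have "\<kappa> * \<dots> = (\<Sum>k<n. X $$ (i, k) * (\<kappa> * a $$ (k, j)))"
        by (simp add: sum_distrib_left mult_ac)
      also have "\<dots> = 0"
      proof (intro sum.neutral ballI)
        fix k assume k: "k \<in> {..<n}"
        show "X $$ (i, k) * (\<kappa> * a $$ (k, j)) = 0"
        proof (cases "j \<le> k")
          case True then show ?thesis using Suc k by simp
        next
          case False
          then show ?thesis using companionD(2)[OF X i(1), of k] i Suc.prems by simp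
        qed
      qed
      finally show "\<kappa> * a $$ (i, Suc j) = 0" .
    qed
  qed
  then have low: "\<kappa> * a $$ (i, j) = 0" if "i < n" "j \<le> i" for i j using that by simp
  define \<nu> where "\<nu> = mat n n (\<lambda>(i, j). if i < j then a $$ (i, j) else 0)"
  have "\<nu> \<in> strict_upper n" by (auto simp: \<nu>_def strict_upper_def)
  moreover have "\<kappa> \<cdot>\<^sub>m (b - \<nu> - s) = 0\<^sub>m n n"
  proof (rule eq_matI, goal_cases)
    case (1 i j)
    then have "(\<kappa> \<cdot>\<^sub>m (b - \<nu> - s)) $$ (i, j) = \<kappa> * (a $$ (i, j) - (if i < j then a $$ (i, j) else 0))"
      using b s by (simp add: a_def \<nu>_def)
    also have "\<dots> = 0" using low[of i j] 1 by simp
    finally show ?case using 1 by simp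
  qed (use b s in \<open>auto simp: \<nu>_def\<close>)
  ultimately show ?thesis using s by blast
qed

lemma companion_pow_n:
  assumes X: "companion n X" and n: "n > 0"
  shows "X ^\<^sub>m n = mat_poly n X (\<lambda>k. X $$ (k, n - 1))"
    and "i < n \<Longrightarrow> (X ^\<^sub>m n) $$ (i, 0) = X $$ (i, n - 1)"
proof -
  have Xc: "X \<in> carrier_mat n n" by (rule companionD(1)[OF X])
  have first: "(X ^\<^sub>m n) $$ (i, 0) = X $$ (i, n - 1)" if i: "i < n" for i
  proof -
    have "(X ^\<^sub>m Suc (n - 1)) $$ (i, 0) = (\<Sum>j<n. X $$ (i, j) * (X ^\<^sub>m (n - 1)) $$ (j, 0))"
      unfolding pow_mat_Suc_left[OF Xc] using i Xc by (intro index_mult_sum[of _ n n _ n]) auto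
    also have "\<dots> = (\<Sum>j<n. if j = n - 1 then X $$ (i, j) else 0)"
      using companion_pow_first_col[OF X, of "n - 1"] n by (intro sum.cong) auto
    also have "\<dots> = X $$ (i, n - 1)" using n by (simp add: sum.delta)
    finally show ?thesis using n by simp
  qed
  then show "i < n \<Longrightarrow> (X ^\<^sub>m n) $$ (i, 0) = X $$ (i, n - 1)" .
  define c where "c = mat_poly n X (\<lambda>k. X $$ (k, n - 1))"
  have "X ^\<^sub>m n - c = 0\<^sub>m n n"
  proof (rule commuting_companion_eq_0[OF X])
    have "X ^\<^sub>m n * X = X * X ^\<^sub>m n" using pow_mat_Suc_left[OF Xc, of n] by simp
    then show "(X ^\<^sub>m n - c) * X = X * (X ^\<^sub>m n - c)"
      using Xc mat_poly_comm[OF Xc] by (simp add: c_def minus_mult_distrib_mat[of _ n n _ _ n] mult_minus_distrib_mat[of _ n n _ n])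
    show "(X ^\<^sub>m n - c) $$ (i, 0) = 0" if "i < n" for i
      using that first[OF that] mat_poly_first_col[OF X that, of "\<lambda>k. X $$ (k, n - 1)"] by (simp add: c_def pow_mat_dim carrier_matD[OF mat_poly_carrier])
  qed (use Xc in \<open>simp add: c_def\<close>)
  then have "(X ^\<^sub>m n - c) $$ (i, j) = 0" if "i < n" "j < n" for i j using that by simp
  then show "X ^\<^sub>m n = mat_poly n X (\<lambda>k. X $$ (k, n - 1))"
    unfolding c_def[symmetric] using Xc by (intro eq_matI) (auto simp: c_def pow_mat_dim carrier_matD[OF mat_poly_carrier])
qed

lemma similar_companion_eq:
  assumes X: "companion n X" and X': "companion n X'"
    and g: "g \<in> carrier_mat n n" "g' \<in> carrier_mat n n" "g' * g = 1\<^sub>m n"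
    and sim: "\<kappa> \<cdot>\<^sub>m (g * X - X' * g) = 0\<^sub>m n n"
  shows "\<kappa> \<cdot>\<^sub>m (X - X') = 0\<^sub>m n n"
proof (cases "n = 0")
  case True
  then show ?thesis using companionD(1)[OF X] companionD(1)[OF X'] by (intro eq_matI) auto
next
  case False
  have Xc: "X \<in> carrier_mat n n" and X'c: "X' \<in> carrier_mat n n"
    using companionD(1)[OF X] companionD(1)[OF X'] by auto
  have 1: "\<kappa> \<cdot>\<^sub>m (g * X) = \<kappa> \<cdot>\<^sub>m (X' * g)"
  proof (rule eq_matI, goal_cases)
    case (1 i j)
    then have ij: "i < n" "j < n" using g X'c by auto
    have "(\<kappa> \<cdot>\<^sub>m (g * X - X' * g)) $$ (i, j) = \<kappa> * ((g * X) $$ (i, j) - (X' * g) $$ (i, j))"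
      using ij g Xc X'c by (simp del: index_mult_mat(1))
    then have "\<kappa> * ((g * X) $$ (i, j) - (X' * g) $$ (i, j)) = 0" using ij by (simp only: sim index_zero_mat)
    then show ?case using ij g Xc X'c by (simp del: index_mult_mat(1) add: right_diff_distrib)
  qed (use g Xc X'c in auto)
  have pow: "\<kappa> \<cdot>\<^sub>m (g * X ^\<^sub>m k) = \<kappa> \<cdot>\<^sub>m (X' ^\<^sub>m k * g)" for k
  proof (induction k)
    case (Suc k)
    have "\<kappa> \<cdot>\<^sub>m (g * X ^\<^sub>m Suc k) = (\<kappa> \<cdot>\<^sub>m (g * X ^\<^sub>m k)) * X"
      using g Xc by (simp add: mult_smult_assoc_mat[of _ n n _ n] assoc_mult_mat[of _ n n _ n _ n])
    also have "\<dots> = X' ^\<^sub>m k * (\<kappa> \<cdot>\<^sub>m (g * X))"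
      unfolding Suc using g Xc X'c by (simp add: mult_smult_assoc_mat[of _ n n _ n] mult_smult_distrib[of _ n n _ n] assoc_mult_mat[of _ n n _ n _ n])
    also have "\<dots> = \<kappa> \<cdot>\<^sub>m (X' ^\<^sub>m Suc k * g)"
      unfolding 1 using g Xc X'c by (simp add: mult_smult_distrib[of _ n n _ n] assoc_mult_mat[of _ n n _ n _ n])
    finally show ?case .
  qed (use g Xc X'c in simp)
  define w where "w = (\<lambda>k. X' $$ (k, n - 1))"
  have "\<kappa> \<cdot>\<^sub>m (g * mat_poly n X w) = msum n (\<lambda>k. w k \<cdot>\<^sub>m (\<kappa> \<cdot>\<^sub>m (g * X ^\<^sub>m k))) {..<n}"
    using g Xc by (simp add: mat_poly_def mult_msum smult_msum mult_smult_distrib[of _ n n _ n] smult_smult_mat mult.commute)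
  also have "\<dots> = \<kappa> \<cdot>\<^sub>m (mat_poly n X' w * g)"
    unfolding pow using g X'c by (simp add: mat_poly_def msum_mult smult_msum mult_smult_assoc_mat[of _ n n _ n] smult_smult_mat mult.commute)
  also have "\<dots> = \<kappa> \<cdot>\<^sub>m (g * X ^\<^sub>m n)"
    unfolding pow w_def by (subst companion_pow_n(1)[OF X']) (use False in simp_all)
  finally have "g' * (\<kappa> \<cdot>\<^sub>m (g * mat_poly n X w)) = g' * (\<kappa> \<cdot>\<^sub>m (g * X ^\<^sub>m n))" by simp
  moreover have "g' * (\<kappa> \<cdot>\<^sub>m (g * M)) = \<kappa> \<cdot>\<^sub>m M" if M: "M \<in> carrier_mat n n" for M
  proof -
    have "g' * (g * M) = (g' * g) * M" using g(1,2) M by (simp add: assoc_mult_mat[of _ n n _ n _ n])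
    also have "\<dots> = M" using M by (simp add: g(3))
    finally show ?thesis using g(1,2) M by (simp add: mult_smult_distrib[of _ n n _ n])
  qed
  ultimately have 2: "\<kappa> \<cdot>\<^sub>m mat_poly n X w = \<kappa> \<cdot>\<^sub>m X ^\<^sub>m n" using Xc by simp
  show ?thesis
  proof (rule eq_matI, goal_cases)
    case (1 i j)
    then have ij: "i < n" "j < n" by auto
    have "\<kappa> * X $$ (i, j) = \<kappa> * X' $$ (i, j)"
    proof (cases "Suc j < n")
      case True
      then show ?thesis using companionD(2)[OF X] companionD(2)[OF X'] ij by simp
    next
      case False
      then have j: "j = n - 1" using ij by simp
      have "\<kappa> * w i = (\<kappa> \<cdot>\<^sub>m mat_poly n X w) $$ (i, 0)"
        using ij mat_poly_first_col[OF X ij(1), of w] by (simp add: carrier_matD[OF mat_poly_carrier])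
      also have "\<dots> = \<kappa> * X $$ (i, n - 1)"
        unfolding 2 using ij Xc companion_pow_n(2)[OF X _ ij(1)] by (simp add: pow_mat_dim)
      finally show ?thesis by (simp add: j w_def)
    qed
    then show ?case using ij Xc X'c by (simp add: right_diff_distrib)
  qed (use Xc X'c in auto)
qed

lemma companion_conjugate:
  assumes Y: "Y \<in> carrier_mat n n" and P: "P \<in> carrier_mat n n" "P' \<in> carrier_mat n n" "P' * P = 1\<^sub>m n"
    and YP: "\<And>k j. k < n \<Longrightarrow> Suc j < n \<Longrightarrow> (Y * P) $$ (k, j) = P $$ (k, Suc j)"
  shows "companion n (P' * (Y * P))"
  unfolding companion_def
proof (intro conjI allI impI)
  fix i j assume i: "i < n" and j: "Suc j < n"
  have "(P' * (Y * P)) $$ (i, j) = (\<Sum>k<n. P' $$ (i, k) * (Y * P) $$ (k, j))"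
    using P Y i j by (intro index_mult_sum[of _ n n _ n]) auto
  also have "\<dots> = (\<Sum>k<n. P' $$ (i, k) * P $$ (k, Suc j))" using j by (intro sum.cong) (auto simp: YP simp del: index_mult_mat(1))
  also have "\<dots> = (P' * P) $$ (i, Suc j)"
    using P i j by (intro index_mult_sum[of _ n n _ n, symmetric]) auto
  finally show "(P' * (Y * P)) $$ (i, j) = (if i = Suc j then 1 else 0)" using i j by (simp add: P(3) del: index_mult_mat(1))
qed (use P in simp)

lemma krylov_shift:
  fixes Y :: "'a :: comm_ring_1 mat"
  assumes Y: "Y \<in> carrier_mat n n" and v: "v \<in> carrier_vec n" and k: "k < n" "Suc j < n"
    and P: "P = mat n n (\<lambda>(i, j). (Y ^\<^sub>m j *\<^sub>v v) $ i)"
  shows "(Y * P) $$ (k, j) = P $$ (k, Suc j)"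
proof -
  have u: "Y ^\<^sub>m j *\<^sub>v v \<in> carrier_vec n" using Y by simp
  have "(Y * P) $$ (k, j) = (\<Sum>a<n. Y $$ (k, a) * (Y ^\<^sub>m j *\<^sub>v v) $ a)"
    using Y k by (subst index_mult_sum[of _ n n _ n]) (auto simp: P simp del: index_mult_mat_vec)
  also have "\<dots> = (Y *\<^sub>v (Y ^\<^sub>m j *\<^sub>v v)) $ k" by (rule index_mult_vec_sum[OF Y u k(1), symmetric])
  also have "Y *\<^sub>v (Y ^\<^sub>m j *\<^sub>v v) = (Y * Y ^\<^sub>m j) *\<^sub>v v" using Y v by (intro assoc_mult_mat_vec[symmetric]) auto
  finally show ?thesis using k by (simp only: P pow_mat_Suc_left[OF Y, symmetric] index_mat split)
qed

lemma hessenberg_similar_companion: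
  fixes Y :: "'a :: comm_ring_1 mat"
  assumes Y: "Y \<in> carrier_mat n n" and hess: "\<And>i j. i < n \<Longrightarrow> j < i \<Longrightarrow> Y $$ (i, j) = (if i = Suc j then 1 else 0)"
  shows "\<exists>\<nu>\<in>strict_upper n. \<exists>X. companion n X \<and> Y * (1\<^sub>m n + \<nu>) = (1\<^sub>m n + \<nu>) * X"
proof -
  define u where "u = mat n n (\<lambda>(i, j). (Y ^\<^sub>m j) $$ (i, 0))"
  have u: "u \<in> carrier_mat n n" by (simp add: u_def)
  have col: "j < n \<Longrightarrow> \<forall>i<n. j \<le> i \<longrightarrow> (Y ^\<^sub>m j) $$ (i, 0) = (if i = j then 1 else 0)" for j
  proof (induction j)
    case (Suc j)
    show ?case
    proof (intro allI impI)
      fix i assume i: "i < n" "Suc j \<le> i"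
      have "(Y ^\<^sub>m Suc j) $$ (i, 0) = (\<Sum>k<n. Y $$ (i, k) * (Y ^\<^sub>m j) $$ (k, 0))"
        unfolding pow_mat_Suc_left[OF Y] using i Y by (intro index_mult_sum[of _ n n _ n]) auto
      also have "\<dots> = (\<Sum>k<n. if k = j then Y $$ (i, j) else 0)"
      proof (intro sum.cong refl)
        fix k assume k: "k \<in> {..<n}"
        show "Y $$ (i, k) * (Y ^\<^sub>m j) $$ (k, 0) = (if k = j then Y $$ (i, j) else 0)"
        proof (cases "j \<le> k")
          case True then show ?thesis using Suc k by auto
        next
          case False
          then show ?thesis using hess[of i k] i by simp
        qed
      qed
      also have "\<dots> = Y $$ (i, j)" using Suc.prems by (simp add: sum.delta)
      finally show "(Y ^\<^sub>m Suc j) $$ (i, 0) = (if i = Suc j then 1 else 0)" using hess[of i j] i by simp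
    qed
  qed (use Y in simp)
  define \<nu> where "\<nu> = u - 1\<^sub>m n"
  have \<nu>: "\<nu> \<in> strict_upper n" using col by (auto simp: strict_upper_def \<nu>_def u_def)
  have u\<nu>: "1\<^sub>m n + \<nu> = u" using u by (auto simp: \<nu>_def)
  have "u \<in> GL n" using one_plus_strict_upper_SL[OF \<nu>] SL_subset_GL u\<nu> by auto
  then obtain u' where u': "u' \<in> carrier_mat n n" "u' * u = 1\<^sub>m n" "u * u' = 1\<^sub>m n"
    using GL_inverse GL_carrier by metis
  define X where "X = u' * (Y * u)"
  have X: "X \<in> carrier_mat n n" using u u' by (simp add: X_def)
  have uX: "u * X = Y * u"
  proof -
    have "u * X = (u * u') * (Y * u)" unfolding X_def using u u' Y by (intro assoc_mult_mat[symmetric]) auto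
    then show ?thesis using u Y by (simp add: u'(3))
  qed
  have "companion n X"
    unfolding X_def
  proof (rule companion_conjugate[OF Y u u'(1,2)])
    fix k j assume k: "k < n" "Suc j < n"
    have "(Y * u) $$ (k, j) = (\<Sum>a<n. Y $$ (k, a) * (Y ^\<^sub>m j) $$ (a, 0))"
      using u Y k by (subst index_mult_sum[of _ n n _ n]) (auto simp: u_def)
    also have "\<dots> = (Y * Y ^\<^sub>m j) $$ (k, 0)"
      using u Y k by (intro index_mult_sum[of _ n n _ n, symmetric]) auto
    also have "\<dots> = u $$ (k, Suc j)" using k by (simp add: u_def flip: pow_mat_Suc_left[OF Y])
    finally show "(Y * u) $$ (k, j) = u $$ (k, Suc j)" .
  qed
  then show ?thesis using \<nu> uX u\<nu> by metis
qed

subsection \<open>The anti-involution attached to a companion matrix\<close>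

locale companion_form =
  fixes n :: nat and X :: "'r :: comm_ring_1 mat"
  assumes n_pos: "n > 0" and companion: "companion n X"
begin

lemma X_carrier [simp]: "X \<in> carrier_mat n n" and X_dim [simp]: "dim_row X = n" "dim_col X = n"
  using companionD(1)[OF companion] by auto

lemmas sq_simps = assoc_mult_mat[of _ n n _ n _ n] add_mult_distrib_mat[of _ n n _ _ n]
  mult_add_distrib_mat[of _ n n _ n] minus_mult_distrib_mat[of _ n n _ _ n]
  mult_minus_distrib_mat[of _ n n _ n] mult_smult_assoc_mat[of _ n n _ n] mult_smult_distrib[of _ n n _ n]

definition S :: "'r mat" where
  "S = mat n n (\<lambda>(i, j). (X ^\<^sub>m (i + j)) $$ (n - 1, 0))"

lemma S_carrier [simp]: "S \<in> carrier_mat n n" and S_dim [simp]: "dim_row S = n" "dim_col S = n"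
  by (simp_all add: S_def)

lemma S_sym: "S $$ (i, j) = S $$ (j, i)" if "i < n" "j < n"
  using that by (simp add: S_def add.commute)

lemma S_transpose [simp]: "S\<^sup>T = S"
  by (rule eq_matI) (auto simp: S_sym)

lemma X_pow_index: "i < n \<Longrightarrow> j < n \<Longrightarrow> (X ^\<^sub>m k) $$ (i, j) = (X ^\<^sub>m (k + j)) $$ (i, 0)"
proof (induction j arbitrary: k)
  case (Suc j)
  have "(X ^\<^sub>m k) $$ (i, Suc j) = (X ^\<^sub>m k * X) $$ (i, j)"
    using Suc.prems by (intro mult_companion_index[OF companion, symmetric]) auto
  also have "\<dots> = (X ^\<^sub>m Suc k) $$ (i, j)" by simp
  also have "\<dots> = (X ^\<^sub>m (Suc k + j)) $$ (i, 0)" by (rule Suc.IH) (use Suc.prems in simp_all)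
  finally show ?case by simp
qed simp

lemma S_X: "S * X = X\<^sup>T * S"
proof -
  have SX: "(S * X) $$ (i, j) = (X ^\<^sub>m (i + Suc j)) $$ (n - 1, 0)" if ij: "i < n" "j < n" for i j
  proof -
    have "(S * X) $$ (i, j) = (\<Sum>k<n. S $$ (i, k) * X $$ (k, j))"
      using ij by (intro index_mult_sum[of _ n n _ n]) auto
    also have "\<dots> = (\<Sum>k<n. (X ^\<^sub>m i) $$ (n - 1, k) * X $$ (k, j))"
      using ij n_pos X_pow_index[of "n - 1" _ i] by (intro sum.cong) (auto simp: S_def)
    also have "\<dots> = (X ^\<^sub>m i * X) $$ (n - 1, j)"
      using ij n_pos by (intro index_mult_sum[of _ n n _ n, symmetric]) auto
    also have "\<dots> = (X ^\<^sub>m Suc i) $$ (n - 1, j)" by simp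
    also have "\<dots> = (X ^\<^sub>m (i + Suc j)) $$ (n - 1, 0)"
      using X_pow_index[of "n - 1" j "Suc i"] ij n_pos by simp
    finally show ?thesis .
  qed
  have "(S * X)\<^sup>T = X\<^sup>T * S" by (simp add: transpose_mult[of _ n n _ n])
  moreover have "(S * X)\<^sup>T = S * X"
  proof (rule eq_matI, goal_cases)
    case (1 i j)
    then have ij: "i < n" "j < n" by auto
    then show ?case using SX[of i j] SX[of j i] by (simp add: add.commute del: index_mult_mat(1))
  qed auto
  ultimately show ?thesis by simp
qed

lemma S_anti_triangular:
  assumes "i < n" "j < n" "i + j < n"
  shows "S $$ (i, j) = (if i + j = n - 1 then 1 else 0)"
  using companion_pow_first_col[OF companion assms(3), of "n - 1"] assms n_pos by (auto simp: S_def)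

lemma S_GL: "S \<in> GL n"
proof -
  define w :: "'r mat" where "w = mat n n (\<lambda>(i, j). if j = n - 1 - i then 1 else 0)"
  have w: "w \<in> carrier_mat n n" by (simp add: w_def)
  have wS: "(w * S) $$ (i, j) = S $$ (n - 1 - i, j)" if ij: "i < n" "j < n" for i j
  proof -
    have "(w * S) $$ (i, j) = (\<Sum>k<n. w $$ (i, k) * S $$ (k, j))"
      using ij w by (intro index_mult_sum[of _ n n _ n]) auto
    also have "\<dots> = (\<Sum>k<n. if k = n - 1 - i then S $$ (k, j) else 0)"
      using ij by (intro sum.cong) (auto simp: w_def)
    also have "\<dots> = S $$ (n - 1 - i, j)" using ij by (simp add: sum.delta)
    finally show ?thesis .
  qed
  define \<nu> where "\<nu> = w * S - 1\<^sub>m n"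
  have "\<nu> $$ (i, j) = 0" if ij: "i < n" "j \<le> i" for i j
  proof -
    have "\<nu> $$ (i, j) = (w * S) $$ (i, j) - 1\<^sub>m n $$ (i, j)" using ij w unfolding \<nu>_def by (intro index_minus_mat) auto
    also have "\<dots> = S $$ (n - 1 - i, j) - (if i = j then 1 else 0)" using ij by (simp add: wS del: index_mult_mat(1))
    also have "\<dots> = 0" using S_anti_triangular[of "n - 1 - i" j] ij n_pos by auto
    finally show ?thesis .
  qed
  then have "\<nu> \<in> strict_upper n" using w by (simp add: strict_upper_def \<nu>_def)
  then have "det (1\<^sub>m n + \<nu>) = 1" by (rule det_one_plus_strict_upper)
  moreover have "1\<^sub>m n + \<nu> = w * S" using w by (intro eq_matI) (auto simp: \<nu>_def simp del: index_mult_mat(1))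
  ultimately have "det w * det S = 1" using det_mult[OF w S_carrier] by simp
  then have "det S dvd 1" by (metis dvd_triv_right)
  then show ?thesis by (simp add: GL_def)
qed

definition Si :: "'r mat" where
  "Si = (SOME M. M \<in> GL n \<and> M * S = 1\<^sub>m n \<and> S * M = 1\<^sub>m n)"

lemma Si: "Si \<in> GL n" "Si * S = 1\<^sub>m n" "S * Si = 1\<^sub>m n"
proof -
  have "\<exists>M. M \<in> GL n \<and> M * S = 1\<^sub>m n \<and> S * M = 1\<^sub>m n" using GL_inverse[OF S_GL] by blast
  from someI_ex[OF this] show "Si \<in> GL n" "Si * S = 1\<^sub>m n" "S * Si = 1\<^sub>m n" unfolding Si_def by blast+
qed

lemma Si_carrier [simp]: "Si \<in> carrier_mat n n" and Si_dim [simp]: "dim_row Si = n" "dim_col Si = n"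
  using GL_carrier[OF Si(1)] by auto

lemma Si_S_mult: "A \<in> carrier_mat n n \<Longrightarrow> Si * (S * A) = A"
proof -
  assume A: "A \<in> carrier_mat n n"
  have "Si * (S * A) = (Si * S) * A" using A by (intro assoc_mult_mat[symmetric]) auto
  then show ?thesis using A by (simp add: Si(2))
qed

lemma S_Si_mult: "A \<in> carrier_mat n n \<Longrightarrow> S * (Si * A) = A"
proof -
  assume A: "A \<in> carrier_mat n n"
  have "S * (Si * A) = (S * Si) * A" using A by (intro assoc_mult_mat[symmetric]) auto
  then show ?thesis using A by (simp add: Si(3))
qed

lemma Si_transpose [simp]: "Si\<^sup>T = Si"
proof -
  have "Si\<^sup>T * S = (S * Si)\<^sup>T" by (simp add: transpose_mult[of _ n n _ n])
  then have 1: "Si\<^sup>T * S = 1\<^sub>m n" by (simp add: Si(3))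
  have "Si\<^sup>T = Si\<^sup>T * (S * Si)" by (simp add: Si(3))
  also have "\<dots> = (Si\<^sup>T * S) * Si" by (rule assoc_mult_mat[symmetric]) auto
  finally show ?thesis by (simp add: 1)
qed

definition \<tau> :: "'r mat \<Rightarrow> 'r mat" where
  "\<tau> g = Si * (g\<^sup>T * S)"

lemma \<tau>_carrier [simp]: "g \<in> carrier_mat n n \<Longrightarrow> \<tau> g \<in> carrier_mat n n"
  and \<tau>_dim [simp]: "dim_row (\<tau> g) = n" "dim_col (\<tau> g) = n"
  by (simp_all add: \<tau>_def)

lemma S_\<tau>: "g \<in> carrier_mat n n \<Longrightarrow> S * \<tau> g = g\<^sup>T * S"
  by (simp add: \<tau>_def S_Si_mult)

lemma \<tau>_mult:
  assumes "g \<in> carrier_mat n n" "h \<in> carrier_mat n n"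
  shows "\<tau> (g * h) = \<tau> h * \<tau> g"
proof -
  have "\<tau> h * \<tau> g = Si * (h\<^sup>T * (S * (Si * (g\<^sup>T * S))))"
    using assms by (simp add: \<tau>_def sq_simps)
  also have "\<dots> = Si * (h\<^sup>T * (g\<^sup>T * S))" using assms by (simp add: S_Si_mult)
  also have "\<dots> = \<tau> (g * h)" using assms by (simp add: \<tau>_def transpose_mult[of _ n n _ n] sq_simps)
  finally show ?thesis by simp
qed

lemma \<tau>_add: "g \<in> carrier_mat n n \<Longrightarrow> h \<in> carrier_mat n n \<Longrightarrow> \<tau> (g + h) = \<tau> g + \<tau> h"
  by (simp add: \<tau>_def transpose_add[of _ n n] sq_simps)

lemma \<tau>_diff: "g \<in> carrier_mat n n \<Longrightarrow> h \<in> carrier_mat n n \<Longrightarrow> \<tau> (g - h) = \<tau> g - \<tau> h"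
  by (simp add: \<tau>_def transpose_minus[of _ n n] sq_simps)

lemma \<tau>_smult: "g \<in> carrier_mat n n \<Longrightarrow> \<tau> (a \<cdot>\<^sub>m g) = a \<cdot>\<^sub>m \<tau> g"
proof -
  assume g: "g \<in> carrier_mat n n"
  have "(a \<cdot>\<^sub>m g)\<^sup>T = a \<cdot>\<^sub>m g\<^sup>T" by (rule eq_matI) auto
  then show ?thesis using g by (simp add: \<tau>_def sq_simps)
qed

lemma \<tau>_one [simp]: "\<tau> (1\<^sub>m n) = 1\<^sub>m n"
  by (simp add: \<tau>_def Si(2))

lemma \<tau>_\<tau> [simp]: "g \<in> carrier_mat n n \<Longrightarrow> \<tau> (\<tau> g) = g"
  by (simp add: \<tau>_def transpose_mult[of _ n n _ n] sq_simps Si_S_mult Si(2))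

lemma \<tau>_X [simp]: "\<tau> X = X"
  by (simp add: \<tau>_def Si_S_mult flip: S_X)

lemma \<tau>_trace: "g \<in> carrier_mat n n \<Longrightarrow> mat_trace (\<tau> g) = mat_trace g"
proof -
  assume g: "g \<in> carrier_mat n n"
  have "mat_trace (\<tau> g) = mat_trace ((g\<^sup>T * S) * Si)"
    unfolding \<tau>_def using g by (intro mat_trace_comm) auto
  also have "(g\<^sup>T * S) * Si = g\<^sup>T" using g by (simp add: sq_simps Si(3))
  finally show ?thesis using g by (simp add: mat_trace_transpose)
qed

lemma \<tau>_GL: "g \<in> GL n \<Longrightarrow> \<tau> g \<in> GL n"
proof -
  assume g: "g \<in> GL n"
  have gc: "g \<in> carrier_mat n n" using g by (rule GL_carrier)
  then have "g\<^sup>T \<in> GL n" using g by (simp add: GL_def det_transpose)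
  then show ?thesis unfolding \<tau>_def by (intro GL_mult Si(1) S_GL)
qed

lemma \<tau>_strict_upper:
  assumes \<nu>: "\<nu> \<in> strict_upper n"
  shows "\<tau> \<nu> \<in> strict_upper n"
proof -
  have \<nu>c: "\<nu> \<in> carrier_mat n n" using \<nu> by (rule strict_upperD)
  have low: "(\<nu>\<^sup>T * S) $$ (i, j) = 0" if ij: "i < n" "j < n" "i + j < n" for i j
  proof -
    have "(\<nu>\<^sup>T * S) $$ (i, j) = (\<Sum>k<n. \<nu>\<^sup>T $$ (i, k) * S $$ (k, j))"
      using ij \<nu>c by (intro index_mult_sum[of _ n n _ n]) auto
    also have "\<dots> = 0"
    proof (intro sum.neutral ballI)
      fix k assume k: "k \<in> {..<n}"
      show "\<nu>\<^sup>T $$ (i, k) * S $$ (k, j) = 0"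
        using strict_upperD(2)[OF \<nu>, of k i] S_anti_triangular[of k j] k ij \<nu>c by (cases "k < i") auto
    qed
    finally show ?thesis .
  qed
  have "\<tau> \<nu> $$ (k, j) = 0" if "k < n" "j \<le> k" for k j
    using that
  proof (induction "n - k" arbitrary: k rule: less_induct)
    case less
    define i where "i = n - 1 - k"
    have i: "i < n" "i + j < n" "j < n" using less.prems n_pos by (auto simp: i_def)
    have "0 = (S * \<tau> \<nu>) $$ (i, j)" using low[of i j] i by (simp add: S_\<tau>[OF \<nu>c] del: index_mult_mat(1))
    also have "\<dots> = (\<Sum>a<n. S $$ (i, a) * \<tau> \<nu> $$ (a, j))"
      using i \<nu>c by (intro index_mult_sum[of _ n n _ n]) auto
    also have "\<dots> = (\<Sum>a<n. if a = k then \<tau> \<nu> $$ (a, j) else 0)"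
    proof (intro sum.cong refl)
      fix a assume a: "a \<in> {..<n}"
      show "S $$ (i, a) * \<tau> \<nu> $$ (a, j) = (if a = k then \<tau> \<nu> $$ (a, j) else 0)"
      proof (cases "k < a")
        case True
        then show ?thesis using less.hyps[of a] a less.prems by simp
      next
        case False
        then show ?thesis using S_anti_triangular[of i a] a less.prems i by (auto simp: i_def)
      qed
    qed
    also have "\<dots> = \<tau> \<nu> $$ (k, j)" using less.prems by (simp add: sum.delta)
    finally show ?case by simp
  qed
  then show ?thesis by (simp add: strict_upper_def \<nu>c)
qed

text \<open>With \<open>\<Delta> = S b - (S b)\<^sup>T\<close>, the hypotheses say that \<open>\<Delta>\<close> is of Hankel shape and that its
  entries on and next to the diagonal vanish.\<close>

lemma \<tau>_fixed_if_commutator_alternating: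
  assumes b: "b \<in> carrier_mat n n"
    and sym: "\<And>i j. i < n \<Longrightarrow> j < n \<Longrightarrow> \<kappa> * ((S * (b * X - X * b)) $$ (i, j) + (S * (b * X - X * b)) $$ (j, i)) = 0"
    and alt: "\<And>i. i < n \<Longrightarrow> \<kappa> * (S * (b * X - X * b)) $$ (i, i) = 0"
  shows "\<kappa> \<cdot>\<^sub>m \<tau> b = \<kappa> \<cdot>\<^sub>m b"
proof -
  define B where "B = S * b"
  have B: "B \<in> carrier_mat n n" using b by (simp add: B_def)
  have "S * (b * X - X * b) = B * X - X\<^sup>T * B"
  proof -
    have "S * (X * b) = (S * X) * b" using b by (intro assoc_mult_mat[symmetric]) auto
    also have "\<dots> = X\<^sup>T * B" unfolding S_X B_def using b by (intro assoc_mult_mat) auto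
    finally show ?thesis using b by (simp add: sq_simps B_def)
  qed
  moreover have "(X\<^sup>T * B) $$ (i, j) = B $$ (Suc i, j)" if "Suc i < n" "j < n" for i j
  proof -
    have "(X\<^sup>T * B) $$ (i, j) = (B\<^sup>T * X)\<^sup>T $$ (i, j)" using B by (simp add: transpose_mult[of _ n n _ n])
    also have "\<dots> = (B\<^sup>T * X) $$ (j, i)" using that B by (simp del: index_mult_mat(1))
    also have "\<dots> = B\<^sup>T $$ (j, Suc i)" using that B by (intro mult_companion_index[OF companion]) auto
    finally show ?thesis using that B by simp
  qed
  ultimately have entry: "(S * (b * X - X * b)) $$ (i, j) = B $$ (i, Suc j) - B $$ (Suc i, j)"
    if "Suc i < n" "Suc j < n" for i j
    using that B mult_companion_index[OF companion B, of i j] by (simp del: index_mult_mat(1))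
  define D where "D i j = \<kappa> * (B $$ (i, j) - B $$ (j, i))" for i j
  have shift: "D i (Suc j) = D (Suc i) j" if "Suc i < n" "Suc j < n" for i j
  proof -
    have "\<kappa> * ((B $$ (i, Suc j) - B $$ (Suc i, j)) + (B $$ (j, Suc i) - B $$ (Suc j, i))) = 0"
      using sym[of i j] that by (simp add: entry del: index_mult_mat(1))
    then show ?thesis by (simp add: D_def algebra_simps)
  qed
  have near: "D i (Suc i) = 0" if "Suc i < n" for i
    using alt[of i] that by (simp add: entry D_def del: index_mult_mat(1))
  have upper: "j < n \<Longrightarrow> i \<le> j \<Longrightarrow> D i j = 0" for i j
  proof (induction "j - i" arbitrary: i j rule: less_induct)
    case less
    show ?case
    proof (cases "j \<le> Suc i")
      case True
      then show ?thesis using less.prems near[of i] by (cases "j = i") (auto simp: D_def le_Suc_eq)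
    next
      case False
      then obtain j' where j': "j = Suc j'" by (cases j) auto
      have "D i (Suc j') = D (Suc i) j'" using False less.prems j' by (intro shift) auto
      also have "\<dots> = 0" using False less.prems j' by (intro less.hyps) auto
      finally show ?thesis by (simp add: j')
    qed
  qed
  have D0: "D i j = 0" if "i < n" "j < n" for i j
  proof (cases "i \<le> j")
    case False
    then have "D j i = 0" using upper[of i j] that by simp
    moreover have "D i j = - D j i" by (simp add: D_def algebra_simps)
    ultimately show ?thesis by simp
  qed (use upper that in simp)
  have "\<kappa> \<cdot>\<^sub>m B\<^sup>T = \<kappa> \<cdot>\<^sub>m B"
  proof (rule eq_matI, goal_cases)
    case (1 i j)
    then show ?case using D0[of i j] B by (simp add: D_def algebra_simps)
  qed (use B in auto)
  moreover have "B\<^sup>T = S * \<tau> b" using b by (simp add: B_def S_\<tau> transpose_mult[of _ n n _ n])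
  ultimately have "\<kappa> \<cdot>\<^sub>m (S * \<tau> b) = \<kappa> \<cdot>\<^sub>m (S * b)" by (simp add: B_def)
  then have "Si * (\<kappa> \<cdot>\<^sub>m (S * \<tau> b)) = Si * (\<kappa> \<cdot>\<^sub>m (S * b))" by simp
  then show ?thesis using b by (simp add: mult_smult_distrib[of _ n n _ n] Si_S_mult)
qed

lemma \<tau>_commuting:
  assumes c: "c \<in> carrier_mat n n" "c * X = X * c"
  shows "\<tau> c = c"
proof -
  have "X * c \<in> carrier_mat n n" using c by simp
  then have "c * X - X * c = 0\<^sub>m n n" unfolding c(2) by (intro eq_matI) auto
  then have "1 \<cdot>\<^sub>m \<tau> c = 1 \<cdot>\<^sub>m c" by (intro \<tau>_fixed_if_commutator_alternating c) auto
  then show ?thesis by simp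
qed

lemma sym_entry_mats:
  shows "\<tau> (entry_mat n i i t * S) = entry_mat n i i t * S"
    and "\<tau> ((entry_mat n i j t + entry_mat n j i t) * S) = (entry_mat n i j t + entry_mat n j i t) * S"
proof -
  have \<tau>S: "\<tau> (M * S) = M\<^sup>T * S" if "M \<in> carrier_mat n n" for M
    using that by (simp add: \<tau>_def transpose_mult[of _ n n _ n] sq_simps Si_S_mult)
  have 1: "(entry_mat n i j t)\<^sup>T = entry_mat n j i t" for i j t
    by (rule eq_matI) (auto simp: entry_mat_def)
  show "\<tau> (entry_mat n i i t * S) = entry_mat n i i t * S" by (simp add: \<tau>S 1)
  have c: "entry_mat n i j t + entry_mat n j i t \<in> carrier_mat n n" by simp
  have "(entry_mat n i j t + entry_mat n j i t)\<^sup>T = entry_mat n i j t + entry_mat n j i t"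
    by (simp add: transpose_add[of _ n n] 1) (rule comm_add_mat[of _ n n], simp_all)
  then show "\<tau> ((entry_mat n i j t + entry_mat n j i t) * S) = (entry_mat n i j t + entry_mat n j i t) * S"
    by (simp add: \<tau>S[OF c])
qed

end

subsection \<open>Isotypic components for the congruence subgroup\<close>

lemma irreducible_rep_sandwich:
  assumes irr: "irreducible_rep G n \<rho> d"
    and G: "\<And>g h. g \<in> G \<Longrightarrow> h \<in> G \<Longrightarrow> g * h \<in> G" "1\<^sub>m n \<in> G"
    and B: "B \<in> carrier_mat d d" "B \<noteq> 0\<^sub>m d d" and C: "C \<in> carrier_mat d d" "C \<noteq> 0\<^sub>m d d"
  shows "\<exists>g\<in>G. C * \<rho> g * B \<noteq> 0\<^sub>m d d"
proof (rule ccontr)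
  note rep = irreducible_repD[OF irr]
  assume *: "\<not> ?thesis"
  obtain v where v: "v \<in> carrier_vec d" "B *\<^sub>v v \<noteq> 0\<^sub>v d" using mat_eq_0I[OF B(1)] B(2) by blast
  have Bv: "B *\<^sub>v v \<in> carrier_vec d" using B by simp
  have "C *\<^sub>v u = 0\<^sub>v d" if u: "u \<in> carrier_vec d" for u
  proof -
    have "C *\<^sub>v (\<rho> (1\<^sub>m n) *\<^sub>v u) \<in> {0\<^sub>v d}"
    proof (rule irreducible_rep_dichotomy[OF irr G(1) C(1) _ _ _ Bv v(2) _ u G(2)])
      fix h assume h: "h \<in> G"
      have "C *\<^sub>v (\<rho> h *\<^sub>v (B *\<^sub>v v)) = (C * \<rho> h * B) *\<^sub>v v"
        using rep(1)[OF h] B C v by (simp add: assoc_mult_mat_vec[of _ d d _ d])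
      also have "\<dots> = 0\<^sub>v d" using * h v by (auto intro!: eq_vecI)
      finally show "C *\<^sub>v (\<rho> h *\<^sub>v (B *\<^sub>v v)) \<in> {0\<^sub>v d}" by simp
    qed auto
    then show ?thesis using rep(2) u by simp
  qed
  then have "C = 0\<^sub>m d d" by (rule mat_eq_0I[OF C(1)])
  then show False using C by simp
qed

lemma smult_mat_cancel:
  assumes "A \<in> carrier_mat nr nc" "a \<cdot>\<^sub>m A = b \<cdot>\<^sub>m A" "A \<noteq> 0\<^sub>m nr nc"
  shows "a = (b :: 'a :: field)"
proof (rule ccontr)
  assume "a \<noteq> b"
  have "A = 0\<^sub>m nr nc"
  proof (rule eq_matI, goal_cases)
    case (1 i j)
    then have "(a \<cdot>\<^sub>m A) $$ (i, j) = (b \<cdot>\<^sub>m A) $$ (i, j)" using assms(2) by simp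
    then show ?case using 1 assms(1) \<open>a \<noteq> b\<close> by simp
  qed (use assms(1) in auto)
  then show False using assms(3) by simp
qed

locale residue_rep = trunc_dvr_char pw l \<phi>
  for pw :: "'r :: comm_ring_1" and l :: nat and \<phi> :: "'r \<Rightarrow> complex" +
  fixes \<pi> :: "'r \<Rightarrow> 'k :: field" and n d :: nat and \<rho> :: "'r mat \<Rightarrow> complex mat"
  assumes residue: "residue_map pw \<pi>" and irr: "irreducible_rep (GL n) n \<rho> d"
begin

abbreviation "M \<equiv> carrier_mat n n :: 'r mat set"
abbreviation "N \<equiv> strict_upper n :: 'r mat set"
abbreviation "tr \<equiv> mat_trace :: 'r mat \<Rightarrow> 'r"

lemmas mat_simps = assoc_mult_mat[of _ n n _ n _ n] add_mult_distrib_mat[of _ n n _ _ n]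
  mult_add_distrib_mat[of _ n n _ n] minus_mult_distrib_mat[of _ n n _ _ n]
  mult_minus_distrib_mat[of _ n n _ n] mult_smult_assoc_mat[of _ n n _ n] mult_smult_distrib[of _ n n _ n]
  add_smult_distrib_left_mat[of _ n n] smult_diff_mat[of _ n n] smult_smult_mat

lemmas rep_simps = assoc_mult_mat[of _ d d _ d _ d] mult_smult_assoc_mat[of _ d d _ d] mult_smult_distrib[of _ d d _ d]
  smult_smult_mat

lemmas trace_simps = mat_trace_add[of _ n] mat_trace_diff[of _ n] mat_trace_smult[of _ n]

lemma N_M: "\<nu> \<in> N \<Longrightarrow> \<nu> \<in> M"
  by (rule strict_upperD)

lemma finite_N [simp]: "finite N"
  by (rule finite_subset[OF _ finite_mats[of n n]]) (auto dest: N_M)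

interpretation \<pi>: comm_ring_hom \<pi>
  using residue by unfold_locales (auto simp: residue_map_def)

lemma GL_iff_residue: "A \<in> M \<Longrightarrow> A \<in> GL n \<longleftrightarrow> det (map_mat \<pi> A) \<noteq> 0"
  using residue dvr by (auto simp: GL_def residue_map_def trunc_dvr_def)

lemma GL_perturb:
  assumes "A \<in> M" "B \<in> M" "k \<ge> 1"
  shows "A + pw ^ k \<cdot>\<^sub>m B \<in> GL n \<longleftrightarrow> A \<in> GL n"
proof -
  have "\<pi> (pw ^ k) = 0" using residue assms(3) by (auto simp: residue_map_def intro: dvd_power)
  then have "map_mat \<pi> (A + pw ^ k \<cdot>\<^sub>m B) = map_mat \<pi> A"
    using assms by (intro eq_matI) (auto simp: \<pi>.hom_add \<pi>.hom_mult)
  then show ?thesis using assms by (simp add: GL_iff_residue)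
qed

lemma \<rho>_carrier [simp]: "g \<in> GL n \<Longrightarrow> \<rho> g \<in> carrier_mat d d"
  and \<rho>_one: "\<rho> (1\<^sub>m n) = 1\<^sub>m d"
  and \<rho>_mult: "g \<in> GL n \<Longrightarrow> h \<in> GL n \<Longrightarrow> \<rho> (g * h) = \<rho> g * \<rho> h"
  using irreducible_repD[OF irr] by auto

lemma \<rho>_dim [simp]: "g \<in> GL n \<Longrightarrow> dim_row (\<rho> g) = d" "g \<in> GL n \<Longrightarrow> dim_col (\<rho> g) = d"
  by (auto dest!: \<rho>_carrier)

definition K :: "nat \<Rightarrow> 'r mat \<Rightarrow> 'r mat" where
  "K k y = 1\<^sub>m n + pw ^ k \<cdot>\<^sub>m y"

lemma K_carrier [simp]: "y \<in> M \<Longrightarrow> K k y \<in> M"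
  by (simp add: K_def)

lemma K_dim [simp]: "dim_row (K k y) = dim_row y" "dim_col (K k y) = dim_col y"
  by (simp_all add: K_def)

lemma K_GL [simp]: "y \<in> M \<Longrightarrow> k \<ge> 1 \<Longrightarrow> K k y \<in> GL n"
  by (simp add: K_def GL_perturb GL_one)

lemma m_ge_1 [simp]: "m \<ge> 1" "Suc 0 \<le> m" and r_ge_1 [simp]: "r \<ge> 1" "Suc 0 \<le> r"
  using r_m by auto

lemma pw_vanish [simp]: "pw ^ m * pw ^ m = 0" "pw ^ m * pw ^ r = 0" "pw ^ r * pw ^ m = 0"
  "pw ^ (2 * r) * pw ^ r = 0" "pw ^ r * pw ^ (2 * r) = 0"
  "pw ^ (2 * r) * pw ^ m = 0" "pw ^ m * pw ^ (2 * r) = 0"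
  using r_m by (simp_all flip: power_add add: pw_power_0)

lemma pw_r_r [simp]: "pw ^ r * pw ^ r = pw ^ (2 * r)"
  by (simp flip: power_add add: mult_2)

lemma pw_m_diff [simp]: "pw ^ m * pw ^ (2 * r - m) = pw ^ (2 * r)"
  using r_m by (simp flip: power_add)

lemma K_mult:
  assumes "y \<in> M" "z \<in> M"
  shows "K k y * K k z = K k (y + z + pw ^ k \<cdot>\<^sub>m (y * z))"
proof -
  have "K k y * K k z = 1\<^sub>m n + pw ^ k \<cdot>\<^sub>m z + (pw ^ k \<cdot>\<^sub>m y + (pw ^ k * pw ^ k) \<cdot>\<^sub>m (y * z))"
    using assms by (simp add: K_def mat_simps)
      (auto simp: algebra_simps simp del: index_mult_mat(1) intro!: eq_matI)
  then show ?thesis using assms by (auto simp: K_def algebra_simps simp del: index_mult_mat(1) intro!: eq_matI)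
qed

lemma K_m_mult: "y \<in> M \<Longrightarrow> z \<in> M \<Longrightarrow> K m y * K m z = K m (y + z)"
  unfolding K_mult by (auto simp: K_def algebra_simps simp del: index_mult_mat(1) intro!: eq_matI)
    (simp flip: mult.assoc)

text \<open>An unnormalized projection: every element of the congruence subgroup occurs in the sum as often
  as there are \<open>y\<close> with \<open>p\<^sup>m y = 0\<close>.\<close>

definition Q :: "'r mat \<Rightarrow> complex mat" where
  "Q Y = msum d (\<lambda>y. \<phi> (- (pw ^ m * tr (Y * y))) \<cdot>\<^sub>m \<rho> (K m y)) M"

lemma Q_carrier [simp]: "Q Y \<in> carrier_mat d d" and Q_dim [simp]: "dim_row (Q Y) = d" "dim_col (Q Y) = d"
  by (simp_all add: Q_def)

lemma bij_translate: "z \<in> M \<Longrightarrow> bij_betw (\<lambda>y. z + y) M M"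
  by (rule bij_betw_byWitness[of _ "\<lambda>y. y - z"]) (auto intro!: eq_matI)

lemma Q_left:
  assumes Y: "Y \<in> M" and z: "z \<in> M"
  shows "\<rho> (K m z) * Q Y = \<phi> (pw ^ m * tr (Y * z)) \<cdot>\<^sub>m Q Y"
proof -
  have "\<rho> (K m z) * Q Y = msum d (\<lambda>y. \<phi> (- (pw ^ m * tr (Y * y))) \<cdot>\<^sub>m \<rho> (K m (z + y))) M"
    unfolding Q_def using z
    by (subst mult_msum) (auto simp: rep_simps K_m_mult simp flip: \<rho>_mult intro!: msum_cong)
  also have "\<dots> = msum d (\<lambda>y. \<phi> (pw ^ m * tr (Y * z)) \<cdot>\<^sub>m (\<phi> (- (pw ^ m * tr (Y * (z + y)))) \<cdot>\<^sub>m \<rho> (K m (z + y)))) M"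
  proof (rule msum_cong)
    fix y assume y: "y \<in> M"
    have "\<phi> (- (pw ^ m * tr (Y * y))) = \<phi> (pw ^ m * tr (Y * z)) * \<phi> (- (pw ^ m * tr (Y * (z + y))))"
      using Y y z by (simp add: mat_simps trace_simps algebra_simps flip: \<phi>_add)
    then show "\<phi> (- (pw ^ m * tr (Y * y))) \<cdot>\<^sub>m \<rho> (K m (z + y)) =
        \<phi> (pw ^ m * tr (Y * z)) \<cdot>\<^sub>m (\<phi> (- (pw ^ m * tr (Y * (z + y)))) \<cdot>\<^sub>m \<rho> (K m (z + y)))"
      by (simp add: smult_smult_mat)
  qed
  also have "\<dots> = \<phi> (pw ^ m * tr (Y * z)) \<cdot>\<^sub>m
      msum d (\<lambda>y. \<phi> (- (pw ^ m * tr (Y * (z + y)))) \<cdot>\<^sub>m \<rho> (K m (z + y))) M"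
    using z by (intro smult_msum[symmetric]) simp
  also have "msum d (\<lambda>y. \<phi> (- (pw ^ m * tr (Y * (z + y)))) \<cdot>\<^sub>m \<rho> (K m (z + y))) M = Q Y"
    unfolding Q_def by (rule msum_reindex[OF bij_translate[OF z], symmetric])
  finally show ?thesis .
qed

lemma Q_K_comm:
  assumes z: "z \<in> M"
  shows "\<rho> (K m z) * Q Y = Q Y * \<rho> (K m z)"
proof -
  have "\<rho> (K m z) * \<rho> (K m y) = \<rho> (K m y) * \<rho> (K m z)" if y: "y \<in> M" for y
    using y z by (simp add: K_m_mult comm_add_mat[of y n n z] flip: \<rho>_mult)
  then show ?thesis unfolding Q_def using z
    by (subst mult_msum, simp, simp, subst msum_mult) (auto simp: rep_simps intro!: msum_cong)
qed

lemma Q_right: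
  assumes "Y \<in> M" "z \<in> M"
  shows "Q Y * \<rho> (K m z) = \<phi> (pw ^ m * tr (Y * z)) \<cdot>\<^sub>m Q Y"
  using Q_left[OF assms] Q_K_comm[OF assms(2)] by simp

lemma character_unique:
  assumes Y: "Y \<in> M" "Y' \<in> M" and B: "B \<in> carrier_mat d d" "B \<noteq> 0\<^sub>m d d"
    and eq: "\<And>y. y \<in> M \<Longrightarrow> \<phi> (\<kappa> * tr (Y * y)) \<cdot>\<^sub>m B = \<phi> (\<kappa> * tr (Y' * y)) \<cdot>\<^sub>m B"
  shows "\<kappa> \<cdot>\<^sub>m (Y - Y') = 0\<^sub>m n n"
proof (rule trace_nondegenerate)
  fix y assume y: "y \<in> M"
  have "\<phi> (\<kappa> * tr (Y * y)) = \<phi> (\<kappa> * tr (Y' * y))" by (rule smult_mat_cancel[OF B(1) eq[OF y] B(2)])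
  then show "\<phi> (\<kappa> * tr ((Y - Y') * y)) = 1"
    unfolding \<phi>_eq_iff using Y y by (simp add: mat_simps trace_simps right_diff_distrib)
qed (use Y in simp)

lemma Q_cong:
  assumes Y: "Y \<in> M" "Y' \<in> M" and eq: "pw ^ m \<cdot>\<^sub>m (Y - Y') = 0\<^sub>m n n"
  shows "Q Y = Q Y'"
  unfolding Q_def
proof (rule msum_cong)
  fix y assume y: "y \<in> M"
  have "pw ^ m * tr ((Y - Y') * y) = tr ((pw ^ m \<cdot>\<^sub>m (Y - Y')) * y)"
    using Y y by (simp add: mult_smult_assoc_mat[of _ n n _ n] mat_trace_smult[of _ n])
  also have "\<dots> = 0" unfolding eq using y by (simp add: mat_trace_def)
  finally have "pw ^ m * tr (Y * y) = pw ^ m * tr (Y' * y)"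
    using Y y by (simp add: mat_simps trace_simps right_diff_distrib)
  then show "\<phi> (- (pw ^ m * tr (Y * y))) \<cdot>\<^sub>m \<rho> (K m y) = \<phi> (- (pw ^ m * tr (Y' * y))) \<cdot>\<^sub>m \<rho> (K m y)" by simp
qed

lemma K_conj:
  assumes g: "g \<in> GL n" "g' \<in> GL n" "g' * g = 1\<^sub>m n" and y: "y \<in> M"
  shows "g * K k y = K k (g * y * g') * g"
proof -
  have gc: "g \<in> M" "g' \<in> M" using g GL_carrier by auto
  have "(g * y * g') * g = g * y" using gc y by (simp add: mat_simps g(3))
  then show ?thesis using gc y by (simp add: K_def mat_simps)
qed

lemma bij_conj:
  assumes g: "g \<in> GL n" "g' \<in> GL n" "g' * g = 1\<^sub>m n" "g * g' = 1\<^sub>m n"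
  shows "bij_betw (\<lambda>y. g * y * g') M M"
proof (rule bij_betw_byWitness[of _ "\<lambda>y. g' * y * g"])
  have gc: "g \<in> M" "g' \<in> M" using g GL_carrier by auto
  have 1: "h' * (h * y * h') * h = y" if "h' * h = 1\<^sub>m n" "h \<in> M" "h' \<in> M" "y \<in> M" for h h' y
  proof -
    have "h' * (h * y * h') * h = (h' * h) * (y * (h' * h))" using that(2-) by (simp add: mat_simps)
    then show ?thesis using that(4) by (simp add: that(1))
  qed
  show "\<forall>a\<in>M. g' * (g * a * g') * g = a" using 1[OF g(3) gc] by blast
  show "\<forall>a\<in>M. g * (g' * a * g) * g' = a" using 1[OF g(4) gc(2,1)] by blast
qed (use GL_carrier[OF g(1)] GL_carrier[OF g(2)] in auto)

lemma trace_conj: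
  assumes "g \<in> M" "g' \<in> M" "Y \<in> M" "y \<in> M"
  shows "tr (Y * (g * y * g')) = tr (g' * Y * g * y)"
proof -
  have "tr (Y * (g * y * g')) = tr ((Y * g * y) * g')" using assms by (simp add: mat_simps)
  also have "\<dots> = tr (g' * (Y * g * y))" using assms by (intro mat_trace_comm) auto
  finally show ?thesis using assms by (simp add: mat_simps)
qed

lemma Q_conj:
  assumes g: "g \<in> GL n" "g' \<in> GL n" "g' * g = 1\<^sub>m n" "g * g' = 1\<^sub>m n" and Y: "Y \<in> M"
  shows "\<rho> g * Q Y = Q (g * Y * g') * \<rho> g"
proof -
  have gc: "g \<in> M" "g' \<in> M" using g GL_carrier by auto
  have "Q (g * Y * g') = msum d (\<lambda>y. \<phi> (- (pw ^ m * tr (g * Y * g' * (g * y * g')))) \<cdot>\<^sub>m \<rho> (K m (g * y * g'))) M"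
    unfolding Q_def by (rule msum_reindex[OF bij_conj[OF g]])
  then have "Q (g * Y * g') * \<rho> g = msum d (\<lambda>y. \<phi> (- (pw ^ m * tr (g * Y * g' * (g * y * g')))) \<cdot>\<^sub>m (\<rho> (K m (g * y * g')) * \<rho> g)) M"
    using g gc by (simp only:) (subst msum_mult, auto simp: rep_simps intro!: msum_cong)
  also have "\<dots> = msum d (\<lambda>y. \<rho> g * (\<phi> (- (pw ^ m * tr (Y * y))) \<cdot>\<^sub>m \<rho> (K m y))) M"
  proof (rule msum_cong)
    fix y assume y: "y \<in> M"
    have "tr (g * Y * g' * (g * y * g')) = tr (g' * (g * Y * g') * g * y)"
      by (rule trace_conj) (use gc Y y in auto)
    also have "g' * (g * Y * g') * g * y = (g' * g) * (Y * ((g' * g) * y))" using gc Y y by (simp only: mat_simps mult_mat_carrier_iff carrier_matD)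
    finally have t: "tr (g * Y * g' * (g * y * g')) = tr (Y * y)" using Y y by (simp add: g(3))
    have "\<rho> (K m (g * y * g')) * \<rho> g = \<rho> g * \<rho> (K m y)"
      using K_conj[OF g(1-3) y, of m] g y gc by (simp flip: \<rho>_mult)
    then show "\<phi> (- (pw ^ m * tr (g * Y * g' * (g * y * g')))) \<cdot>\<^sub>m (\<rho> (K m (g * y * g')) * \<rho> g) =
        \<rho> g * (\<phi> (- (pw ^ m * tr (Y * y))) \<cdot>\<^sub>m \<rho> (K m y))"
      using g y by (simp add: t rep_simps)
  qed
  also have "\<dots> = \<rho> g * Q Y" unfolding Q_def using g by (intro mult_msum[symmetric]) auto
  finally show ?thesis by simp
qed

lemma Q_sandwich:
  assumes g: "g \<in> GL n" and Y: "Y \<in> M" "Y' \<in> M" and nz: "Q Y' * \<rho> g * Q Y \<noteq> 0\<^sub>m d d"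
  shows "pw ^ m \<cdot>\<^sub>m (g * Y - Y' * g) = 0\<^sub>m n n"
proof -
  obtain g' where g': "g' \<in> GL n" "g' * g = 1\<^sub>m n" "g * g' = 1\<^sub>m n" using GL_inverse[OF g] by blast
  have gc: "g \<in> M" "g' \<in> M" using g g' GL_carrier by auto
  define B where "B = Q Y' * \<rho> g * Q Y"
  have B: "B \<in> carrier_mat d d" using g by (simp add: B_def)
  have 0: "pw ^ m \<cdot>\<^sub>m (g * Y * g' - Y') = 0\<^sub>m n n"
  proof (rule character_unique[OF _ Y(2) B nz[folded B_def]])
    fix y assume y: "y \<in> M"
    have B2: "B = Q Y' * (Q (g * Y * g') * \<rho> g)"
      using g by (simp add: B_def rep_simps Q_conj[OF g g' Y(1)])
    have "\<phi> (pw ^ m * tr (g * Y * g' * y)) \<cdot>\<^sub>m B = Q Y' * (\<rho> (K m y) * Q (g * Y * g') * \<rho> g)"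
      using g gc y Y by (simp add: Q_left rep_simps B2)
    also have "\<dots> = (Q Y' * \<rho> (K m y)) * (Q (g * Y * g') * \<rho> g)"
      using g gc y Y by (simp add: rep_simps)
    also have "\<dots> = \<phi> (pw ^ m * tr (Y' * y)) \<cdot>\<^sub>m B" using g gc y Y by (simp add: Q_right rep_simps B2)
    finally show "\<phi> (pw ^ m * tr (g * Y * g' * y)) \<cdot>\<^sub>m B = \<phi> (pw ^ m * tr (Y' * y)) \<cdot>\<^sub>m B" .
  qed (use gc Y in auto)
  have "pw ^ m \<cdot>\<^sub>m (g * Y - Y' * g) = (pw ^ m \<cdot>\<^sub>m (g * Y * g' - Y')) * g"
    using gc Y by (simp add: mat_simps g'(2))
  also have "\<dots> = 0\<^sub>m n n" unfolding 0 using gc by simp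
  finally show ?thesis .
qed

lemma sum_\<phi>_trace:
  assumes z: "z \<in> M"
  shows "(\<Sum>Y\<in>M. \<phi> (\<kappa> * tr (z * Y))) = (if \<kappa> \<cdot>\<^sub>m z = 0\<^sub>m n n then of_nat (card M) else 0)"
proof (cases "\<kappa> \<cdot>\<^sub>m z = 0\<^sub>m n n")
  case True
  have "\<kappa> * tr (z * Y) = 0" if Y: "Y \<in> M" for Y
  proof -
    have "\<kappa> * tr (z * Y) = tr ((\<kappa> \<cdot>\<^sub>m z) * Y)" using z Y by (simp add: mat_simps trace_simps)
    also have "\<dots> = 0" unfolding True using Y by (simp add: mat_trace_def)
    finally show ?thesis .
  qed
  then show ?thesis using True by simp
next
  case False
  then obtain y where y: "y \<in> M" "\<phi> (\<kappa> * tr (z * y)) \<noteq> 1" using trace_nondegenerate[OF z] by blast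
  have "(\<Sum>Y\<in>M. \<phi> (\<kappa> * tr (z * Y))) = 0"
  proof (rule sum_eq_0_if_equivariant[where f = "\<lambda>Y. y + Y", OF finite_mats _ _ _ y(2)])
    show "inj_on (\<lambda>Y. y + Y) M" "(\<lambda>Y. y + Y) ` M \<subseteq> M" using bij_translate[OF y(1)] by (auto simp: bij_betw_def)
    show "\<phi> (\<kappa> * tr (z * (y + x))) = \<phi> (\<kappa> * tr (z * y)) * \<phi> (\<kappa> * tr (z * x))" if "x \<in> M" for x
      using that y z by (simp add: mat_simps trace_simps distrib_left \<phi>_add)
  qed
  then show ?thesis using False by simp
qed

lemma card_M_pos: "card M > 0"
  by (metis card_gt_0_iff empty_iff finite_mats zero_carrier_mat)

lemma K_eq_one: "y \<in> M \<Longrightarrow> pw ^ k \<cdot>\<^sub>m y = 0\<^sub>m n n \<Longrightarrow> K k y = 1\<^sub>m n"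
  by (simp add: K_def)

lemma sum_Q: "\<exists>c. c \<noteq> 0 \<and> msum d Q M = c \<cdot>\<^sub>m 1\<^sub>m d"
proof -
  have "msum d Q M = msum d (\<lambda>y. msum d (\<lambda>Y. \<phi> (- (pw ^ m * tr (Y * y))) \<cdot>\<^sub>m \<rho> (K m y)) M) M"
    unfolding Q_def by (rule msum_swap)
  also have "\<dots> = msum d (\<lambda>y. (if pw ^ m \<cdot>\<^sub>m y = 0\<^sub>m n n then of_nat (card M) else 0) \<cdot>\<^sub>m 1\<^sub>m d) M"
  proof (rule msum_cong)
    fix y assume y: "y \<in> M"
    have "msum d (\<lambda>Y. \<phi> (- (pw ^ m * tr (Y * y))) \<cdot>\<^sub>m \<rho> (K m y)) M =
        (\<Sum>Y\<in>M. \<phi> (- (pw ^ m * tr (Y * y)))) \<cdot>\<^sub>m \<rho> (K m y)"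
      using y by (intro msum_const_dir) auto
    also have "(\<Sum>Y\<in>M. \<phi> (- (pw ^ m * tr (Y * y)))) = (\<Sum>Y\<in>M. \<phi> (- (pw ^ m) * tr (y * Y)))"
      using y by (intro sum.cong) (auto simp: mat_trace_comm[of y n])
    also have "\<dots> = (if - (pw ^ m) \<cdot>\<^sub>m y = 0\<^sub>m n n then of_nat (card M) else 0)" by (rule sum_\<phi>_trace[OF y])
    also have "- (pw ^ m) \<cdot>\<^sub>m y = 0\<^sub>m n n \<longleftrightarrow> pw ^ m \<cdot>\<^sub>m y = 0\<^sub>m n n"
    proof -
      have "- (pw ^ m) \<cdot>\<^sub>m y = 0\<^sub>m n n \<longleftrightarrow> (\<forall>i<n. \<forall>j<n. pw ^ m * y $$ (i, j) = 0)"
        using y by (auto simp: mat_eq_iff)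
      also have "\<dots> \<longleftrightarrow> pw ^ m \<cdot>\<^sub>m y = 0\<^sub>m n n" using y by (auto simp: mat_eq_iff)
      finally show ?thesis .
    qed
    finally show "msum d (\<lambda>Y. \<phi> (- (pw ^ m * tr (Y * y))) \<cdot>\<^sub>m \<rho> (K m y)) M =
        (if pw ^ m \<cdot>\<^sub>m y = 0\<^sub>m n n then of_nat (card M) else 0) \<cdot>\<^sub>m 1\<^sub>m d"
      using y K_eq_one[OF y, of m] by (auto simp: \<rho>_one intro!: eq_matI)
  qed
  also have "\<dots> = (\<Sum>y\<in>M. if pw ^ m \<cdot>\<^sub>m y = 0\<^sub>m n n then of_nat (card M) else 0) \<cdot>\<^sub>m 1\<^sub>m d"
    by (rule msum_const_dir) auto
  also have "(\<Sum>y\<in>M. if pw ^ m \<cdot>\<^sub>m y = 0\<^sub>m n n then of_nat (card M) else 0 :: complex) =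
      of_nat (card {y \<in> M. pw ^ m \<cdot>\<^sub>m y = 0\<^sub>m n n} * card M)"
    by (simp flip: sum.inter_filter)
  finally show ?thesis
  proof (intro exI conjI)
    have "0\<^sub>m n n \<in> {y \<in> M. pw ^ m \<cdot>\<^sub>m y = 0\<^sub>m n n}" by simp
    moreover have "finite {y \<in> M. pw ^ m \<cdot>\<^sub>m y = 0\<^sub>m n n}" by simp
    ultimately have "card {y \<in> M. pw ^ m \<cdot>\<^sub>m y = 0\<^sub>m n n} > 0" unfolding card_gt_0_iff by blast
    then have "card {y \<in> M. pw ^ m \<cdot>\<^sub>m y = 0\<^sub>m n n} * card M > 0" using card_M_pos by (rule mult_pos_pos)
    then show "of_nat (card {y \<in> M. pw ^ m \<cdot>\<^sub>m y = 0\<^sub>m n n} * card M) \<noteq> (0 :: complex)"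
      by (metis less_irrefl of_nat_eq_0_iff)
  qed assumption
qed

lemma Q_mult_eigen:
  assumes B: "B \<in> carrier_mat d d" and eig: "\<And>y. y \<in> M \<Longrightarrow> \<rho> (K m y) * B = \<phi> (pw ^ m * tr (Y * y)) \<cdot>\<^sub>m B"
  shows "Q Y * B = of_nat (card M) \<cdot>\<^sub>m B"
proof -
  have "Q Y * B = msum d (\<lambda>y. (\<phi> (- (pw ^ m * tr (Y * y))) \<cdot>\<^sub>m \<rho> (K m y)) * B) M"
    unfolding Q_def using B by (intro msum_mult) auto
  also have "\<dots> = (\<Sum>y\<in>M. 1) \<cdot>\<^sub>m B"
    using B by (intro msum_const_dir) (auto simp: rep_simps eig \<phi>_minus)
  finally show ?thesis by simp
qed

lemma ex_Q_mult_nonzero: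
  assumes B: "B \<in> carrier_mat d d" "B \<noteq> 0\<^sub>m d d"
  shows "\<exists>Y\<in>M. Q Y * B \<noteq> 0\<^sub>m d d"
proof (rule ccontr)
  assume *: "\<not> ?thesis"
  obtain c where c: "c \<noteq> 0" "msum d Q M = c \<cdot>\<^sub>m 1\<^sub>m d" using sum_Q by blast
  have "c \<cdot>\<^sub>m B = msum d Q M * B" using B by (simp add: c rep_simps)
  also have "\<dots> = msum d (\<lambda>Y. Q Y * B) M" using B by (intro msum_mult) auto
  also have "\<dots> = 0\<^sub>m d d" using * by (intro msum_zero) auto
  also have "\<dots> = 0 \<cdot>\<^sub>m B" using B by (auto intro!: eq_matI)
  finally show False using smult_mat_cancel[OF B(1) _ B(2)] c by blast
qed

end

subsection \<open>The idempotent of a companion matrix\<close>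

locale companion_rep = residue_rep pw l \<phi> \<pi> n d \<rho> + companion_form n X
  for pw :: "'r :: comm_ring_1" and l \<phi> and \<pi> :: "'r \<Rightarrow> 'k :: field" and n d \<rho> and X :: "'r mat" +
  assumes Q_X_nonzero: "Q X \<noteq> 0\<^sub>m d d"
begin

lemma tr_X_strict_upper_mult:
  assumes "\<nu> \<in> N" "\<mu> \<in> N"
  shows "tr (X * (\<nu> * \<mu>)) = 0"
proof -
  have c: "\<nu> * \<mu> \<in> M" using assms N_M by auto
  have "X $$ (i, k) * (\<nu> * \<mu>) $$ (k, i) = 0" if "i < n" "k < n" for i k
    using strict_upper_mult_index[OF assms, of k i] companionD(2)[OF companion, of i k] that
    by (cases "i \<le> Suc k") auto
  then show ?thesis unfolding mat_trace_mult_sum[OF X_carrier c]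
    by (intro sum.neutral ballI) simp
qed

text \<open>The pair \<open>(\<nu>, y)\<close> stands for the group element \<open>1 + p\<^sup>r \<nu> + p\<^sup>m y\<close>, and \<open>\<phi> \<circ> wt\<close> is the character of
  the group of these elements. It is multiplicative because \<open>X\<close> vanishes below its subdiagonal.\<close>

definition wt :: "'r mat \<times> 'r mat \<Rightarrow> 'r" where
  "wt = (\<lambda>(\<nu>, y). pw ^ r * tr (X * \<nu>) + pw ^ m * tr (X * y))"

definition b :: "'r mat \<times> 'r mat \<Rightarrow> 'r mat" where
  "b = (\<lambda>(\<nu>, y). 1\<^sub>m n + pw ^ r \<cdot>\<^sub>m \<nu> + pw ^ m \<cdot>\<^sub>m y)"

fun op :: "'r mat \<times> 'r mat \<Rightarrow> 'r mat \<times> 'r mat \<Rightarrow> 'r mat \<times> 'r mat" where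
  "op (\<nu>, y) (\<mu>, z) = (\<nu> + \<mu> + pw ^ r \<cdot>\<^sub>m (\<nu> * \<mu>), y + z)"

abbreviation "I \<equiv> N \<times> M"

lemma b_GL [simp]: "i \<in> I \<Longrightarrow> b i \<in> GL n"
  by (auto simp: b_def GL_perturb GL_one N_M)

lemma op_I: "i \<in> I \<Longrightarrow> j \<in> I \<Longrightarrow> op i j \<in> I"
  by (auto simp: N_M intro!: strict_upper_add strict_upper_smult strict_upper_mult)

lemma b_mult: "i \<in> I \<Longrightarrow> j \<in> I \<Longrightarrow> b i * b j = b (op i j)"
proof -
  assume "i \<in> I" "j \<in> I"
  then obtain \<nu> y \<mu> z where i: "i = (\<nu>, y)" "j = (\<mu>, z)" and c: "\<nu> \<in> M" "\<mu> \<in> M" "y \<in> M" "z \<in> M"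
    using N_M by (cases i, cases j) auto
  have "b i * b j = 1\<^sub>m n + pw ^ r \<cdot>\<^sub>m \<nu> + pw ^ m \<cdot>\<^sub>m y + (pw ^ r \<cdot>\<^sub>m \<mu> + (pw ^ r * pw ^ r) \<cdot>\<^sub>m (\<nu> * \<mu>) + (pw ^ m * pw ^ r) \<cdot>\<^sub>m (y * \<mu>))
      + (pw ^ m \<cdot>\<^sub>m z + (pw ^ r * pw ^ m) \<cdot>\<^sub>m (\<nu> * z) + (pw ^ m * pw ^ m) \<cdot>\<^sub>m (y * z))"
    using c by (simp add: i b_def mat_simps del: pw_vanish pw_r_r)
      (auto simp: algebra_simps simp del: index_mult_mat(1) pw_vanish pw_r_r intro!: eq_matI)
  also have "\<dots> = b (op i j)" using c
    by (simp add: i b_def mat_simps) (auto simp: algebra_simps simp del: index_mult_mat(1) intro!: eq_matI)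
  finally show ?thesis .
qed

lemma wt_op: "i \<in> I \<Longrightarrow> j \<in> I \<Longrightarrow> wt (op i j) = wt i + wt j"
proof -
  assume "i \<in> I" "j \<in> I"
  then obtain \<nu> y \<mu> z where i: "i = (\<nu>, y)" "j = (\<mu>, z)" and c: "\<nu> \<in> N" "\<mu> \<in> N" "y \<in> M" "z \<in> M"
    by (cases i, cases j) auto
  then show ?thesis using N_M[OF c(1)] N_M[OF c(2)] tr_X_strict_upper_mult[OF c(1,2)]
    by (simp add: wt_def mat_simps trace_simps distrib_left)
qed

lemma finite_I [simp]: "finite I"
  by simp

lemma GL_cancel:
  assumes "g \<in> GL n" "A \<in> M" "B \<in> M"
  shows "g * A = g * B \<Longrightarrow> A = B" "A * g = B * g \<Longrightarrow> A = B"
proof -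
  obtain g' where g': "g' \<in> GL n" "g' * g = 1\<^sub>m n" "g * g' = 1\<^sub>m n" using GL_inverse[OF assms(1)] by blast
  have c: "g \<in> M" "g' \<in> M" using g'(1) assms(1) GL_carrier by auto
  have "A = (g' * g) * A" using assms by (simp add: g')
  also have "\<dots> = g' * (g * A)" using assms c by (intro assoc_mult_mat) auto
  also assume "g * A = g * B"
  also have "g' * (g * B) = (g' * g) * B" using assms c by (intro assoc_mult_mat[symmetric]) auto
  finally show "A = B" using assms by (simp add: g')
next
  obtain g' where g': "g' \<in> GL n" "g' * g = 1\<^sub>m n" "g * g' = 1\<^sub>m n" using GL_inverse[OF assms(1)] by blast
  have c: "g \<in> M" "g' \<in> M" using g'(1) assms(1) GL_carrier by auto
  have "A = A * (g * g')" using assms by (simp add: g')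
  also have "\<dots> = (A * g) * g'" using assms c by (intro assoc_mult_mat[symmetric]) auto
  also assume "A * g = B * g"
  also have "(B * g) * g' = B * (g * g')" using assms c by (intro assoc_mult_mat) auto
  finally show "A = B" using assms by (simp add: g')
qed

lemma add_mat_cancel: "A \<in> M \<Longrightarrow> B \<in> M \<Longrightarrow> C \<in> M \<Longrightarrow> A + B = A + C \<Longrightarrow> B = C"
proof -
  assume c: "A \<in> M" "B \<in> M" "C \<in> M" and eq: "A + B = A + C"
  show "B = C"
  proof (rule eq_matI, goal_cases)
    case (1 i j)
    have "(A + B) $$ (i, j) = (A + C) $$ (i, j)" by (simp only: eq)
    then show ?case using 1 c by simp
  qed (use c in auto)
qed

lemma bij_op: "i \<in> I \<Longrightarrow> bij_betw (op i) I I" "i \<in> I \<Longrightarrow> bij_betw (\<lambda>j. op j i) I I"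
proof -
  assume i: "i \<in> I"
  then obtain \<nu> y where iy: "i = (\<nu>, y)" and c: "\<nu> \<in> N" "\<nu> \<in> M" "y \<in> M" using N_M by (cases i) auto
  have "\<mu> = \<mu>' \<and> z = z'" if j: "\<mu> \<in> N" "z \<in> M" "\<mu>' \<in> N" "z' \<in> M" and eq: "op i (\<mu>, z) = op i (\<mu>', z')" for \<mu> z \<mu>' z'
  proof -
    note j = j N_M[OF j(1)] N_M[OF j(3)]
    have 1: "\<nu> + \<mu> + pw ^ r \<cdot>\<^sub>m (\<nu> * \<mu>) = \<nu> + K r \<nu> * \<mu>" if "\<mu> \<in> M" for \<mu>
      using that c by (simp add: K_def mat_simps)
    have "\<nu> + K r \<nu> * \<mu> = \<nu> + K r \<nu> * \<mu>'"
      using eq 1[OF j(5)] 1[OF j(6)] by (simp add: iy)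
    then have "K r \<nu> * \<mu> = K r \<nu> * \<mu>'"
      by (rule add_mat_cancel[of \<nu>, rotated 3]) (use j c in auto)
    then have "\<mu> = \<mu>'" by (rule GL_cancel(1)[of "K r \<nu>", rotated 3]) (use j c in auto)
    moreover have "z = z'" by (rule add_mat_cancel[of y]) (use eq j c in \<open>auto simp: iy\<close>)
    ultimately show ?thesis by simp
  qed
  then have "inj_on (op i) I" by (intro inj_onI) auto
  moreover have "op i ` I \<subseteq> I" by (intro image_subsetI op_I[OF i])
  ultimately show "bij_betw (op i) I I" using endo_inj_surj[OF finite_I] by (simp add: bij_betw_def)
  have "\<mu> = \<mu>' \<and> z = z'" if j: "\<mu> \<in> N" "z \<in> M" "\<mu>' \<in> N" "z' \<in> M" and eq: "op (\<mu>, z) i = op (\<mu>', z') i" for \<mu> z \<mu>' z'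
  proof -
    note j = j N_M[OF j(1)] N_M[OF j(3)]
    have 1: "\<mu> + \<nu> + pw ^ r \<cdot>\<^sub>m (\<mu> * \<nu>) = \<nu> + \<mu> * K r \<nu>" if "\<mu> \<in> M" for \<mu>
      using that c by (simp add: K_def mat_simps)
        (auto simp: algebra_simps simp del: index_mult_mat(1) intro!: eq_matI)
    have "\<nu> + \<mu> * K r \<nu> = \<nu> + \<mu>' * K r \<nu>"
      using eq 1[OF j(5)] 1[OF j(6)] by (simp add: iy)
    then have "\<mu> * K r \<nu> = \<mu>' * K r \<nu>"
      by (rule add_mat_cancel[of \<nu>, rotated 3]) (use j c in auto)
    then have "\<mu> = \<mu>'" by (rule GL_cancel(2)[of "K r \<nu>", rotated 3]) (use j c in auto)
    moreover have "z = z'" by (rule add_mat_cancel[of y]) (use eq j c in \<open>auto simp: iy comm_add_mat[of _ n n y]\<close>)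
    ultimately show ?thesis by simp
  qed
  then have "inj_on (\<lambda>j. op j i) I" by (intro inj_onI) auto
  moreover have "(\<lambda>j. op j i) ` I \<subseteq> I" by (intro image_subsetI op_I[OF _ i])
  ultimately show "bij_betw (\<lambda>j. op j i) I I" using endo_inj_surj[OF finite_I] by (simp add: bij_betw_def)
qed

definition E0 :: "complex mat" where
  "E0 = msum d (\<lambda>i. \<phi> (- wt i) \<cdot>\<^sub>m \<rho> (b i)) I"

lemma E0_carrier [simp]: "E0 \<in> carrier_mat d d" and E0_dim [simp]: "dim_row E0 = d" "dim_col E0 = d"
  by (simp_all add: E0_def)

lemma E0_left:
  assumes i: "i \<in> I"
  shows "\<rho> (b i) * E0 = \<phi> (wt i) \<cdot>\<^sub>m E0"
proof -
  have "E0 = msum d (\<lambda>j. \<phi> (- wt (op i j)) \<cdot>\<^sub>m \<rho> (b (op i j))) I"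
    unfolding E0_def by (rule msum_reindex[OF bij_op(1)[OF i]])
  then have "\<phi> (wt i) \<cdot>\<^sub>m E0 = msum d (\<lambda>j. \<phi> (wt i) \<cdot>\<^sub>m (\<phi> (- wt (op i j)) \<cdot>\<^sub>m \<rho> (b (op i j)))) I"
    by (simp only:) (rule smult_msum, use op_I[OF i] in simp)
  also have "\<dots> = msum d (\<lambda>j. \<rho> (b i) * (\<phi> (- wt j) \<cdot>\<^sub>m \<rho> (b j))) I"
  proof (rule msum_cong)
    fix j assume j: "j \<in> I"
    have "\<phi> (wt i) * \<phi> (- wt (op i j)) = \<phi> (- wt j)" using wt_op[OF i j] by (simp flip: \<phi>_add)
    then show "\<phi> (wt i) \<cdot>\<^sub>m (\<phi> (- wt (op i j)) \<cdot>\<^sub>m \<rho> (b (op i j))) = \<rho> (b i) * (\<phi> (- wt j) \<cdot>\<^sub>m \<rho> (b j))"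
      using i j by (simp add: smult_smult_mat mult_smult_distrib[of _ d d _ d] flip: b_mult \<rho>_mult)
  qed
  also have "\<dots> = \<rho> (b i) * E0" unfolding E0_def using i by (intro mult_msum[symmetric]) auto
  finally show ?thesis by simp
qed

lemma E0_right:
  assumes i: "i \<in> I"
  shows "E0 * \<rho> (b i) = \<phi> (wt i) \<cdot>\<^sub>m E0"
proof -
  have "E0 = msum d (\<lambda>j. \<phi> (- wt (op j i)) \<cdot>\<^sub>m \<rho> (b (op j i))) I"
    unfolding E0_def by (rule msum_reindex[OF bij_op(2)[OF i]])
  then have "\<phi> (wt i) \<cdot>\<^sub>m E0 = msum d (\<lambda>j. \<phi> (wt i) \<cdot>\<^sub>m (\<phi> (- wt (op j i)) \<cdot>\<^sub>m \<rho> (b (op j i)))) I"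
    by (simp only:) (rule smult_msum, use op_I[OF _ i] in simp)
  also have "\<dots> = msum d (\<lambda>j. (\<phi> (- wt j) \<cdot>\<^sub>m \<rho> (b j)) * \<rho> (b i)) I"
  proof (rule msum_cong)
    fix j assume j: "j \<in> I"
    have "\<phi> (wt i) * \<phi> (- wt (op j i)) = \<phi> (- wt j)" using wt_op[OF j i] by (simp flip: \<phi>_add)
    then show "\<phi> (wt i) \<cdot>\<^sub>m (\<phi> (- wt (op j i)) \<cdot>\<^sub>m \<rho> (b (op j i))) = (\<phi> (- wt j) \<cdot>\<^sub>m \<rho> (b j)) * \<rho> (b i)"
      using i j by (simp add: smult_smult_mat mult_smult_assoc_mat[of _ d d _ d] flip: b_mult \<rho>_mult)
  qed
  also have "\<dots> = E0 * \<rho> (b i)" unfolding E0_def using i by (intro msum_mult[symmetric]) auto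
  finally show ?thesis by simp
qed

lemma card_I_pos: "card I > 0"
  using strict_upper_zero[of n] by (subst card_gt_0_iff) auto

lemma E0_E0: "E0 * E0 = of_nat (card I) \<cdot>\<^sub>m E0"
proof -
  have "E0 * E0 = msum d (\<lambda>i. (\<phi> (- wt i) \<cdot>\<^sub>m \<rho> (b i)) * E0) I"
    by (subst (1) E0_def, rule msum_mult) auto
  also have "\<dots> = (\<Sum>i\<in>I. 1) \<cdot>\<^sub>m E0"
    by (intro msum_const_dir) (auto simp: mult_smult_assoc_mat[of _ d d _ d] E0_left smult_smult_mat \<phi>_minus)
  finally show ?thesis by simp
qed

lemma b_K: "\<nu> \<in> N \<Longrightarrow> b (\<nu>, 0\<^sub>m n n) = K r \<nu>" "y \<in> M \<Longrightarrow> b (0\<^sub>m n n, y) = K m y"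
  using N_M by (auto simp: b_def K_def intro!: eq_matI)

lemma wt_K: "\<nu> \<in> N \<Longrightarrow> wt (\<nu>, 0\<^sub>m n n) = pw ^ r * tr (X * \<nu>)" "y \<in> M \<Longrightarrow> wt (0\<^sub>m n n, y) = pw ^ m * tr (X * y)"
  by (auto simp: wt_def mat_trace_def)

lemma E0_K:
  assumes "y \<in> M"
  shows "\<rho> (K m y) * E0 = \<phi> (pw ^ m * tr (X * y)) \<cdot>\<^sub>m E0" "E0 * \<rho> (K m y) = \<phi> (pw ^ m * tr (X * y)) \<cdot>\<^sub>m E0"
  using E0_left[of "(0\<^sub>m n n, y)"] E0_right[of "(0\<^sub>m n n, y)"] strict_upper_zero[of n] assms
  by (simp_all add: b_K wt_K)

lemma Q_E0: "Q X * E0 = of_nat (card M) \<cdot>\<^sub>m E0"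
  by (intro Q_mult_eigen) (auto simp: E0_K)

lemma E0_Q: "E0 * Q X = of_nat (card M) \<cdot>\<^sub>m E0"
proof -
  have "E0 * Q X = msum d (\<lambda>y. E0 * (\<phi> (- (pw ^ m * tr (X * y))) \<cdot>\<^sub>m \<rho> (K m y))) M"
    unfolding Q_def by (intro mult_msum) auto
  also have "\<dots> = (\<Sum>y\<in>M. 1) \<cdot>\<^sub>m E0"
    by (intro msum_const_dir) (auto simp: E0_K rep_simps \<phi>_minus)
  finally show ?thesis by simp
qed

lemma pw_r_smult_shift:
  assumes "w \<in> M" "pw ^ (2 * r) \<cdot>\<^sub>m w = 0\<^sub>m n n"
  shows "\<exists>z\<in>M. pw ^ r \<cdot>\<^sub>m w = pw ^ m \<cdot>\<^sub>m z"
proof -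
  have "2 * r \<le> l" by (simp add: r_def)
  then obtain z where z: "z \<in> M" "w = pw ^ (l - 2 * r) \<cdot>\<^sub>m z"
    using pw_smult_eq_0D[OF assms] by blast
  have "r + (l - 2 * r) = m" using \<open>2 * r \<le> l\<close> by (simp add: m_def)
  then have "pw ^ r * pw ^ (l - 2 * r) = pw ^ m" by (simp flip: power_add)
  then show ?thesis using z by (auto simp: smult_smult_mat)
qed

text \<open>Conjugating \<open>E0 = 0\<close> by \<open>1 + p\<^sup>r \<beta>\<close> twists the summand of \<open>\<nu>\<close> by
  \<open>\<phi> (p\<^bsup>2r\<^esup> tr ((X \<nu> - \<nu> X) \<beta>))\<close>. Summing over \<open>\<beta>\<close> leaves those \<open>\<nu>\<close> with \<open>p\<^bsup>2r\<^esup> \<nu> = 0\<close>, each of which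
  contributes \<open>Q X\<close>.\<close>

lemma E0_nonzero: "E0 \<noteq> 0\<^sub>m d d"
proof
  assume E0: "E0 = 0\<^sub>m d d"
  define R where "R \<nu> = msum d (\<lambda>y. \<phi> (- wt (\<nu>, y)) \<cdot>\<^sub>m \<rho> (b (\<nu>, y))) M" for \<nu>
  have R_carrier [simp]: "R \<nu> \<in> carrier_mat d d" for \<nu> by (simp add: R_def)
  have R: "R \<nu> = Q X" if \<nu>: "\<nu> \<in> N" "pw ^ (2 * r) \<cdot>\<^sub>m \<nu> = 0\<^sub>m n n" for \<nu>
  proof -
    note \<nu>M = N_M[OF \<nu>(1)]
    obtain z where z: "z \<in> M" "pw ^ r \<cdot>\<^sub>m \<nu> = pw ^ m \<cdot>\<^sub>m z" using pw_r_smult_shift[OF \<nu>M \<nu>(2)] by blast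
    have "pw ^ r * tr (X * \<nu>) = tr (X * (pw ^ r \<cdot>\<^sub>m \<nu>))" using \<nu>M by (simp add: mat_simps trace_simps)
    also have "\<dots> = pw ^ m * tr (X * z)" using z by (simp add: mat_simps trace_simps)
    finally have t: "pw ^ r * tr (X * \<nu>) = pw ^ m * tr (X * z)" .
    have "R \<nu> = msum d (\<lambda>y. \<phi> (- (pw ^ m * tr (X * (z + y)))) \<cdot>\<^sub>m \<rho> (K m (z + y))) M"
      unfolding R_def
    proof (rule msum_cong)
      fix y assume y: "y \<in> M"
      have "b (\<nu>, y) = K m (z + y)" using z(1) y \<nu>M
        by (simp add: b_def K_def mat_simps z(2)) (auto simp: algebra_simps intro!: eq_matI)
      moreover have "wt (\<nu>, y) = pw ^ m * tr (X * (z + y))" using z y by (simp add: wt_def t mat_simps trace_simps distrib_left)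
      ultimately show "\<phi> (- wt (\<nu>, y)) \<cdot>\<^sub>m \<rho> (b (\<nu>, y)) = \<phi> (- (pw ^ m * tr (X * (z + y)))) \<cdot>\<^sub>m \<rho> (K m (z + y))" by simp
    qed
    also have "\<dots> = Q X" unfolding Q_def by (rule msum_reindex[OF bij_translate[OF z(1)], symmetric])
    finally show ?thesis .
  qed
  have conj: "msum d (\<lambda>\<nu>. \<phi> (pw ^ (2 * r) * tr ((X * \<nu> - \<nu> * X) * \<beta>)) \<cdot>\<^sub>m R \<nu>) N = 0\<^sub>m d d" if \<beta>: "\<beta> \<in> M" for \<beta>
  proof -
    define k where "k = K r \<beta>"
    have k: "k \<in> GL n" "k \<in> M" using \<beta> by (auto simp: k_def)
    obtain k' where k': "k' \<in> GL n" "k' * k = 1\<^sub>m n" using GL_inverse[OF k(1)] by blast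
    have k'c: "k' \<in> M" using k' GL_carrier by auto
    define \<delta> where "\<delta> \<nu> = pw ^ (2 * r - m) \<cdot>\<^sub>m (\<nu> * \<beta> - \<beta> * \<nu>)" for \<nu>
    have \<delta>: "\<delta> \<nu> \<in> M" if "\<nu> \<in> M" for \<nu> using that \<beta> by (simp add: \<delta>_def)
    have bk: "k' * b (\<nu>, y) * k = b (\<nu>, \<delta> \<nu> + y)" if \<nu>: "\<nu> \<in> M" and y: "y \<in> M" for \<nu> y
    proof -
      have 1: "b (\<nu>, y) * k = 1\<^sub>m n + pw ^ r \<cdot>\<^sub>m \<nu> + pw ^ m \<cdot>\<^sub>m y + (pw ^ r \<cdot>\<^sub>m \<beta> + pw ^ (2 * r) \<cdot>\<^sub>m (\<nu> * \<beta>))"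
        using \<nu> y \<beta> by (simp add: b_def k_def K_def mat_simps)
          (auto simp: algebra_simps simp del: index_mult_mat(1) intro!: eq_matI)
      have 2: "b (\<nu>, \<delta> \<nu> + y) = 1\<^sub>m n + pw ^ r \<cdot>\<^sub>m \<nu> + pw ^ m \<cdot>\<^sub>m y + pw ^ (2 * r) \<cdot>\<^sub>m (\<nu> * \<beta> - \<beta> * \<nu>)"
        using \<nu> y \<beta> by (simp add: b_def \<delta>_def mat_simps)
          (auto simp: algebra_simps simp del: index_mult_mat(1) intro!: eq_matI)
      have 3: "k * b (\<nu>, \<delta> \<nu> + y) = b (\<nu>, y) * k"
        unfolding 1 2 using \<nu> y \<beta> by (simp add: k_def K_def mat_simps)
          (auto simp: algebra_simps simp del: index_mult_mat(1) intro!: eq_matI)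
      have c: "b (\<nu>, \<delta> \<nu> + y) \<in> M" "b (\<nu>, y) \<in> M" using \<nu> y \<delta>[OF \<nu>] by (auto simp: b_def)
      have "k' * b (\<nu>, y) * k = k' * (k * b (\<nu>, \<delta> \<nu> + y))" unfolding 3 using c k k'c by (simp add: mat_simps)
      also have "\<dots> = (k' * k) * b (\<nu>, \<delta> \<nu> + y)" using c k k'c by (intro assoc_mult_mat[symmetric]) auto
      finally show ?thesis using c by (simp add: k'(2))
    qed
    have "0\<^sub>m d d = \<rho> k' * (E0 * \<rho> k)" unfolding E0 using k k' by simp
    also have "\<dots> = msum d (\<lambda>i. \<rho> k' * ((\<phi> (- wt i) \<cdot>\<^sub>m \<rho> (b i)) * \<rho> k)) I"
      unfolding E0_def using k k' by (subst msum_mult, simp, simp, subst mult_msum) auto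
    also have "\<dots> = msum d (\<lambda>(\<nu>, y). \<phi> (- wt (\<nu>, y)) \<cdot>\<^sub>m \<rho> (b (\<nu>, \<delta> \<nu> + y))) I"
    proof (rule msum_cong, clarify)
      fix \<nu> y assume \<nu>: "\<nu> \<in> N" and y: "y \<in> M"
      have i: "(\<nu>, y) \<in> I" using \<nu> y by simp
      have "\<rho> k' * (\<rho> (b (\<nu>, y)) * \<rho> k) = \<rho> (k' * b (\<nu>, y) * k)"
        using k k' i by (simp add: \<rho>_mult GL_mult rep_simps)
      then show "\<rho> k' * ((\<phi> (- wt (\<nu>, y)) \<cdot>\<^sub>m \<rho> (b (\<nu>, y))) * \<rho> k) = \<phi> (- wt (\<nu>, y)) \<cdot>\<^sub>m \<rho> (b (\<nu>, \<delta> \<nu> + y))"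
        using k k' i by (simp add: rep_simps bk[OF N_M[OF \<nu>] y])
    qed
    also have "\<dots> = msum d (\<lambda>\<nu>. msum d (\<lambda>y. \<phi> (- wt (\<nu>, y)) \<cdot>\<^sub>m \<rho> (b (\<nu>, \<delta> \<nu> + y))) M) N"
      by (simp add: msum_Times)
    also have "\<dots> = msum d (\<lambda>\<nu>. \<phi> (pw ^ (2 * r) * tr ((X * \<nu> - \<nu> * X) * \<beta>)) \<cdot>\<^sub>m R \<nu>) N"
    proof (rule msum_cong)
      fix \<nu> assume \<nu>N: "\<nu> \<in> N"
      note \<nu> = N_M[OF \<nu>N]
      let ?c = "\<phi> (pw ^ (2 * r) * tr ((X * \<nu> - \<nu> * X) * \<beta>))"
      have "tr (X * (\<beta> * \<nu>)) = tr (\<nu> * (X * \<beta>))"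
        using \<nu> \<beta> mat_trace_comm[of "X * \<beta>" n \<nu>] by (simp add: mat_simps)
      then have t: "pw ^ m * tr (X * \<delta> \<nu>) = pw ^ (2 * r) * tr ((X * \<nu> - \<nu> * X) * \<beta>)"
        using \<nu> \<beta> by (simp add: \<delta>_def mat_simps trace_simps right_diff_distrib flip: mult.assoc)
      have "msum d (\<lambda>y. \<phi> (- wt (\<nu>, y)) \<cdot>\<^sub>m \<rho> (b (\<nu>, \<delta> \<nu> + y))) M =
          msum d (\<lambda>y. ?c \<cdot>\<^sub>m (\<phi> (- wt (\<nu>, \<delta> \<nu> + y)) \<cdot>\<^sub>m \<rho> (b (\<nu>, \<delta> \<nu> + y)))) M"
      proof (rule msum_cong)
        fix y assume y: "y \<in> M"
        have "wt (\<nu>, \<delta> \<nu> + y) = wt (\<nu>, y) + pw ^ (2 * r) * tr ((X * \<nu> - \<nu> * X) * \<beta>)"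
          using y \<delta>[OF \<nu>] by (simp add: wt_def mat_simps trace_simps distrib_left t)
        then have "?c * \<phi> (- wt (\<nu>, \<delta> \<nu> + y)) = \<phi> (- wt (\<nu>, y))" by (simp flip: \<phi>_add)
        then show "\<phi> (- wt (\<nu>, y)) \<cdot>\<^sub>m \<rho> (b (\<nu>, \<delta> \<nu> + y)) = ?c \<cdot>\<^sub>m (\<phi> (- wt (\<nu>, \<delta> \<nu> + y)) \<cdot>\<^sub>m \<rho> (b (\<nu>, \<delta> \<nu> + y)))"
          by (simp add: smult_smult_mat)
      qed
      also have "\<dots> = ?c \<cdot>\<^sub>m msum d (\<lambda>y. \<phi> (- wt (\<nu>, \<delta> \<nu> + y)) \<cdot>\<^sub>m \<rho> (b (\<nu>, \<delta> \<nu> + y))) M"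
        using \<nu>N \<delta>[OF \<nu>] by (intro smult_msum[symmetric]) simp
      also have "msum d (\<lambda>y. \<phi> (- wt (\<nu>, \<delta> \<nu> + y)) \<cdot>\<^sub>m \<rho> (b (\<nu>, \<delta> \<nu> + y))) M = R \<nu>"
        unfolding R_def by (rule msum_reindex[OF bij_translate[OF \<delta>[OF \<nu>]], symmetric])
      finally show "msum d (\<lambda>y. \<phi> (- wt (\<nu>, y)) \<cdot>\<^sub>m \<rho> (b (\<nu>, \<delta> \<nu> + y))) M = ?c \<cdot>\<^sub>m R \<nu>" .
    qed
    finally show ?thesis by simp
  qed
  define C where "C \<nu> \<longleftrightarrow> pw ^ (2 * r) \<cdot>\<^sub>m (X * \<nu> - \<nu> * X) = 0\<^sub>m n n" for \<nu>
  have "0\<^sub>m d d = msum d (\<lambda>\<beta>. msum d (\<lambda>\<nu>. \<phi> (pw ^ (2 * r) * tr ((X * \<nu> - \<nu> * X) * \<beta>)) \<cdot>\<^sub>m R \<nu>) N) M"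
    by (rule msum_zero[symmetric]) (rule conj)
  also have "\<dots> = msum d (\<lambda>\<nu>. msum d (\<lambda>\<beta>. \<phi> (pw ^ (2 * r) * tr ((X * \<nu> - \<nu> * X) * \<beta>)) \<cdot>\<^sub>m R \<nu>) M) N"
    by (rule msum_swap)
  also have "\<dots> = msum d (\<lambda>\<nu>. (if C \<nu> then of_nat (card M) else 0) \<cdot>\<^sub>m Q X) N"
  proof (rule msum_cong)
    fix \<nu> assume \<nu>N: "\<nu> \<in> N"
    note \<nu> = N_M[OF \<nu>N]
    have "msum d (\<lambda>\<beta>. \<phi> (pw ^ (2 * r) * tr ((X * \<nu> - \<nu> * X) * \<beta>)) \<cdot>\<^sub>m R \<nu>) M =
        (\<Sum>\<beta>\<in>M. \<phi> (pw ^ (2 * r) * tr ((X * \<nu> - \<nu> * X) * \<beta>))) \<cdot>\<^sub>m R \<nu>"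
      by (rule msum_const_dir) auto
    also have "\<dots> = (if C \<nu> then of_nat (card M) else 0) \<cdot>\<^sub>m R \<nu>"
      unfolding C_def using \<nu> by (subst sum_\<phi>_trace) auto
    also have "\<dots> = (if C \<nu> then of_nat (card M) else 0) \<cdot>\<^sub>m Q X"
    proof (cases "C \<nu>")
      case True
      have "pw ^ (2 * r) \<cdot>\<^sub>m (\<nu> * X - X * \<nu>) = 0\<^sub>m n n"
      proof -
        have c: "\<nu> * X \<in> M" "X * \<nu> \<in> M" using \<nu> by auto
        have "pw ^ (2 * r) \<cdot>\<^sub>m (\<nu> * X - X * \<nu>) = - (pw ^ (2 * r) \<cdot>\<^sub>m (X * \<nu> - \<nu> * X))"
          using c \<nu> by (intro eq_matI) (auto simp: algebra_simps simp del: index_mult_mat(1))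
        then show ?thesis using True by (auto simp: C_def)
      qed
      then have "pw ^ (2 * r) \<cdot>\<^sub>m \<nu> = 0\<^sub>m n n"
        using strict_upperD(2)[OF \<nu>N] by (intro smult_eq_0_if_commuting[OF companion \<nu>]) auto
      then show ?thesis using R[OF \<nu>N] by simp
    next
      case False
      then show ?thesis by (simp add: zero_smult_mat[of _ d d])
    qed
    finally show "msum d (\<lambda>\<beta>. \<phi> (pw ^ (2 * r) * tr ((X * \<nu> - \<nu> * X) * \<beta>)) \<cdot>\<^sub>m R \<nu>) M =
      (if C \<nu> then of_nat (card M) else 0) \<cdot>\<^sub>m Q X" .
  qed
  also have "\<dots> = (\<Sum>\<nu>\<in>N. if C \<nu> then of_nat (card M) else 0) \<cdot>\<^sub>m Q X"
    by (rule msum_const_dir) auto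
  also have "(\<Sum>\<nu>\<in>N. if C \<nu> then of_nat (card M) else 0 :: complex) = of_nat (card {\<nu> \<in> N. C \<nu>} * card M)"
    by (simp flip: sum.inter_filter)
  finally have "of_nat (card {\<nu> \<in> N. C \<nu>} * card M) \<cdot>\<^sub>m Q X = 0 \<cdot>\<^sub>m Q X"
    by (simp add: zero_smult_mat[of "Q X" d d])
  then have "of_nat (card {\<nu> \<in> N. C \<nu>} * card M) = (0 :: complex)"
    by (rule smult_mat_cancel[OF Q_carrier _ Q_X_nonzero])
  moreover have "card {\<nu> \<in> N. C \<nu>} > 0"
  proof -
    have "X * 0\<^sub>m n n = 0\<^sub>m n n" "0\<^sub>m n n * X = 0\<^sub>m n n" by auto
    then have "0\<^sub>m n n \<in> {\<nu> \<in> N. C \<nu>}" using strict_upper_zero[of n] by (auto simp: C_def intro!: eq_matI)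
    moreover have "finite {\<nu> \<in> N. C \<nu>}" by simp
    ultimately show ?thesis unfolding card_gt_0_iff by blast
  qed
  ultimately show False using card_M_pos by (metis mult_is_0 not_gr0 of_nat_eq_0_iff)
qed

definition F :: "'r mat \<Rightarrow> complex mat" where
  "F g = E0 * \<rho> g * E0"

lemma F_carrier: "g \<in> GL n \<Longrightarrow> F g \<in> carrier_mat d d"
  by (simp add: F_def)

lemma F_left:
  assumes "g \<in> GL n" "i \<in> I"
  shows "F (b i * g) = \<phi> (wt i) \<cdot>\<^sub>m F g"
proof -
  have "F (b i * g) = (E0 * \<rho> (b i)) * (\<rho> g * E0)" using assms by (simp add: F_def \<rho>_mult rep_simps)
  then show ?thesis using assms by (simp add: E0_right F_def rep_simps)
qed

lemma F_right:
  assumes "g \<in> GL n" "i \<in> I"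
  shows "F (g * b i) = \<phi> (wt i) \<cdot>\<^sub>m F g"
proof -
  have "F (g * b i) = (E0 * \<rho> g) * (\<rho> (b i) * E0)" using assms by (simp add: F_def \<rho>_mult rep_simps)
  then show ?thesis using assms by (simp add: E0_left F_def rep_simps)
qed

lemma F_support:
  assumes g: "g \<in> GL n" and nz: "F g \<noteq> 0\<^sub>m d d"
  shows "pw ^ m \<cdot>\<^sub>m (g * X - X * g) = 0\<^sub>m n n"
proof (rule Q_sandwich[OF g X_carrier X_carrier], rule notI)
  assume 0: "Q X * \<rho> g * Q X = 0\<^sub>m d d"
  let ?c = "of_nat (card M) :: complex"
  have "(?c * ?c) \<cdot>\<^sub>m F g = (E0 * Q X) * \<rho> g * (Q X * E0)"
    using g by (simp add: E0_Q Q_E0 F_def rep_simps)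
  also have "\<dots> = E0 * (Q X * \<rho> g * Q X) * E0" using g by (simp add: rep_simps)
  also have "\<dots> = 0 \<cdot>\<^sub>m F g" unfolding 0 using g by (simp add: zero_smult_mat[OF F_carrier])
  finally have "?c * ?c = 0" by (rule smult_mat_cancel[OF F_carrier[OF g] _ nz])
  then show False using card_M_pos by simp
qed

lemma F_shift:
  assumes g: "g \<in> GL n" and c: "c \<in> M" "c' \<in> M" "c' * c = 1\<^sub>m n" "c * c' = 1\<^sub>m n"
    and gc: "pw ^ m \<cdot>\<^sub>m (g - c) = 0\<^sub>m n n" and z: "z \<in> M"
  shows "F (g + pw ^ m \<cdot>\<^sub>m z) = \<phi> (pw ^ m * tr (X * (c' * z))) \<cdot>\<^sub>m F g"
proof -
  obtain g' where g': "g' \<in> GL n" "g' * g = 1\<^sub>m n" "g * g' = 1\<^sub>m n" using GL_inverse[OF g] by blast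
  have gM: "g \<in> M" "g' \<in> M" using g g' GL_carrier by auto
  have "g * (g' * z) = z"
  proof -
    have "g * (g' * z) = (g * g') * z" using gM z by (intro assoc_mult_mat[symmetric]) auto
    then show ?thesis using z by (simp add: g'(3))
  qed
  then have 1: "g + pw ^ m \<cdot>\<^sub>m z = g * b (0\<^sub>m n n, g' * z)"
    using gM z by (simp add: b_K K_def mat_simps)
  have "pw ^ m \<cdot>\<^sub>m (c' * z) = pw ^ m \<cdot>\<^sub>m (g' * z)"
  proof -
    have "g' * ((pw ^ m \<cdot>\<^sub>m (g - c)) * (c' * z)) = 0\<^sub>m n n" unfolding gc using gM c z by simp
    moreover have "g' * ((pw ^ m \<cdot>\<^sub>m (g - c)) * (c' * z)) = pw ^ m \<cdot>\<^sub>m ((g' * g) * (c' * z)) - pw ^ m \<cdot>\<^sub>m (g' * ((c * c') * z))"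
      using gM c(1,2) z by (simp add: mat_simps)
    ultimately have "pw ^ m \<cdot>\<^sub>m (c' * z) - pw ^ m \<cdot>\<^sub>m (g' * z) = 0\<^sub>m n n" using gM c z by (simp add: g' c(4))
    then have eq: "(pw ^ m \<cdot>\<^sub>m (c' * z) - pw ^ m \<cdot>\<^sub>m (g' * z)) $$ (i, j) = 0" if "i < n" "j < n" for i j
      using that by simp
    show ?thesis
    proof (rule eq_matI, goal_cases)
      case (1 i j)
      then have ij: "i < n" "j < n" using gM z by auto
      then show ?case using eq[OF ij] gM c z by (simp del: index_mult_mat(1))
    qed (use gM c z in auto)
  qed
  then have "tr (X * (pw ^ m \<cdot>\<^sub>m (c' * z))) = tr (X * (pw ^ m \<cdot>\<^sub>m (g' * z)))" by simp
  then have "pw ^ m * tr (X * (c' * z)) = pw ^ m * tr (X * (g' * z))"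
    using gM c z by (simp add: mult_smult_distrib[of _ n n _ n] mat_trace_smult[of _ n])
  then show ?thesis unfolding 1 using F_right[OF g, of "(0\<^sub>m n n, g' * z)"] gM z strict_upper_zero[of n]
    by (simp add: wt_K)
qed

end

subsection \<open>Multiplicity one for the Whittaker character\<close>

context companion_rep
begin

lemma tr_\<tau>_X: "y \<in> M \<Longrightarrow> tr (X * \<tau> y) = tr (X * y)"
proof -
  assume y: "y \<in> M"
  have "tr (X * \<tau> y) = tr (\<tau> (y * X))" using y by (simp add: \<tau>_mult)
  also have "\<dots> = tr (y * X)" using y by (simp add: \<tau>_trace)
  finally show ?thesis using y by (simp add: mat_trace_comm[of y n])
qed

lemma smult_mat_eq_iff:
  assumes "A \<in> M" "B \<in> M"
  shows "\<kappa> \<cdot>\<^sub>m A = \<kappa> \<cdot>\<^sub>m B \<longleftrightarrow> \<kappa> \<cdot>\<^sub>m (A - B) = 0\<^sub>m n n"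
  using assms by (auto simp: mat_eq_iff right_diff_distrib)

lemma lower_entries_eq_0:
  assumes z: "z \<in> M" and h: "\<And>\<nu>. \<nu> \<in> N \<Longrightarrow> \<phi> (\<kappa> * tr (z * \<nu>)) = 1" and ij: "i < n" "j < i"
  shows "\<kappa> * z $$ (i, j) = 0"
proof (rule \<phi>_nondegenerate)
  fix t :: 'r
  have "entry_mat n j i t \<in> N" using ij by (auto simp: strict_upper_def entry_mat_def)
  then show "\<phi> (\<kappa> * z $$ (i, j) * t) = 1"
    using h[of "entry_mat n j i t"] z ij by (simp add: mat_trace_entry_mat mult.assoc)
qed

lemma \<tau>_fixed_if_orthogonal:
  assumes \<beta>: "\<beta> \<in> M" and h: "\<And>h. h \<in> M \<Longrightarrow> \<tau> h = h \<Longrightarrow> \<phi> (\<kappa> * tr ((\<beta> * X - X * \<beta>) * h)) = 1"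
  shows "\<kappa> \<cdot>\<^sub>m \<tau> \<beta> = \<kappa> \<cdot>\<^sub>m \<beta>"
proof -
  define y where "y = \<beta> * X - X * \<beta>"
  have y: "y \<in> M" using \<beta> by (simp add: y_def)
  have Sy: "S * y \<in> M" using y by simp
  have tr_S: "tr (y * (e * S)) = tr ((S * y) * e)" if "e \<in> M" for e :: "'r mat"
    using that y mat_trace_comm[of "y * e" n S] by (simp add: mat_simps)
  show ?thesis
  proof (rule \<tau>_fixed_if_commutator_alternating[OF \<beta>], unfold y_def[symmetric])
    fix i j assume ij: "i < n" "j < n"
    show "\<kappa> * ((S * y) $$ (i, j) + (S * y) $$ (j, i)) = 0"
    proof (rule \<phi>_nondegenerate)
      fix t :: 'r
      define e where "e = entry_mat n i j t + entry_mat n j i t"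
      have e: "e \<in> M" by (simp add: e_def)
      have "\<phi> (\<kappa> * tr (y * (e * S))) = 1"
        unfolding y_def by (rule h) (use e sym_entry_mats(2)[of i j t] in \<open>simp_all add: e_def\<close>)
      moreover have "tr ((S * y) * e) = ((S * y) $$ (i, j) + (S * y) $$ (j, i)) * t"
        unfolding e_def using Sy ij
        by (simp add: mult_add_distrib_mat[of _ n n _ n] mat_trace_add[of _ n] mat_trace_entry_mat distrib_right add.commute del: index_mult_mat(1))
      ultimately show "\<phi> (\<kappa> * ((S * y) $$ (i, j) + (S * y) $$ (j, i)) * t) = 1"
        using tr_S[OF e] by (simp add: mult.assoc del: index_mult_mat(1))
    qed
  next
    fix i assume i: "i < n"
    show "\<kappa> * (S * y) $$ (i, i) = 0"
    proof (rule \<phi>_nondegenerate)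
      fix t :: 'r
      have e: "entry_mat n i i t \<in> M" by simp
      have "\<phi> (\<kappa> * tr (y * (entry_mat n i i t * S))) = 1"
        unfolding y_def by (rule h) (use sym_entry_mats(1)[of i t] in simp_all)
      moreover have "tr ((S * y) * entry_mat n i i t) = (S * y) $$ (i, i) * t"
        using Sy i by (simp add: mat_trace_entry_mat del: index_mult_mat(1))
      ultimately show "\<phi> (\<kappa> * (S * y) $$ (i, i) * t) = 1"
        using tr_S[OF e] by (simp add: mult.assoc del: index_mult_mat(1))
    qed
  qed
qed

lemma commuting_comm:
  assumes "c \<in> M" "s \<in> M" "c * X = X * c" "s * X = X * s"
  shows "c * s = s * c"
proof -
  have "(c * s) * X = X * (c * s)"
  proof -
    have "(c * s) * X = c * (X * s)" using assms by (simp add: sq_simps)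
    also have "\<dots> = (c * X) * s" using assms by (intro assoc_mult_mat[symmetric]) auto
    also have "\<dots> = X * (c * s)" unfolding assms(3) using assms(1,2) by (intro assoc_mult_mat) auto
    finally show ?thesis .
  qed
  then have "\<tau> (c * s) = c * s" using assms by (intro \<tau>_commuting) auto
  then show ?thesis using assms \<tau>_commuting[of c] \<tau>_commuting[of s] by (simp add: \<tau>_mult)
qed

lemma F_orthogonality:
  assumes g: "g \<in> GL n" "g = c + pw ^ r \<cdot>\<^sub>m a" and a: "a \<in> M"
    and c: "c \<in> M" "c' \<in> M" "c' * c = 1\<^sub>m n" "c * c' = 1\<^sub>m n" "c * X = X * c" "c' * X = X * c'"
    and \<nu>: "\<nu> \<in> N" "pw ^ (2 * r) \<cdot>\<^sub>m (c * \<nu>) = pw ^ (2 * r) \<cdot>\<^sub>m (\<tau> \<nu> * c)"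
    and nz: "F g \<noteq> 0\<^sub>m d d"
  shows "\<phi> (pw ^ (2 * r) * tr (((\<nu> * c') * X - X * (\<nu> * c')) * a)) = 1"
proof -
  note \<nu>M = N_M[OF \<nu>(1)]
  have \<tau>N: "\<tau> \<nu> \<in> N" and \<tau>M: "\<tau> \<nu> \<in> M" using \<tau>_strict_upper[OF \<nu>(1)] N_M by auto
  have cancel: "c' * (c * Y) = Y" "c * (c' * Y) = Y" if "Y \<in> M" for Y
    using that c(1-4) assoc_mult_mat[of c' n n c n Y n] assoc_mult_mat[of c n n c' n Y n] by auto
  have swap: "c' * (X * Y) = X * (c' * Y)" if "Y \<in> M" for Y
    using that c(2,6) assoc_mult_mat[of c' n n X n Y n] assoc_mult_mat[of X n n c' n Y n] by auto
  define w where "w = c * \<nu> - \<tau> \<nu> * c"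
  have w: "w \<in> M" using \<nu>M c by (simp add: w_def)
  have "pw ^ (2 * r) \<cdot>\<^sub>m w = 0\<^sub>m n n" using \<nu>(2) \<nu>M c \<tau>M by (simp add: w_def flip: smult_mat_eq_iff)
  then obtain z0 where z0: "z0 \<in> M" "pw ^ r \<cdot>\<^sub>m w = pw ^ m \<cdot>\<^sub>m z0" using pw_r_smult_shift[OF w] by blast
  define z where "z = z0 + pw ^ (2 * r - m) \<cdot>\<^sub>m (a * \<nu> - \<tau> \<nu> * a)"
  have z: "z \<in> M" using z0 a \<nu>M \<tau>M by (simp add: z_def)
  have pz: "pw ^ m \<cdot>\<^sub>m z = pw ^ r \<cdot>\<^sub>m (c * \<nu>) - pw ^ r \<cdot>\<^sub>m (\<tau> \<nu> * c) + pw ^ (2 * r) \<cdot>\<^sub>m (a * \<nu>) - pw ^ (2 * r) \<cdot>\<^sub>m (\<tau> \<nu> * a)"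
  proof -
    have "pw ^ m \<cdot>\<^sub>m z = pw ^ r \<cdot>\<^sub>m w + pw ^ (2 * r) \<cdot>\<^sub>m (a * \<nu> - \<tau> \<nu> * a)"
      using z0 a \<nu>M \<tau>M by (simp add: z_def mat_simps)
    then show ?thesis using a \<nu>M \<tau>M c by (simp add: w_def)
      (auto simp: algebra_simps simp del: index_mult_mat(1) intro!: eq_matI)
  qed
  define g1 where "g1 = K r (\<tau> \<nu>) * g"
  have gM: "g \<in> M" using g(1) by (rule GL_carrier)
  have g1: "g1 \<in> GL n" using g \<tau>M by (simp add: g1_def GL_mult)
  have g1e: "g1 = c + pw ^ r \<cdot>\<^sub>m a + (pw ^ r \<cdot>\<^sub>m (\<tau> \<nu> * c) + pw ^ (2 * r) \<cdot>\<^sub>m (\<tau> \<nu> * a))"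
    using \<tau>M c a by (simp add: g1_def g(2) K_def mat_simps)
      (auto simp: algebra_simps simp del: index_mult_mat(1) intro!: eq_matI)
  have "g * K r \<nu> = c + pw ^ r \<cdot>\<^sub>m a + (pw ^ r \<cdot>\<^sub>m (c * \<nu>) + pw ^ (2 * r) \<cdot>\<^sub>m (a * \<nu>))"
    using \<nu>M c a by (simp add: g(2) K_def mat_simps)
  also have "\<dots> = g1 + pw ^ m \<cdot>\<^sub>m z"
    unfolding g1e pz using \<nu>M \<tau>M c a by (intro eq_matI) (auto simp: algebra_simps simp del: index_mult_mat(1))
  finally have gK: "g * K r \<nu> = g1 + pw ^ m \<cdot>\<^sub>m z" .
  have g1c: "pw ^ m \<cdot>\<^sub>m (g1 - c) = 0\<^sub>m n n"
  proof -
    have "g1 - c = pw ^ r \<cdot>\<^sub>m (a + \<tau> \<nu> * c) + pw ^ (2 * r) \<cdot>\<^sub>m (\<tau> \<nu> * a)"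
      unfolding g1e using \<tau>M c a by (intro eq_matI) (auto simp: algebra_simps simp del: index_mult_mat(1))
    then show ?thesis using \<tau>M c a by (simp add: mat_simps zero_smult_mat[of _ n n])
  qed
  have t: "pw ^ m * tr (X * (c' * z)) = pw ^ (2 * r) * tr (((\<nu> * c') * X - X * (\<nu> * c')) * a)"
  proof -
    have "pw ^ m * tr (X * (c' * z)) = tr (X * (c' * (pw ^ m \<cdot>\<^sub>m z)))"
      using c z by (simp add: mult_smult_distrib[of _ n n _ n] mat_trace_smult[of _ n])
    also have "\<dots> = pw ^ r * tr (X * \<nu>) - pw ^ r * tr (X * (c' * (\<tau> \<nu> * c)))
        + pw ^ (2 * r) * tr (X * (c' * (a * \<nu>))) - pw ^ (2 * r) * tr (X * (c' * (\<tau> \<nu> * a)))"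
      unfolding pz using c(1,2) a \<nu>M \<tau>M by (simp add: mat_simps trace_simps cancel)
    also have "tr (X * (c' * (\<tau> \<nu> * c))) = tr (X * \<nu>)"
    proof -
      have "tr (X * (c' * (\<tau> \<nu> * c))) = tr ((X * (c' * \<tau> \<nu>)) * c)" using c(1,2) \<tau>M by (simp add: mat_simps)
      also have "\<dots> = tr (c * (X * (c' * \<tau> \<nu>)))" using c(1,2) \<tau>M by (intro mat_trace_comm) auto
      also have "X * (c' * \<tau> \<nu>) = c' * (X * \<tau> \<nu>)" using swap \<tau>M by simp
      also have "c * (c' * (X * \<tau> \<nu>)) = X * \<tau> \<nu>" using cancel \<tau>M by simp
      finally show ?thesis using tr_\<tau>_X[OF \<nu>M] by simp
    qed
    also have "tr (X * (c' * (a * \<nu>))) = tr (((\<nu> * c') * X) * a)"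
    proof -
      have "tr (X * (c' * (a * \<nu>))) = tr ((X * (c' * a)) * \<nu>)" using c(1,2) a \<nu>M by (simp add: mat_simps)
      also have "\<dots> = tr (\<nu> * (X * (c' * a)))" using c(1,2) a \<nu>M by (intro mat_trace_comm) auto
      also have "X * (c' * a) = c' * (X * a)" using swap a by simp
      finally show ?thesis using c(1,2) a \<nu>M by (simp add: mat_simps)
    qed
    also have "pw ^ (2 * r) * tr (X * (c' * (\<tau> \<nu> * a))) = pw ^ (2 * r) * tr ((X * (\<nu> * c')) * a)"
    proof -
      have "pw ^ (2 * r) \<cdot>\<^sub>m \<tau> \<nu> = (pw ^ (2 * r) \<cdot>\<^sub>m (\<tau> \<nu> * c)) * c'"
        using c(1,2) \<tau>M by (simp add: mat_simps c(4))
      also have "\<dots> = pw ^ (2 * r) \<cdot>\<^sub>m (c * (\<nu> * c'))" unfolding \<nu>(2)[symmetric] using c(1,2) \<nu>M by (simp add: mat_simps)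
      finally have e: "pw ^ (2 * r) \<cdot>\<^sub>m \<tau> \<nu> = pw ^ (2 * r) \<cdot>\<^sub>m (c * (\<nu> * c'))" .
      have "pw ^ (2 * r) * tr (X * (c' * (\<tau> \<nu> * a))) = tr (X * (c' * ((pw ^ (2 * r) \<cdot>\<^sub>m \<tau> \<nu>) * a)))"
        using c(1,2) \<tau>M a by (simp add: mat_simps trace_simps)
      also have "\<dots> = pw ^ (2 * r) * tr (X * (c' * (c * (\<nu> * (c' * a)))))"
        unfolding e using c(1,2) \<nu>M a by (simp add: mat_simps trace_simps)
      also have "c' * (c * (\<nu> * (c' * a))) = \<nu> * (c' * a)" using cancel c(2) \<nu>M a by simp
      finally show ?thesis using c(2) \<nu>M a by (simp add: mat_simps)
    qed
    finally show ?thesis using c(2) \<nu>M a by (simp add: minus_mult_distrib_mat[of _ n n _ _ n] mat_trace_diff[of _ n] right_diff_distrib)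
  qed
  define x where "x = \<phi> (pw ^ (2 * r) * tr (((\<nu> * c') * X - X * (\<nu> * c')) * a))"
  have i: "(\<nu>, 0\<^sub>m n n) \<in> I" "(\<tau> \<nu>, 0\<^sub>m n n) \<in> I" using \<nu> \<tau>N by auto
  have "F (g * K r \<nu>) = \<phi> (pw ^ r * tr (X * \<nu>)) \<cdot>\<^sub>m F g"
    using F_right[OF g(1) i(1)] \<nu> by (simp add: b_K wt_K)
  moreover have "F (g * K r \<nu>) = x \<cdot>\<^sub>m F g1"
    unfolding gK x_def t[symmetric] by (rule F_shift[OF g1 c(1-4) g1c z])
  moreover have "F g1 = \<phi> (pw ^ r * tr (X * \<nu>)) \<cdot>\<^sub>m F g"
    using F_left[OF g(1) i(2)] \<tau>N tr_\<tau>_X[OF \<nu>M] by (simp add: g1_def b_K wt_K)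
  ultimately have "(x * \<phi> (pw ^ r * tr (X * \<nu>))) \<cdot>\<^sub>m F g = \<phi> (pw ^ r * tr (X * \<nu>)) \<cdot>\<^sub>m F g"
    by (simp add: smult_smult_mat)
  then have "x * \<phi> (pw ^ r * tr (X * \<nu>)) = \<phi> (pw ^ r * tr (X * \<nu>))"
    by (rule smult_mat_cancel[OF F_carrier[OF g(1)] _ nz])
  then show ?thesis by (simp add: x_def)
qed

text \<open>Write \<open>g = c + p\<^sup>r a\<close> with \<open>c\<close> in the centralizer of \<open>X\<close>. The claim is that \<open>a\<close> lies in the sum \<open>T\<close> of
  \<open>c N\<close>, the \<open>\<tau>\<close>-symmetric matrices and the matrices killed by \<open>p\<^bsup>2r\<^esup>\<close>. As \<open>T\<close> contains the radical of the
  alternating form \<open>\<beta>\<close>, it is its own double complement, and every element of its complement agrees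
  modulo the radical with some \<open>\<nu> c\<inverse>\<close> as in \<open>F_orthogonality\<close>.\<close>

lemma F_support_decomposition:
  assumes g: "g \<in> GL n" and nz: "F g \<noteq> 0\<^sub>m d d"
  shows "\<exists>c\<in>M. \<exists>c'\<in>M. \<exists>\<nu>\<in>N. \<exists>h\<in>M. \<exists>z\<in>M. c' * c = 1\<^sub>m n \<and> c * c' = 1\<^sub>m n \<and> c * X = X * c \<and> c' * X = X * c' \<and>
    \<tau> h = h \<and> g = (c + pw ^ r \<cdot>\<^sub>m h) * K r \<nu> + pw ^ m \<cdot>\<^sub>m z"
proof -
  have gM: "g \<in> M" using g by (rule GL_carrier)
  obtain c where c: "c \<in> M" "c * X = X * c" "pw ^ m \<cdot>\<^sub>m (g - c) = 0\<^sub>m n n"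
    using commuting_approximation[OF companion gM F_support[OF g nz]] by blast
  have "g - c \<in> M" using c by simp
  then obtain a where a: "a \<in> M" "g - c = pw ^ (l - m) \<cdot>\<^sub>m a"
    using pw_smult_eq_0D[OF _ c(3)] r_m by blast
  have lm: "l - m = r" using r_m by simp
  have ga: "g = c + pw ^ r \<cdot>\<^sub>m a"
  proof -
    have "g = c + (g - c)" using c gM by (intro eq_matI) auto
    then show ?thesis using a(2) lm by simp
  qed
  have cGL: "c \<in> GL n" using g ga GL_perturb[OF c(1) a(1), of r] by simp
  obtain c' where c': "c' \<in> GL n" "c' * c = 1\<^sub>m n" "c * c' = 1\<^sub>m n" using GL_inverse[OF cGL] by blast
  have c'M: "c' \<in> M" using c' GL_carrier by auto
  have c'X: "c' * X = X * c'"
  proof -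
    have "c' * X = (c' * X) * (c * c')" using c'M by (simp add: c')
    also have "\<dots> = c' * (X * c) * c'" using c c'M by (simp add: mat_simps)
    also have "\<dots> = (c' * c) * (X * c')" unfolding c(2)[symmetric] using c(1) c'M by (simp add: mat_simps del: c(2))
    finally show ?thesis using c'M by (simp add: c')
  qed
  define T where "T = {c * \<nu> + h + j | \<nu> h j. \<nu> \<in> N \<and> h \<in> M \<and> \<tau> h = h \<and> j \<in> M \<and> pw ^ (2 * r) \<cdot>\<^sub>m j = 0\<^sub>m n n}"
  have T_I: "c * \<nu> + h + j \<in> T" if "\<nu> \<in> N" "h \<in> M" "\<tau> h = h" "j \<in> M" "pw ^ (2 * r) \<cdot>\<^sub>m j = 0\<^sub>m n n" for \<nu> h j
    using that unfolding T_def by blast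
  have zero: "c * 0\<^sub>m n n = 0\<^sub>m n n" "\<tau> (0\<^sub>m n n) = 0\<^sub>m n n" "pw ^ (2 * r) \<cdot>\<^sub>m 0\<^sub>m n n = 0\<^sub>m n n"
    using c(1) by (auto simp: \<tau>_def)
  have T_sym: "h \<in> T" if "h \<in> M" "\<tau> h = h" for h
    using T_I[OF strict_upper_zero that zero_carrier_mat zero(3)] that c(1) by (simp add: zero)
  have T_cN: "c * \<nu> \<in> T" if "\<nu> \<in> N" for \<nu>
    using T_I[OF that zero_carrier_mat zero(2) zero_carrier_mat zero(3)] that c(1) N_M[OF that] by simp
  define \<beta> where "\<beta> a b = \<phi> (pw ^ (2 * r) * tr ((b * X - X * b) * a))" for a b
  have "a \<in> T"
  proof (rule orthogonal_complement_involutive[where A = M and add = "(+)" and \<beta> = \<beta> and z = "0\<^sub>m n n"])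
    show "finite M" by simp
    show "x + y \<in> M" if "x \<in> M" "y \<in> M" for x y using that by simp
    show "inj_on ((+) x) M" if "x \<in> M" for x
      using add_mat_cancel[OF that] by (intro inj_onI) blast
    show "\<beta> (x + y) b = \<beta> x b * \<beta> y b" if "x \<in> M" "y \<in> M" "b \<in> M" for x y b
      using that by (simp add: \<beta>_def mult_add_distrib_mat[of _ n n _ n] mat_trace_add[of _ n] distrib_left \<phi>_add)
    show "\<beta> b (x + y) = \<beta> b x * \<beta> b y" if "x \<in> M" "y \<in> M" "b \<in> M" for x y b
    proof -
      have "(x + y) * X - X * (x + y) = (x * X - X * x) + (y * X - X * y)"
        using that by (simp add: add_mult_distrib_mat[of _ n n _ _ n] mult_add_distrib_mat[of _ n n _ n])
          (auto simp: algebra_simps simp del: index_mult_mat(1) intro!: eq_matI)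
      then show ?thesis using that
        by (simp add: \<beta>_def add_mult_distrib_mat[of _ n n _ _ n] mat_trace_add[of _ n] distrib_left \<phi>_add)
    qed
    show "\<beta> x (0\<^sub>m n n) = 1" if "x \<in> M" for x
    proof -
      have "0\<^sub>m n n * X - X * 0\<^sub>m n n = 0\<^sub>m n n" by auto
      then show ?thesis unfolding \<beta>_def using that by (simp only:) (simp add: mat_trace_def)
    qed
    show "T \<subseteq> M" using c(1) by (auto simp: T_def N_M)
    show "x + y \<in> T" if "x \<in> T" "y \<in> T" for x y
    proof -
      obtain \<nu> h j \<nu>' h' j' where x: "x = c * \<nu> + h + j" "\<nu> \<in> N" "h \<in> M" "\<tau> h = h" "j \<in> M" "pw ^ (2 * r) \<cdot>\<^sub>m j = 0\<^sub>m n n"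
        and y: "y = c * \<nu>' + h' + j'" "\<nu>' \<in> N" "h' \<in> M" "\<tau> h' = h'" "j' \<in> M" "pw ^ (2 * r) \<cdot>\<^sub>m j' = 0\<^sub>m n n"
        using \<open>x \<in> T\<close> \<open>y \<in> T\<close> unfolding T_def by blast
      have "c * (\<nu> + \<nu>') + (h + h') + (j + j') \<in> T"
        using x y by (intro T_I strict_upper_add) (auto simp: \<tau>_add add_smult_distrib_left_mat[of _ n n])
      moreover have "c * (\<nu> + \<nu>') + (h + h') + (j + j') = x + y"
        unfolding x(1) y(1) using c(1) x y N_M[OF x(2)] N_M[OF y(2)]
        by (simp add: mult_add_distrib_mat[of _ n n _ n])
          (auto simp: algebra_simps simp del: index_mult_mat(1) intro!: eq_matI)
      ultimately show ?thesis by simp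
    qed
    show "x \<in> T" if x: "x \<in> M" and rad: "\<And>b. b \<in> M \<Longrightarrow> \<beta> x b = 1" for x
    proof -
      have "pw ^ (2 * r) \<cdot>\<^sub>m (X * x - x * X) = 0\<^sub>m n n"
      proof (rule trace_nondegenerate)
        fix b assume b: "b \<in> M"
        have "tr ((b * X - X * b) * x) = tr (b * (X * x)) - tr (X * (b * x))"
          using b x by (simp add: mat_simps trace_simps)
        also have "tr (b * (X * x)) = tr ((X * x) * b)" using b x by (intro mat_trace_comm) auto
        also have "tr (X * (b * x)) = tr ((X * b) * x)" using b x by (simp add: mat_simps)
        also have "\<dots> = tr (x * (X * b))" using b x by (intro mat_trace_comm) auto
        finally have "tr ((b * X - X * b) * x) = tr ((X * x - x * X) * b)"
          using b x by (simp add: mat_simps trace_simps)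
        then show "\<phi> (pw ^ (2 * r) * tr ((X * x - x * X) * b)) = 1" using rad[OF b] by (simp add: \<beta>_def)
      qed (use x in simp)
      then have "pw ^ (2 * r) \<cdot>\<^sub>m (x * X - X * x) = 0\<^sub>m n n"
        using x by (subst smult_mat_eq_iff[symmetric], simp, simp, subst (asm) smult_mat_eq_iff[symmetric]) auto
      then obtain s where s: "s \<in> M" "s * X = X * s" "pw ^ (2 * r) \<cdot>\<^sub>m (x - s) = 0\<^sub>m n n"
        using commuting_approximation[OF companion x] by blast
      have "c * 0\<^sub>m n n + s + (x - s) \<in> T" using s x strict_upper_zero by (intro T_I) (auto simp: \<tau>_commuting)
      moreover have "c * 0\<^sub>m n n + s + (x - s) = x" using c(1) s x by (auto simp: zero intro!: eq_matI)
      ultimately show ?thesis by simp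
    qed
    show "\<beta> a b = 1" if b: "b \<in> M" and perp: "\<And>s. s \<in> T \<Longrightarrow> \<beta> s b = 1" for b
    proof -
      have \<tau>b: "pw ^ (2 * r) \<cdot>\<^sub>m \<tau> b = pw ^ (2 * r) \<cdot>\<^sub>m b"
        using perp[OF T_sym] by (intro \<tau>_fixed_if_orthogonal[OF b]) (simp add: \<beta>_def)
      have bc: "b * c \<in> M" using b c by simp
      have bcX: "(b * X - X * b) * c = b * c * X - X * (b * c)" using b c(1,2) by (simp add: mat_simps)
      have "pw ^ (2 * r) * (b * c * X - X * (b * c)) $$ (i, j) = 0" if "i < n" "j < i" for i j
      proof (rule lower_entries_eq_0[OF _ _ that])
        fix \<nu> assume \<nu>: "\<nu> \<in> N"
        have "(b * X - X * b) * (c * \<nu>) = ((b * X - X * b) * c) * \<nu>"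
          using b c(1) N_M[OF \<nu>] by (intro assoc_mult_mat[symmetric]) auto
        then show "\<phi> (pw ^ (2 * r) * tr ((b * c * X - X * (b * c)) * \<nu>)) = 1"
          using perp[OF T_cN[OF \<nu>]] by (simp add: \<beta>_def bcX)
      qed (use bc in simp)
      then obtain \<nu> s where \<nu>: "\<nu> \<in> N" and s: "s \<in> M" "s * X = X * s"
          and eq: "pw ^ (2 * r) \<cdot>\<^sub>m (b * c - \<nu> - s) = 0\<^sub>m n n"
        using commutator_lower_zero[OF companion bc, of "pw ^ (2 * r)"] by blast
      note \<nu>M = N_M[OF \<nu>]
      let ?p = "pw ^ (2 * r)"
      have eq\<nu>: "?p \<cdot>\<^sub>m \<nu> = ?p \<cdot>\<^sub>m (b * c - s)"
      proof -
        have "?p \<cdot>\<^sub>m (b * c - s - \<nu>) = 0\<^sub>m n n"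
        proof -
          have "b * c - s - \<nu> = b * c - \<nu> - s" using bc s \<nu>M by (intro eq_matI) (auto simp del: index_mult_mat(1))
          then show ?thesis using eq by simp
        qed
        then have "?p \<cdot>\<^sub>m (b * c - s) = ?p \<cdot>\<^sub>m \<nu>" using bc s \<nu>M by (subst smult_mat_eq_iff) auto
        then show ?thesis by simp
      qed
      have cs: "c * s = s * c" by (rule commuting_comm[OF c(1) s(1) c(2) s(2)])
      have \<tau>c: "\<tau> c = c" and \<tau>s: "\<tau> s = s" using \<tau>_commuting c s by auto
      have D: "?p \<cdot>\<^sub>m (c * \<nu>) = ?p \<cdot>\<^sub>m (\<tau> \<nu> * c)"
      proof -
        have "?p \<cdot>\<^sub>m \<tau> \<nu> = \<tau> (?p \<cdot>\<^sub>m \<nu>)" using \<nu>M by (simp add: \<tau>_smult)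
        also have "\<dots> = ?p \<cdot>\<^sub>m (c * \<tau> b - s)" unfolding eq\<nu> using b c(1) s(1) by (simp add: \<tau>_smult \<tau>_diff \<tau>_mult \<tau>c \<tau>s)
        also have "\<dots> = c * (?p \<cdot>\<^sub>m \<tau> b) - ?p \<cdot>\<^sub>m s" using b c(1) s(1) by (simp add: mat_simps)
        also have "\<dots> = ?p \<cdot>\<^sub>m (c * b - s)" unfolding \<tau>b using b c(1) s(1) by (simp add: mat_simps)
        finally have 1: "?p \<cdot>\<^sub>m \<tau> \<nu> = ?p \<cdot>\<^sub>m (c * b - s)" .
        have "?p \<cdot>\<^sub>m (\<tau> \<nu> * c) = (?p \<cdot>\<^sub>m \<tau> \<nu>) * c" using \<nu>M c(1) by (simp add: mat_simps)
        also have "\<dots> = ?p \<cdot>\<^sub>m (c * (b * c)) - ?p \<cdot>\<^sub>m (c * s)" unfolding 1 cs using b c(1) s(1) by (simp add: mat_simps)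
        also have "\<dots> = c * (?p \<cdot>\<^sub>m (b * c - s))" using b c(1) s(1) by (simp add: mat_simps)
        also have "\<dots> = ?p \<cdot>\<^sub>m (c * \<nu>)" unfolding eq\<nu>[symmetric] using \<nu>M c(1) by (simp add: mat_simps)
        finally show ?thesis by simp
      qed
      have one: "\<phi> (?p * tr (((\<nu> * c') * X - X * (\<nu> * c')) * a)) = 1"
        by (rule F_orthogonality[OF g ga a(1) c(1) c'M c'(2,3) c(2) c'X \<nu> D nz])
      have "?p * tr ((b * X - X * b) * a) = ?p * tr (((\<nu> * c') * X - X * (\<nu> * c')) * a)"
      proof -
        have sc': "s * c' * X = X * (s * c')" 
        proof -
          have "s * c' * X = s * (X * c')" using s(1) c'M by (simp add: sq_simps c'X)
          also have "\<dots> = (s * X) * c'" using s(1) c'M by (intro assoc_mult_mat[symmetric]) auto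
          also have "\<dots> = X * (s * c')" unfolding s(2) using s(1) c'M by (intro assoc_mult_mat) auto
          finally show ?thesis .
        qed
        have pb: "?p \<cdot>\<^sub>m (\<nu> * c') = ?p \<cdot>\<^sub>m (b - s * c')"
        proof -
          have "?p \<cdot>\<^sub>m (\<nu> * c') = (?p \<cdot>\<^sub>m \<nu>) * c'" using \<nu>M c'M by (simp add: mat_simps)
          also have "\<dots> = ?p \<cdot>\<^sub>m b - ?p \<cdot>\<^sub>m (s * c')" unfolding eq\<nu> using b c(1) s(1) c'M by (simp add: mat_simps c')
          finally show ?thesis using b s(1) c'M by (simp add: smult_diff_mat[of _ n n])
        qed
        have "?p * tr (((\<nu> * c') * X - X * (\<nu> * c')) * a) = tr (((?p \<cdot>\<^sub>m (\<nu> * c')) * X - X * (?p \<cdot>\<^sub>m (\<nu> * c'))) * a)"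
          using \<nu>M c'M a(1) by (simp add: mat_simps trace_simps right_diff_distrib)
        also have "\<dots> = ?p * tr (((b - s * c') * X - X * (b - s * c')) * a)"
          unfolding pb using b s(1) c'M a(1) by (simp add: mat_simps trace_simps right_diff_distrib)
        also have "(b - s * c') * X - X * (b - s * c') = b * X - X * b"
          by (rule commuting_diff) (use b s(1) c'M sc' in auto)
        finally show ?thesis by simp
      qed
      then show ?thesis using one by (simp add: \<beta>_def)
    qed
  qed (use a in auto)
  then obtain \<nu> h j where d: "a = c * \<nu> + h + j" "\<nu> \<in> N" "h \<in> M" "\<tau> h = h" "j \<in> M" "pw ^ (2 * r) \<cdot>\<^sub>m j = 0\<^sub>m n n"
    unfolding T_def by blast
  note \<nu>M = N_M[OF d(2)]
  obtain z0 where z0: "z0 \<in> M" "pw ^ r \<cdot>\<^sub>m j = pw ^ m \<cdot>\<^sub>m z0" using pw_r_smult_shift[OF d(5,6)] by blast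
  define z where "z = z0 - pw ^ (2 * r - m) \<cdot>\<^sub>m (h * \<nu>)"
  have z: "z \<in> M" using d \<nu>M by (simp add: z_def)
  have pz: "pw ^ m \<cdot>\<^sub>m z = pw ^ r \<cdot>\<^sub>m j - pw ^ (2 * r) \<cdot>\<^sub>m (h * \<nu>)"
    using z0 d \<nu>M by (simp add: z_def mat_simps)
  have "(c + pw ^ r \<cdot>\<^sub>m h) * K r \<nu> = c + pw ^ r \<cdot>\<^sub>m h + (pw ^ r \<cdot>\<^sub>m (c * \<nu>) + pw ^ (2 * r) \<cdot>\<^sub>m (h * \<nu>))"
    using c(1) d(3) \<nu>M by (simp add: K_def mat_simps)
  then have "(c + pw ^ r \<cdot>\<^sub>m h) * K r \<nu> + pw ^ m \<cdot>\<^sub>m z = c + pw ^ r \<cdot>\<^sub>m (c * \<nu> + h + j)"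
    unfolding pz using c(1) d(3,5) \<nu>M by (simp only:) (auto simp: algebra_simps simp del: index_mult_mat(1) intro!: eq_matI)
  then have "g = (c + pw ^ r \<cdot>\<^sub>m h) * K r \<nu> + pw ^ m \<cdot>\<^sub>m z" using ga d(1) by simp
  then show ?thesis using c(1,2) c'M c'(2,3) c'X d z by blast
qed

end

context companion_rep
begin

lemma F_\<tau>_if_nonzero:
  assumes g: "g \<in> GL n" and nz: "F g \<noteq> 0\<^sub>m d d"
  shows "F (\<tau> g) = F g"
proof -
  obtain c c' \<nu> h z where c: "c \<in> M" "c' \<in> M" "c' * c = 1\<^sub>m n" "c * c' = 1\<^sub>m n" "c * X = X * c" "c' * X = X * c'"
    and \<nu>: "\<nu> \<in> N" and h: "h \<in> M" "\<tau> h = h" and z: "z \<in> M" and ge: "g = (c + pw ^ r \<cdot>\<^sub>m h) * K r \<nu> + pw ^ m \<cdot>\<^sub>m z"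
    using F_support_decomposition[OF g nz] by blast
  note \<nu>M = N_M[OF \<nu>]
  have \<tau>N: "\<tau> \<nu> \<in> N" and \<tau>M: "\<tau> \<nu> \<in> M" using \<tau>_strict_upper[OF \<nu>] N_M by auto
  have cGL: "c \<in> GL n"
    using det_mult[OF c(2,1)] c(1,3) by (simp add: GL_def) (metis dvd_triv_right)
  define g1 where "g1 = c + pw ^ r \<cdot>\<^sub>m h"
  have g1: "g1 \<in> GL n" "g1 \<in> M" using cGL c(1) h by (auto simp: g1_def GL_perturb)
  have \<tau>g1: "\<tau> g1 = g1" using c h by (simp add: g1_def \<tau>_add \<tau>_smult \<tau>_commuting)
  have \<tau>K: "\<tau> (K r \<nu>) = K r (\<tau> \<nu>)" using \<nu>M by (simp add: K_def \<tau>_add \<tau>_smult)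
  have \<tau>g: "\<tau> g = K r (\<tau> \<nu>) * g1 + pw ^ m \<cdot>\<^sub>m \<tau> z"
    unfolding ge g1_def[symmetric] using g1 \<nu>M z by (simp add: \<tau>_add \<tau>_smult \<tau>_mult \<tau>g1 \<tau>K)
  have i: "(\<nu>, 0\<^sub>m n n) \<in> I" "(\<tau> \<nu>, 0\<^sub>m n n) \<in> I" using \<nu> \<tau>N by auto
  let ?t = "\<phi> (pw ^ r * tr (X * \<nu>))"
  have F1: "F (g1 * K r \<nu>) = ?t \<cdot>\<^sub>m F g1" using F_right[OF g1(1) i(1)] \<nu> by (simp add: b_K wt_K)
  have F2: "F (K r (\<tau> \<nu>) * g1) = ?t \<cdot>\<^sub>m F g1" using F_left[OF g1(1) i(2)] \<tau>N tr_\<tau>_X[OF \<nu>M] by (simp add: b_K wt_K)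
  have near: "pw ^ m \<cdot>\<^sub>m (g1 * K r \<nu> - c) = 0\<^sub>m n n" "pw ^ m \<cdot>\<^sub>m (K r (\<tau> \<nu>) * g1 - c) = 0\<^sub>m n n"
  proof -
    have "g1 * K r \<nu> - c = pw ^ r \<cdot>\<^sub>m (h + g1 * \<nu>)" using c(1) h(1) g1(2) \<nu>M
      by (simp add: K_def mat_simps) (auto simp: g1_def algebra_simps simp del: index_mult_mat(1) intro!: eq_matI)
    then show "pw ^ m \<cdot>\<^sub>m (g1 * K r \<nu> - c) = 0\<^sub>m n n" using h g1 \<nu>M by (simp add: smult_smult_mat zero_smult_mat[of _ n n])
    have "K r (\<tau> \<nu>) * g1 - c = pw ^ r \<cdot>\<^sub>m (h + \<tau> \<nu> * g1)" using c(1) h(1) g1(2) \<tau>M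
      by (simp add: K_def mat_simps) (auto simp: g1_def algebra_simps simp del: index_mult_mat(1) intro!: eq_matI)
    then show "pw ^ m \<cdot>\<^sub>m (K r (\<tau> \<nu>) * g1 - c) = 0\<^sub>m n n" using h g1 \<tau>M by (simp add: smult_smult_mat zero_smult_mat[of _ n n])
  qed
  have "F g = \<phi> (pw ^ m * tr (X * (c' * z))) \<cdot>\<^sub>m (?t \<cdot>\<^sub>m F g1)"
    unfolding ge g1_def[symmetric] F1[symmetric]
    by (rule F_shift[OF _ c(1-4) near(1) z]) (use g1 \<nu>M in \<open>simp add: GL_mult\<close>)
  moreover have "F (\<tau> g) = \<phi> (pw ^ m * tr (X * (c' * \<tau> z))) \<cdot>\<^sub>m (?t \<cdot>\<^sub>m F g1)"
    unfolding \<tau>g F2[symmetric]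
    by (rule F_shift[OF _ c(1-4) near(2)]) (use g1 \<tau>M z in \<open>simp_all add: GL_mult\<close>)
  moreover have "tr (X * (c' * \<tau> z)) = tr (X * (c' * z))"
  proof -
    have "X * (c' * \<tau> z) = X * \<tau> (z * c')" using c z \<tau>_commuting[OF c(2,6)] by (simp add: \<tau>_mult)
    then have "tr (X * (c' * \<tau> z)) = tr (X * (z * c'))" using tr_\<tau>_X[of "z * c'"] c z by simp
    also have "\<dots> = tr ((X * z) * c')" using c z by (simp add: mat_simps)
    also have "\<dots> = tr (c' * (X * z))" using c z by (intro mat_trace_comm) auto
    also have "c' * (X * z) = (X * c') * z" unfolding c(6)[symmetric] using c(2) z by (intro assoc_mult_mat[symmetric]) auto
    finally show ?thesis using c(2) z by (simp add: mat_simps)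
  qed
  ultimately show ?thesis by simp
qed

lemma F_\<tau>:
  assumes g: "g \<in> GL n"
  shows "F (\<tau> g) = F g"
proof (cases "F g = 0\<^sub>m d d")
  case True
  show ?thesis
  proof (cases "F (\<tau> g) = 0\<^sub>m d d")
    case False
    then have "F (\<tau> (\<tau> g)) = F (\<tau> g)" by (intro F_\<tau>_if_nonzero \<tau>_GL g)
    then show ?thesis using GL_carrier[OF g] by simp
  qed (simp add: True)
qed (intro F_\<tau>_if_nonzero g)

lemma F_mult:
  assumes g: "g \<in> GL n" and h: "h \<in> GL n"
  shows "F g * F h = msum d (\<lambda>i. of_nat (card I) \<cdot>\<^sub>m (\<phi> (- wt i) \<cdot>\<^sub>m F (g * b i * h))) I"
proof -
  have "F g * F h = (E0 * \<rho> g) * (E0 * E0) * (\<rho> h * E0)" using g h by (simp add: F_def rep_simps)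
  also have "\<dots> = (E0 * \<rho> g) * ((of_nat (card I) \<cdot>\<^sub>m E0) * (\<rho> h * E0))" using g h by (simp add: E0_E0 rep_simps)
  also have "\<dots> = of_nat (card I) \<cdot>\<^sub>m ((E0 * \<rho> g) * (E0 * (\<rho> h * E0)))" using g h by (simp add: rep_simps)
  also have "E0 * (\<rho> h * E0) = msum d (\<lambda>i. (\<phi> (- wt i) \<cdot>\<^sub>m \<rho> (b i)) * (\<rho> h * E0)) I"
    by (subst (1) E0_def, rule msum_mult) (use h in auto)
  also have "(E0 * \<rho> g) * \<dots> = msum d (\<lambda>i. (E0 * \<rho> g) * ((\<phi> (- wt i) \<cdot>\<^sub>m \<rho> (b i)) * (\<rho> h * E0))) I"
    by (rule mult_msum) (use g h in auto)
  also have "\<dots> = msum d (\<lambda>i. \<phi> (- wt i) \<cdot>\<^sub>m F (g * b i * h)) I"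
    by (rule msum_cong) (use g h in \<open>simp add: F_def \<rho>_mult GL_mult rep_simps\<close>)
  also have "of_nat (card I) \<cdot>\<^sub>m \<dots> = msum d (\<lambda>i. of_nat (card I) \<cdot>\<^sub>m (\<phi> (- wt i) \<cdot>\<^sub>m F (g * b i * h))) I"
    by (rule smult_msum) (use g h in \<open>simp add: F_carrier GL_mult\<close>)
  finally show ?thesis .
qed

lemma F_commute:
  assumes g: "g \<in> GL n" and h: "h \<in> GL n"
  shows "F g * F h = F h * F g"
proof -
  define \<tau>2 where "\<tau>2 = (\<lambda>(\<nu>, y). (\<tau> \<nu>, \<tau> y))"
  have I: "\<tau>2 i \<in> I" if "i \<in> I" for i using that by (auto simp: \<tau>2_def \<tau>_strict_upper)
  have inv: "\<tau>2 (\<tau>2 i) = i" if "i \<in> I" for i using that N_M by (auto simp: \<tau>2_def)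
  have bij: "bij_betw \<tau>2 I I"
  proof (rule bij_betw_byWitness[of _ \<tau>2])
    show "\<forall>i\<in>I. \<tau>2 (\<tau>2 i) = i" "\<forall>i\<in>I. \<tau>2 (\<tau>2 i) = i" using inv by blast+
    show "\<tau>2 ` I \<subseteq> I" "\<tau>2 ` I \<subseteq> I" by (intro image_subsetI I; assumption)+
  qed
  have wt: "wt (\<tau>2 i) = wt i" if "i \<in> I" for i using that N_M by (auto simp: \<tau>2_def wt_def tr_\<tau>_X)
  have \<tau>b: "\<tau> (b i) = b (\<tau>2 i)" if "i \<in> I" for i using that N_M by (auto simp: \<tau>2_def b_def \<tau>_add \<tau>_smult)
  have "F g * F h = msum d (\<lambda>i. of_nat (card I) \<cdot>\<^sub>m (\<phi> (- wt (\<tau>2 i)) \<cdot>\<^sub>m F (\<tau> h * b (\<tau>2 i) * \<tau> g))) I"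
    unfolding F_mult[OF g h]
  proof (rule msum_cong)
    fix i assume i: "i \<in> I"
    have bM: "b i \<in> M" using b_GL[OF i] by (rule GL_carrier)
    have gh: "g \<in> M" "h \<in> M" using g h GL_carrier by auto
    have "F (g * b i * h) = F (\<tau> (g * b i * h))" using F_\<tau>[of "g * b i * h"] g h i by (simp add: GL_mult)
    also have "\<tau> (g * b i * h) = \<tau> h * b (\<tau>2 i) * \<tau> g" using gh bM i by (simp add: \<tau>_mult \<tau>b mat_simps carrier_matD[OF GL_carrier[OF b_GL[OF I[OF i]]]] GL_carrier[OF b_GL[OF I[OF i]]])
    finally show "of_nat (card I) \<cdot>\<^sub>m (\<phi> (- wt i) \<cdot>\<^sub>m F (g * b i * h)) =
        of_nat (card I) \<cdot>\<^sub>m (\<phi> (- wt (\<tau>2 i)) \<cdot>\<^sub>m F (\<tau> h * b (\<tau>2 i) * \<tau> g))" by (simp add: wt[OF i])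
  qed
  also have "\<dots> = F (\<tau> h) * F (\<tau> g)"
    unfolding F_mult[OF \<tau>_GL[OF h] \<tau>_GL[OF g]] by (rule msum_reindex[OF bij, symmetric])
  finally show ?thesis by (simp add: F_\<tau> g h)
qed

lemma E0_rank_le_1: "\<exists>w\<in>carrier_vec d. \<forall>v\<in>carrier_vec d. \<exists>k. E0 *\<^sub>v v = k \<cdot>\<^sub>v w"
proof -
  define q :: complex where "q = of_nat (card I)"
  have q: "q \<noteq> 0" using card_I_pos unfolding q_def by (metis less_irrefl of_nat_eq_0_iff)
  define s where "s = 1 / q"
  have s: "s * q = 1" "s \<noteq> 0" using q by (auto simp: s_def)
  define E where "E = s \<cdot>\<^sub>m E0"
  have E: "E \<in> carrier_mat d d" by (simp add: E_def)
  have EE: "E * E = E" by (simp add: E_def rep_simps E0_E0[folded q_def] s)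
  have EgE: "E * \<rho> g * E = (s * s) \<cdot>\<^sub>m F g" if "g \<in> GL n" for g
    using that by (simp add: E_def F_def rep_simps)
  have "\<exists>w\<in>carrier_vec d. \<forall>v\<in>carrier_vec d. \<exists>k. E *\<^sub>v v = k \<cdot>\<^sub>v w"
  proof (rule corner_rank_le_1_if_commuting[OF irr GL_mult GL_one E EE])
    fix g h :: "'r mat" assume g: "g \<in> GL n" and h: "h \<in> GL n"
    have c: "F g \<in> carrier_mat d d" "F h \<in> carrier_mat d d" using g h by (auto intro: F_carrier)
    show "E * \<rho> g * E * (E * \<rho> h * E) = E * \<rho> h * E * (E * \<rho> g * E)"
      unfolding EgE[OF g] EgE[OF h] using c F_commute[OF g h] by (simp add: rep_simps)
  qed
  then obtain w where w: "w \<in> carrier_vec d" "\<And>v. v \<in> carrier_vec d \<Longrightarrow> \<exists>k. E *\<^sub>v v = k \<cdot>\<^sub>v w" by blast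
  have "\<exists>k. E0 *\<^sub>v v = k \<cdot>\<^sub>v w" if v: "v \<in> carrier_vec d" for v
  proof -
    obtain k where "E *\<^sub>v v = k \<cdot>\<^sub>v w" using w(2)[OF v] by blast
    moreover have "E *\<^sub>v v = s \<cdot>\<^sub>v (E0 *\<^sub>v v)" using v by (simp add: E_def smult_mat_mult_vec[of _ d d])
    ultimately have "q \<cdot>\<^sub>v (s \<cdot>\<^sub>v (E0 *\<^sub>v v)) = q \<cdot>\<^sub>v (k \<cdot>\<^sub>v w)" by simp
    then show ?thesis using s(1) by (auto simp: smult_smult_assoc mult.commute)
  qed
  then show ?thesis using w(1) by blast
qed

definition A :: "complex mat" where
  "A = msum d (\<lambda>\<nu>. \<phi> (- tr (X * \<nu>)) \<cdot>\<^sub>m \<rho> (K 0 \<nu>)) N"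

lemma A_carrier [simp]: "A \<in> carrier_mat d d" and A_dim [simp]: "dim_row A = d" "dim_col A = d"
  by (simp_all add: A_def)

lemma K_N_SL: "\<nu> \<in> N \<Longrightarrow> K k \<nu> \<in> SL n"
  by (simp add: K_def one_plus_strict_upper_SL strict_upper_smult)

lemma K_N_GL [simp]: "\<nu> \<in> N \<Longrightarrow> K k \<nu> \<in> GL n"
  using K_N_SL SL_subset_GL by blast

lemma A_right:
  assumes \<nu>: "\<nu> \<in> N"
  shows "A * \<rho> (K k \<nu>) = \<phi> (pw ^ k * tr (X * \<nu>)) \<cdot>\<^sub>m A"
proof -
  define \<xi> where "\<xi> = pw ^ k \<cdot>\<^sub>m \<nu>"
  have \<xi>: "\<xi> \<in> N" "\<xi> \<in> M" using strict_upper_smult[OF \<nu>] N_M by (auto simp: \<xi>_def)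
  have K\<xi>: "K k \<nu> = K 0 \<xi>" by (simp add: K_def \<xi>_def)
  have t: "pw ^ k * tr (X * \<nu>) = tr (X * \<xi>)" using N_M[OF \<nu>] by (simp add: \<xi>_def mat_simps trace_simps)
  define f where "f \<mu> = \<mu> + \<xi> + \<mu> * \<xi>" for \<mu>
  have f: "f \<mu> \<in> N" if "\<mu> \<in> N" for \<mu> using that \<xi> by (auto simp: f_def intro!: strict_upper_add strict_upper_mult)
  have Kf: "K 0 \<mu> * K 0 \<xi> = K 0 (f \<mu>)" if "\<mu> \<in> M" for \<mu>
    using that \<xi> by (simp add: K_mult f_def)
  have trf: "tr (X * f \<mu>) = tr (X * \<mu>) + tr (X * \<xi>)" if "\<mu> \<in> N" for \<mu>
    using N_M[OF that] \<xi> tr_X_strict_upper_mult[OF that \<xi>(1)]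
    by (simp add: f_def mult_add_distrib_mat[of _ n n _ n] mat_trace_add[of _ n])
  have "inj_on f N"
  proof (rule inj_onI)
    fix \<mu> \<mu>' assume \<mu>: "\<mu> \<in> N" "\<mu>' \<in> N" and eq: "f \<mu> = f \<mu>'"
    have c: "\<mu> \<in> M" "\<mu>' \<in> M" using \<mu> N_M by auto
    have f2: "f \<mu> = \<xi> + \<mu> * K 0 \<xi>" if "\<mu> \<in> M" for \<mu>
      using that \<xi> by (simp add: f_def K_def mat_simps)
        (auto simp: algebra_simps simp del: index_mult_mat(1) intro!: eq_matI)
    have "\<mu> * K 0 \<xi> = \<mu>' * K 0 \<xi>"
      using eq unfolding f2[OF c(1)] f2[OF c(2)]
      by (rule add_mat_cancel[of \<xi>, rotated 3]) (use c \<xi> in auto)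
    then show "\<mu> = \<mu>'" by (rule GL_cancel(2)[of "K 0 \<xi>", rotated 3]) (use c \<xi> in auto)
  qed
  moreover have "f ` N \<subseteq> N" using f by auto
  ultimately have bij: "bij_betw f N N" using endo_inj_surj[OF finite_N] by (simp add: bij_betw_def)
  have "A = msum d (\<lambda>\<mu>. \<phi> (- tr (X * f \<mu>)) \<cdot>\<^sub>m \<rho> (K 0 (f \<mu>))) N"
    unfolding A_def by (rule msum_reindex[OF bij])
  then have "\<phi> (tr (X * \<xi>)) \<cdot>\<^sub>m A = msum d (\<lambda>\<mu>. \<phi> (tr (X * \<xi>)) \<cdot>\<^sub>m (\<phi> (- tr (X * f \<mu>)) \<cdot>\<^sub>m \<rho> (K 0 (f \<mu>)))) N"
    by (simp only:) (rule smult_msum, use f in simp)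
  also have "\<dots> = msum d (\<lambda>\<mu>. (\<phi> (- tr (X * \<mu>)) \<cdot>\<^sub>m \<rho> (K 0 \<mu>)) * \<rho> (K 0 \<xi>)) N"
  proof (rule msum_cong)
    fix \<mu> assume \<mu>: "\<mu> \<in> N"
    have "\<phi> (tr (X * \<xi>)) * \<phi> (- tr (X * f \<mu>)) = \<phi> (- tr (X * \<mu>))" using trf[OF \<mu>] by (simp flip: \<phi>_add)
    then show "\<phi> (tr (X * \<xi>)) \<cdot>\<^sub>m (\<phi> (- tr (X * f \<mu>)) \<cdot>\<^sub>m \<rho> (K 0 (f \<mu>))) = (\<phi> (- tr (X * \<mu>)) \<cdot>\<^sub>m \<rho> (K 0 \<mu>)) * \<rho> (K 0 \<xi>)"
      using \<mu> \<xi> N_M[OF \<mu>] by (simp add: smult_smult_mat mult_smult_assoc_mat[of _ d d _ d] flip: Kf \<rho>_mult)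
  qed
  also have "\<dots> = A * \<rho> (K 0 \<xi>)" unfolding A_def using \<xi> by (intro msum_mult[symmetric]) auto
  finally show ?thesis by (simp add: K\<xi> t)
qed

lemma A_E0: "A * E0 = of_nat (card N) \<cdot>\<^sub>m (A * Q X)"
proof -
  have "A * E0 = msum d (\<lambda>i. A * (\<phi> (- wt i) \<cdot>\<^sub>m \<rho> (b i))) I"
    unfolding E0_def by (rule mult_msum) auto
  also have "\<dots> = msum d (\<lambda>\<nu>. msum d (\<lambda>y. A * (\<phi> (- wt (\<nu>, y)) \<cdot>\<^sub>m \<rho> (b (\<nu>, y)))) M) N"
    by (rule msum_Times)
  also have "\<dots> = msum d (\<lambda>\<nu>. msum d (\<lambda>y. A * (\<phi> (- (pw ^ m * tr (X * y))) \<cdot>\<^sub>m \<rho> (K m y))) M) N"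
  proof (intro msum_cong)
    fix \<nu> y assume \<nu>: "\<nu> \<in> N" and y: "y \<in> M"
    note \<nu>M = N_M[OF \<nu>]
    have "b (\<nu>, y) = K r \<nu> * K m y"
      using \<nu>M y by (simp add: b_def K_def mat_simps zero_smult_mat[of _ n n])
    then have "A * \<rho> (b (\<nu>, y)) = (A * \<rho> (K r \<nu>)) * \<rho> (K m y)"
      using \<nu> \<nu>M y by (simp add: \<rho>_mult rep_simps)
    also have "\<dots> = \<phi> (pw ^ r * tr (X * \<nu>)) \<cdot>\<^sub>m (A * \<rho> (K m y))" using y by (simp add: A_right[OF \<nu>] rep_simps)
    finally have 1: "A * \<rho> (b (\<nu>, y)) = \<phi> (pw ^ r * tr (X * \<nu>)) \<cdot>\<^sub>m (A * \<rho> (K m y))" .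
    have "\<phi> (- wt (\<nu>, y)) * \<phi> (pw ^ r * tr (X * \<nu>)) = \<phi> (- (pw ^ m * tr (X * y)))"
      by (simp add: wt_def flip: \<phi>_add)
    then show "A * (\<phi> (- wt (\<nu>, y)) \<cdot>\<^sub>m \<rho> (b (\<nu>, y))) = A * (\<phi> (- (pw ^ m * tr (X * y))) \<cdot>\<^sub>m \<rho> (K m y))"
      using \<nu> y b_GL[of "(\<nu>, y)"] by (simp add: mult_smult_distrib[of _ d d _ d] 1 smult_smult_mat)
  qed
  also have "\<dots> = msum d (\<lambda>\<nu>. 1 \<cdot>\<^sub>m (A * Q X)) N"
    unfolding Q_def by (intro msum_cong, subst mult_msum) auto
  also have "\<dots> = (\<Sum>\<nu>\<in>N. 1) \<cdot>\<^sub>m (A * Q X)" by (rule msum_const_dir) auto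
  finally show ?thesis by simp
qed

lemma card_N_pos: "card N > 0"
  using strict_upper_zero[of n] by (subst card_gt_0_iff) auto

text \<open>In \<open>Q X * A * E0\<close> only those \<open>\<nu>\<close> survive for which \<open>1 + \<nu>\<close> commutes with \<open>X\<close> modulo \<open>p\<^sup>r\<close>, that is
  \<open>p\<^sup>m \<nu> = 0\<close>, and on \<open>E0\<close> all of these act through the character.\<close>

lemma A_nonzero: "A \<noteq> 0\<^sub>m d d"
proof
  assume A0: "A = 0\<^sub>m d d"
  let ?c = "of_nat (card M) :: complex"
  have cM: "?c \<noteq> 0" using card_M_pos by (metis less_irrefl of_nat_eq_0_iff)
  have trm: "(Q X * (\<phi> (- tr (X * \<nu>)) \<cdot>\<^sub>m \<rho> (K 0 \<nu>))) * E0 = (if pw ^ m \<cdot>\<^sub>m \<nu> = 0\<^sub>m n n then ?c else 0) \<cdot>\<^sub>m E0"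
    if \<nu>: "\<nu> \<in> N" for \<nu>
  proof (cases "pw ^ m \<cdot>\<^sub>m \<nu> = 0\<^sub>m n n")
    case True
    note \<nu>M = N_M[OF \<nu>]
    obtain \<mu> where \<mu>: "\<mu> \<in> M" "\<nu> = pw ^ (l - m) \<cdot>\<^sub>m \<mu>" "\<forall>i<n. \<forall>j<n. \<nu> $$ (i, j) = 0 \<longrightarrow> \<mu> $$ (i, j) = 0"
      using pw_smult_eq_0D[OF \<nu>M True] r_m by blast
    have lm: "l - m = r" using r_m by simp
    have \<mu>N: "\<mu> \<in> N" using \<mu>(1,3) strict_upperD(2)[OF \<nu>] by (auto simp: strict_upper_def)
    have K: "K 0 \<nu> = K r \<mu>" by (simp add: K_def \<mu>(2) lm)
    have t: "tr (X * \<nu>) = pw ^ r * tr (X * \<mu>)" using \<mu>(1) by (simp add: \<mu>(2) lm mat_simps trace_simps)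
    have "\<rho> (K 0 \<nu>) * E0 = \<phi> (tr (X * \<nu>)) \<cdot>\<^sub>m E0"
      using E0_left[of "(\<mu>, 0\<^sub>m n n)"] \<mu>N by (simp add: K t b_K wt_K)
    then have "(Q X * (\<phi> (- tr (X * \<nu>)) \<cdot>\<^sub>m \<rho> (K 0 \<nu>))) * E0 = Q X * E0"
      using \<nu> by (simp add: rep_simps \<phi>_minus)
    then show ?thesis using True by (simp add: Q_E0)
  next
    case False
    note \<nu>M = N_M[OF \<nu>]
    have g: "K 0 \<nu> \<in> GL n" using \<nu> by simp
    have "Q X * \<rho> (K 0 \<nu>) * Q X = 0\<^sub>m d d"
    proof (rule ccontr)
      assume "\<not> ?thesis"
      then have "pw ^ m \<cdot>\<^sub>m (K 0 \<nu> * X - X * K 0 \<nu>) = 0\<^sub>m n n" by (intro Q_sandwich g) auto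
      moreover have "K 0 \<nu> * X - X * K 0 \<nu> = \<nu> * X - X * \<nu>"
        using \<nu>M by (simp add: K_def mat_simps)
          (auto simp: algebra_simps simp del: index_mult_mat(1) intro!: eq_matI)
      ultimately have "pw ^ m \<cdot>\<^sub>m \<nu> = 0\<^sub>m n n"
        using strict_upperD(2)[OF \<nu>] by (intro smult_eq_0_if_commuting[OF companion \<nu>M]) auto
      then show False using False by simp
    qed
    then have "0\<^sub>m d d = (Q X * \<rho> (K 0 \<nu>) * Q X) * E0" by simp
    also have "\<dots> = ?c \<cdot>\<^sub>m (Q X * \<rho> (K 0 \<nu>) * E0)" using g by (simp add: rep_simps Q_E0)
    finally have "?c \<cdot>\<^sub>m (Q X * \<rho> (K 0 \<nu>) * E0) = 0 \<cdot>\<^sub>m (Q X * \<rho> (K 0 \<nu>) * E0)"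
      using g by (simp add: zero_smult_mat[of _ d d])
    then have "Q X * \<rho> (K 0 \<nu>) * E0 = 0\<^sub>m d d"
      using smult_mat_cancel[of "Q X * \<rho> (K 0 \<nu>) * E0" d d ?c 0] g cM by fastforce
    then show ?thesis using False g by (simp add: rep_simps zero_smult_mat[of _ d d])
  qed
  have "0 \<cdot>\<^sub>m E0 = (Q X * A) * E0" unfolding A0 by (simp add: zero_smult_mat[of _ d d])
  also have "Q X * A = msum d (\<lambda>\<nu>. Q X * (\<phi> (- tr (X * \<nu>)) \<cdot>\<^sub>m \<rho> (K 0 \<nu>))) N"
    unfolding A_def by (rule mult_msum) auto
  also have "\<dots> * E0 = msum d (\<lambda>\<nu>. (Q X * (\<phi> (- tr (X * \<nu>)) \<cdot>\<^sub>m \<rho> (K 0 \<nu>))) * E0) N"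
    by (rule msum_mult) auto
  also have "\<dots> = (\<Sum>\<nu>\<in>N. if pw ^ m \<cdot>\<^sub>m \<nu> = 0\<^sub>m n n then ?c else 0) \<cdot>\<^sub>m E0"
    by (rule msum_const_dir) (auto simp: trm)
  also have "(\<Sum>\<nu>\<in>N. if pw ^ m \<cdot>\<^sub>m \<nu> = 0\<^sub>m n n then ?c else 0) = of_nat (card {\<nu> \<in> N. pw ^ m \<cdot>\<^sub>m \<nu> = 0\<^sub>m n n} * card M)"
    by (simp flip: sum.inter_filter)
  finally have 0: "0 = (of_nat (card {\<nu> \<in> N. pw ^ m \<cdot>\<^sub>m \<nu> = 0\<^sub>m n n} * card M) :: complex)"
    by (rule smult_mat_cancel[OF E0_carrier _ E0_nonzero])
  have "0\<^sub>m n n \<in> {\<nu> \<in> N. pw ^ m \<cdot>\<^sub>m \<nu> = 0\<^sub>m n n}" using strict_upper_zero[of n] by simp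
  moreover have "finite {\<nu> \<in> N. pw ^ m \<cdot>\<^sub>m \<nu> = 0\<^sub>m n n}" by simp
  ultimately have "card {\<nu> \<in> N. pw ^ m \<cdot>\<^sub>m \<nu> = 0\<^sub>m n n} > 0" unfolding card_gt_0_iff by blast
  then have "card {\<nu> \<in> N. pw ^ m \<cdot>\<^sub>m \<nu> = 0\<^sub>m n n} * card M > 0" using card_M_pos by (rule mult_pos_pos)
  then show False using 0 by (metis less_irrefl of_nat_eq_0_iff)
qed

lemma A_Q:
  assumes Y: "Y \<in> M"
  shows "\<exists>k. \<exists>g\<in>GL n. A * Q Y = k \<cdot>\<^sub>m (A * E0 * \<rho> g)"
proof (cases "A * Q Y = 0\<^sub>m d d")
  case True
  then show ?thesis using GL_one[of n]
    by (intro exI[of _ 0] bexI[of _ "1\<^sub>m n"]) (auto simp: zero_smult_mat[of _ d d])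
next
  case nz: False
  have low: "pw ^ m * (Y - X) $$ (i, j) = 0" if ij: "i < n" "j < i" for i j
  proof (rule lower_entries_eq_0[OF _ _ ij])
    fix \<nu> assume \<nu>: "\<nu> \<in> N"
    note \<nu>M = N_M[OF \<nu>]
    have "\<phi> (pw ^ m * tr (Y * \<nu>)) \<cdot>\<^sub>m (A * Q Y) = A * (\<rho> (K m \<nu>) * Q Y)"
      using \<nu> \<nu>M Y by (simp add: Q_left rep_simps)
    also have "\<dots> = (A * \<rho> (K m \<nu>)) * Q Y" using \<nu> by (intro assoc_mult_mat[symmetric]) auto
    also have "\<dots> = \<phi> (pw ^ m * tr (X * \<nu>)) \<cdot>\<^sub>m (A * Q Y)" using \<nu> by (simp add: A_right rep_simps)
    finally have "\<phi> (pw ^ m * tr (Y * \<nu>)) = \<phi> (pw ^ m * tr (X * \<nu>))"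
      by (rule smult_mat_cancel[of _ d d, rotated]) (use nz in auto)
    then show "\<phi> (pw ^ m * tr ((Y - X) * \<nu>)) = 1"
      unfolding \<phi>_eq_iff using Y \<nu>M by (simp add: mat_simps trace_simps right_diff_distrib)
  qed (use Y in simp)
  define Y' where "Y' = mat n n (\<lambda>(i, j). if j < i then X $$ (i, j) else Y $$ (i, j))"
  have Y': "Y' \<in> M" by (simp add: Y'_def)
  have "pw ^ m \<cdot>\<^sub>m (Y - Y') = 0\<^sub>m n n"
  proof (rule eq_matI, goal_cases)
    case (1 i j)
    then show ?case using low[of i j] Y by (cases "j < i") (auto simp: Y'_def)
  qed (auto simp: Y'_def)
  then have QY': "Q Y = Q Y'" by (rule Q_cong[OF Y Y'])
  have "Y' $$ (i, j) = (if i = Suc j then 1 else 0)" if "i < n" "j < i" for i j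
    using that companionD(2)[OF companion, of i j] by (simp add: Y'_def)
  from hessenberg_similar_companion[OF Y' this]
  obtain \<nu> X' where \<nu>: "\<nu> \<in> N" and X': "companion n X'" and sim: "Y' * (1\<^sub>m n + \<nu>) = (1\<^sub>m n + \<nu>) * X'" by blast
  have X'M: "X' \<in> M" by (rule companionD(1)[OF X'])
  define u where "u = K 0 \<nu>"
  have u: "u \<in> GL n" "u \<in> M" using \<nu> N_M by (auto simp: u_def)
  have sim: "Y' * u = u * X'" using sim by (simp add: u_def K_def)
  obtain u' where u': "u' \<in> GL n" "u' * u = 1\<^sub>m n" "u * u' = 1\<^sub>m n" using GL_inverse[OF u(1)] by blast
  have u'M: "u' \<in> M" using u' GL_carrier by auto
  have "u * X' * u' = Y' * (u * u')" unfolding sim[symmetric] using u u'M Y' by (intro assoc_mult_mat) auto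
  then have "u * X' * u' = Y'" using Y' by (simp add: u')
  then have conj: "\<rho> u * Q X' = Q Y' * \<rho> u" using Q_conj[OF u(1) u' X'M] by simp
  have QY'2: "Q Y' = \<rho> u * Q X' * \<rho> u'"
  proof -
    have "\<rho> u * Q X' * \<rho> u' = Q Y' * (\<rho> u * \<rho> u')" unfolding conj using u u' by (intro assoc_mult_mat) auto
    also have "\<rho> u * \<rho> u' = 1\<^sub>m d" using u u' \<rho>_one by (simp flip: \<rho>_mult)
    finally show ?thesis by simp
  qed
  have "Q X' \<noteq> 0\<^sub>m d d"
  proof
    assume "Q X' = 0\<^sub>m d d"
    then have "A * Q Y = 0\<^sub>m d d" using u u' by (simp add: QY' QY'2)
    then show False using nz by simp
  qed
  then obtain g where g: "g \<in> GL n" "Q X' * \<rho> g * Q X \<noteq> 0\<^sub>m d d"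
    using irreducible_rep_sandwich[OF irr GL_mult GL_one Q_carrier Q_X_nonzero Q_carrier] by blast
  obtain g' where g': "g' \<in> GL n" "g' * g = 1\<^sub>m n" using GL_inverse[OF g(1)] by blast
  have "pw ^ m \<cdot>\<^sub>m (X - X') = 0\<^sub>m n n"
    by (rule similar_companion_eq[OF companion X' GL_carrier[OF g(1)] GL_carrier[OF g'(1)] g'(2)
        Q_sandwich[OF g(1) X_carrier X'M g(2)]])
  then have QX': "Q X' = Q X" using Q_cong[OF X_carrier X'M] by simp
  let ?k = "\<phi> (pw ^ 0 * tr (X * \<nu>))"
  have "A * Q Y = (A * \<rho> u) * (Q X * \<rho> u')"
    unfolding QY' QY'2 QX' using u u' by (simp add: rep_simps)
  also have "A * \<rho> u = ?k \<cdot>\<^sub>m A" unfolding u_def by (rule A_right[OF \<nu>])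
  also have "(?k \<cdot>\<^sub>m A) * (Q X * \<rho> u') = ?k \<cdot>\<^sub>m ((A * Q X) * \<rho> u')" using u' by (simp add: rep_simps)
  also have "A * Q X = (1 / of_nat (card N)) \<cdot>\<^sub>m (A * E0)"
  proof -
    have "of_nat (card N) \<noteq> (0 :: complex)" using card_N_pos by (metis less_irrefl of_nat_eq_0_iff)
    then have "1 / of_nat (card N) * of_nat (card N) = (1 :: complex)" by (rule nonzero_eq_divide_eq[THEN iffD1]) (rule refl)
    then show ?thesis by (simp only: A_E0 smult_smult_mat one_smult_mat)
  qed
  also have "?k \<cdot>\<^sub>m ((1 / of_nat (card N)) \<cdot>\<^sub>m (A * E0) * \<rho> u') = (?k * (1 / of_nat (card N))) \<cdot>\<^sub>m (A * E0 * \<rho> u')"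
    using u' by (simp add: mult_smult_assoc_mat[of _ d d _ d] smult_smult_mat)
  finally show ?thesis using u'(1) by blast
qed

lemma A_rank_le_1: "\<exists>w\<in>carrier_vec d. \<forall>v\<in>carrier_vec d. \<exists>k. A *\<^sub>v v = k \<cdot>\<^sub>v w"
proof -
  obtain w where w: "w \<in> carrier_vec d" "\<And>v. v \<in> carrier_vec d \<Longrightarrow> \<exists>k. E0 *\<^sub>v v = k \<cdot>\<^sub>v w"
    using E0_rank_le_1 by blast
  have Aw: "A *\<^sub>v w \<in> carrier_vec d" by simp
  obtain c where c: "c \<noteq> 0" "msum d Q M = c \<cdot>\<^sub>m 1\<^sub>m d" using sum_Q by blast
  have "\<exists>k. A *\<^sub>v v = k \<cdot>\<^sub>v (A *\<^sub>v w)" if v: "v \<in> carrier_vec d" for v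
  proof -
    have "\<exists>k. (A * Q Y) *\<^sub>v v = k \<cdot>\<^sub>v (A *\<^sub>v w)" if Y: "Y \<in> M" for Y
    proof -
      obtain k g where g: "g \<in> GL n" and eq: "A * Q Y = k \<cdot>\<^sub>m (A * E0 * \<rho> g)" using A_Q[OF Y] by blast
      have gv: "\<rho> g *\<^sub>v v \<in> carrier_vec d" using g by simp
      obtain k' where k': "E0 *\<^sub>v (\<rho> g *\<^sub>v v) = k' \<cdot>\<^sub>v w" using w(2)[OF gv] by blast
      have "(A * Q Y) *\<^sub>v v = k \<cdot>\<^sub>v (A *\<^sub>v (E0 *\<^sub>v (\<rho> g *\<^sub>v v)))"
        unfolding eq using g v by (simp add: smult_mat_mult_vec[of _ d d] assoc_mult_mat_vec[of _ d d _ d])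
      also have "\<dots> = k \<cdot>\<^sub>v (k' \<cdot>\<^sub>v (A *\<^sub>v w))" unfolding k' using w(1) by (simp add: mult_mat_vec_smult[of _ d d])
      finally show ?thesis by (auto simp: smult_smult_assoc)
    qed
    then obtain k where k: "\<And>Y. Y \<in> M \<Longrightarrow> (A * Q Y) *\<^sub>v v = k Y \<cdot>\<^sub>v (A *\<^sub>v w)" by metis
    have "c \<cdot>\<^sub>m A = A * msum d Q M" by (simp add: c rep_simps)
    also have "\<dots> = msum d (\<lambda>Y. A * Q Y) M" by (rule mult_msum) auto
    finally have "c \<cdot>\<^sub>v (A *\<^sub>v v) = msum d (\<lambda>Y. A * Q Y) M *\<^sub>v v"
      using v by (simp flip: smult_mat_mult_vec[of _ d d])
    also have "\<dots> = (\<Sum>Y\<in>M. k Y) \<cdot>\<^sub>v (A *\<^sub>v w)"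
      by (rule msum_mult_vec_line[OF v Aw]) (use k in auto)
    finally have "(1 / c) \<cdot>\<^sub>v (c \<cdot>\<^sub>v (A *\<^sub>v v)) = (1 / c) \<cdot>\<^sub>v ((\<Sum>Y\<in>M. k Y) \<cdot>\<^sub>v (A *\<^sub>v w))" by simp
    then show ?thesis using c(1) by (auto simp: smult_smult_assoc)
  qed
  then show ?thesis using Aw by blast
qed

lemma multiplicity_free_SL: "multiplicity_free_restriction (SL n) n \<rho> d"
proof -
  obtain w where w: "w \<in> carrier_vec d" "\<And>v. v \<in> carrier_vec d \<Longrightarrow> \<exists>k. A *\<^sub>v v = k \<cdot>\<^sub>v w"
    using A_rank_le_1 by blast
  show ?thesis
  proof (rule multiplicity_free_if_rank_1[OF irr GL_mult GL_one _ SL_subset_GL _ A_def _ A_nonzero w])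
    show "GL n \<subseteq> M" using GL_carrier by auto
    show "\<exists>g'\<in>GL n. g' * g = 1\<^sub>m n \<and> g * g' = 1\<^sub>m n \<and> (\<forall>h\<in>SL n. g' * h * g \<in> SL n)" if "g \<in> GL n" for g
      using GL_inverse[OF that] SL_normal[OF _ that] by blast
    show "K 0 \<nu> \<in> SL n" if "\<nu> \<in> N" for \<nu> by (rule K_N_SL[OF that])
  qed
qed

end

subsection \<open>Regular representations\<close>

context residue_rep
begin

lemma cyclic_conjugate:
  assumes Y: "Y \<in> M" and reg: "regular_mat (map_mat \<pi> Y)"
  shows "\<exists>P\<in>GL n. \<exists>P'\<in>GL n. P' * P = 1\<^sub>m n \<and> P * P' = 1\<^sub>m n \<and> companion n (P' * (Y * P))"
proof -
  interpret \<pi>: comm_ring_hom \<pi>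
    using residue by unfold_locales (auto simp: residue_map_def)
  have Yc: "map_mat \<pi> Y \<in> carrier_mat n n" using Y by simp
  obtain w where w: "w \<in> carrier_vec n" "det (mat n n (\<lambda>(i, j). (map_mat \<pi> Y ^\<^sub>m j *\<^sub>v w) $ i)) \<noteq> 0"
    using ex_cyclic_vector[OF Yc reg] by blast
  define v where "v = vec n (\<lambda>i. inv_into UNIV \<pi> (w $ i))"
  have v: "v \<in> carrier_vec n" by (simp add: v_def)
  have "surj \<pi>" using residue by (simp add: residue_map_def)
  then have vw: "map_vec \<pi> v = w" using w(1) by (intro eq_vecI) (auto simp: v_def f_inv_into_f)
  define P where "P = mat n n (\<lambda>(i, j). (Y ^\<^sub>m j *\<^sub>v v) $ i)"
  have P: "P \<in> M" by (simp add: P_def)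
  have pow: "map_mat \<pi> (Y ^\<^sub>m j) = map_mat \<pi> Y ^\<^sub>m j" for j
  proof (induction j)
    case (Suc j)
    then show ?case using Y by (simp add: \<pi>.mat_hom_mult[of _ n n _ n])
  qed (use Y in \<open>simp add: \<pi>.mat_hom_one\<close>)
  have "map_mat \<pi> P = mat n n (\<lambda>(i, j). (map_mat \<pi> Y ^\<^sub>m j *\<^sub>v w) $ i)"
  proof (rule eq_matI, goal_cases)
    case (1 i j)
    then have ij: "i < n" "j < n" by simp_all
    have "map_mat \<pi> P $$ (i, j) = map_vec \<pi> (Y ^\<^sub>m j *\<^sub>v v) $ i"
      using ij Y by (simp add: P_def del: index_mult_mat_vec)
    also have "map_vec \<pi> (Y ^\<^sub>m j *\<^sub>v v) = map_mat \<pi> Y ^\<^sub>m j *\<^sub>v w"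
      by (simp only: \<pi>.mult_mat_vec_hom[OF pow_carrier_mat[OF Y] v] pow vw)
    finally show ?case using ij by simp
  qed (simp_all add: P_def)
  then have "P \<in> GL n" using w(2) P by (simp add: GL_iff_residue)
  then obtain P' where P': "P' \<in> GL n" "P' * P = 1\<^sub>m n" "P * P' = 1\<^sub>m n" using GL_inverse by blast
  have "companion n (P' * (Y * P))"
    by (rule companion_conjugate[OF Y P GL_carrier[OF P'(1)] P'(2) krylov_shift[OF Y v _ _ P_def]])
  then show ?thesis using \<open>P \<in> GL n\<close> P' by blast
qed

lemma regular_imp_companion:
  assumes xh: "xh \<in> M" and reg: "regular_mat (map_mat \<pi> xh)" and cont: "contains_phi_x pw l \<phi> n \<rho> d xh"
  shows "\<exists>X. companion n X \<and> Q X \<noteq> 0\<^sub>m d d"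
proof -
  obtain v where v: "v \<in> carrier_vec d" "v \<noteq> 0\<^sub>v d"
      "\<And>y. y \<in> M \<Longrightarrow> \<rho> (K (l - 1) y) *\<^sub>v v = \<phi> (pw ^ (l - 1) * tr (xh * y)) \<cdot>\<^sub>v v"
    using cont unfolding contains_phi_x_def K_def by blast
  define D where "D = mat d d (\<lambda>(i, j). v $ i)"
  have D: "D \<in> carrier_mat d d" by (simp add: D_def)
  have colD: "col D j = v" if "j < d" for j using that v(1) by (auto simp: D_def)
  have D0: "D \<noteq> 0\<^sub>m d d"
  proof
    assume "D = 0\<^sub>m d d"
    have "d > 0" using v(1,2) by (metis carrier_vecD gr0I vec_of_dim_0)
    then have "v = col (0\<^sub>m d d) 0" using colD[of 0] \<open>D = 0\<^sub>m d d\<close> by simp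
    then show False using v(2) \<open>d > 0\<close> by simp
  qed
  have l1: "l - 1 \<ge> 1" using l2 by simp
  have eigD: "\<rho> (K (l - 1) y) * D = \<phi> (pw ^ (l - 1) * tr (xh * y)) \<cdot>\<^sub>m D" if y: "y \<in> M" for y
  proof (rule eq_matI, goal_cases)
    case (1 i j)
    then have ij: "i < d" "j < d" using D by simp_all
    have g: "K (l - 1) y \<in> GL n" using y l1 by simp
    have "(\<rho> (K (l - 1) y) * D) $$ (i, j) = (\<rho> (K (l - 1) y) *\<^sub>v v) $ i"
      using ij g D by (simp add: colD)
    also have "\<dots> = \<phi> (pw ^ (l - 1) * tr (xh * y)) * v $ i" using v(1,3) y ij by simp
    finally show ?case using ij by (simp add: D_def)
  qed (use D y l1 in simp_all)
  obtain Y where Y: "Y \<in> M" "Q Y * D \<noteq> 0\<^sub>m d d" using ex_Q_mult_nonzero[OF D D0] by blast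
  have QD: "Q Y * D \<in> carrier_mat d d" using D by simp
  have "pw ^ (l - 1) \<cdot>\<^sub>m (Y - xh) = 0\<^sub>m n n"
  proof (rule character_unique[OF Y(1) xh QD Y(2)])
    fix y assume y: "y \<in> M"
    define z where "z = pw ^ (l - 1 - m) \<cdot>\<^sub>m y"
    have z: "z \<in> M" using y by (simp add: z_def)
    have pm: "pw ^ m * pw ^ (l - 1 - m) = pw ^ (l - 1)"
      using r_m(8) by (simp only: power_add[symmetric] le_add_diff_inverse)
    have Kz: "K (l - 1) y = K m z" unfolding K_def z_def smult_smult_mat pm ..
    have t: "pw ^ m * tr (Y * z) = pw ^ (l - 1) * tr (Y * y)"
      using y Y by (simp add: z_def mult_smult_distrib[of _ n n _ n] mat_trace_smult[of _ n] pm[simplified] flip: mult.assoc)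
    have "\<phi> (pw ^ (l - 1) * tr (Y * y)) \<cdot>\<^sub>m (Q Y * D) = (\<rho> (K m z) * Q Y) * D"
      using Y z D by (simp add: Q_left t mult_smult_assoc_mat[of _ d d _ d])
    also have "\<dots> = Q Y * (\<rho> (K m z) * D)"
      unfolding Q_K_comm[OF z] using z D by (intro assoc_mult_mat) auto
    also have "\<dots> = \<phi> (pw ^ (l - 1) * tr (xh * y)) \<cdot>\<^sub>m (Q Y * D)"
      unfolding eigD[OF y, unfolded Kz] by (rule mult_smult_distrib[OF Q_carrier D])
    finally show "\<phi> (pw ^ (l - 1) * tr (Y * y)) \<cdot>\<^sub>m (Q Y * D) = \<phi> (pw ^ (l - 1) * tr (xh * y)) \<cdot>\<^sub>m (Q Y * D)" .
  qed
  then obtain y where y: "y \<in> M" "Y - xh = pw ^ (l - (l - 1)) \<cdot>\<^sub>m y"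
    using pw_smult_eq_0D[of "Y - xh" n n "l - 1"] xh by auto
  have "map_mat \<pi> Y = map_mat \<pi> xh"
  proof (rule eq_matI, goal_cases)
    case (1 i j)
    then have ij: "i < n" "j < n" using xh by simp_all
    have "l - (l - 1) = 1" using l2 by simp
    then have "(Y - xh) $$ (i, j) = pw * y $$ (i, j)" using y ij by simp
    then have "Y $$ (i, j) = xh $$ (i, j) + pw * y $$ (i, j)" using ij Y xh by (simp add: algebra_simps)
    moreover have "\<pi> (pw * y $$ (i, j)) = 0" using residue by (auto simp: residue_map_def)
    ultimately have "\<pi> (Y $$ (i, j)) = \<pi> (xh $$ (i, j))" using residue by (simp add: residue_map_def)
    then show ?case using ij Y xh by simp
  qed (use Y xh in auto)
  then obtain P P' where P: "P \<in> GL n" "P' \<in> GL n" "P' * P = 1\<^sub>m n" "P * P' = 1\<^sub>m n" and X: "companion n (P' * (Y * P))"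
    using cyclic_conjugate[OF Y(1)] reg by auto
  have PM: "P \<in> M" "P' \<in> M" using P GL_carrier by auto
  have "P' * Y * P = P' * (Y * P)" using PM Y by (intro assoc_mult_mat) auto
  then have conj: "\<rho> P' * Q Y = Q (P' * (Y * P)) * \<rho> P'" using Q_conj[OF P(2,1,4,3) Y(1)] by simp
  have "Q (P' * (Y * P)) \<noteq> 0\<^sub>m d d"
  proof
    assume "Q (P' * (Y * P)) = 0\<^sub>m d d"
    then have "\<rho> P' * Q Y = 0\<^sub>m d d" using conj P by simp
    then have "\<rho> P * (\<rho> P' * Q Y) = 0\<^sub>m d d" using P by simp
    moreover have "\<rho> P * (\<rho> P' * Q Y) = (\<rho> P * \<rho> P') * Q Y" using P by (intro assoc_mult_mat[symmetric]) auto
    moreover have "\<rho> P * \<rho> P' = 1\<^sub>m d" using P \<rho>_one by (simp flip: \<rho>_mult)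
    ultimately have "Q Y = 0\<^sub>m d d" by simp
    then show False using Y(2) D by simp
  qed
  then show ?thesis using X by blast
qed

end

lemma multiplicity_free_dim_0:
  fixes \<rho> :: "'r :: comm_ring_1 mat \<Rightarrow> complex mat"
  assumes irr: "irreducible_rep (GL 0) 0 \<rho> d"
  shows "multiplicity_free_restriction (SL 0) 0 \<rho> d"
proof -
  note rep = irreducible_repD[OF irr]
  have all: "g = 1\<^sub>m 0" if "g \<in> GL 0" for g :: "'r mat" using GL_carrier[OF that] by (intro eq_matI) auto
  define Z where "Z = {u :: complex vec. \<exists>k. u = k \<cdot>\<^sub>v unit_vec d 0}"
  have line: "1\<^sub>m d *\<^sub>v (\<rho> (1\<^sub>m 0) *\<^sub>v v) \<in> Z" if v: "v \<in> carrier_vec d" for v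
  proof (rule irreducible_rep_dichotomy[OF irr GL_mult one_carrier_mat _ _ _ unit_vec_carrier unit_vec_nonzero[OF rep(4)] _ v GL_one])
    have "0\<^sub>v d = (0 :: complex) \<cdot>\<^sub>v unit_vec d 0" by (intro eq_vecI) auto
    then show "0\<^sub>v d \<in> Z" by (auto simp: Z_def)
    show "u + v \<in> Z" if "u \<in> Z" "v \<in> Z" for u v
      using that by (auto simp: Z_def simp flip: add_smult_distrib_vec)
    show "c \<cdot>\<^sub>v v \<in> Z" if "v \<in> Z" for c v
      using that by (auto simp: Z_def smult_smult_assoc)
    show "1\<^sub>m d *\<^sub>v (\<rho> h *\<^sub>v unit_vec d 0) \<in> Z" if "h \<in> GL 0" for h
    proof -
      have "1\<^sub>m d *\<^sub>v (\<rho> h *\<^sub>v unit_vec d 0) = 1 \<cdot>\<^sub>v unit_vec d 0" by (simp add: all[OF that] rep(2))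
      then show ?thesis unfolding Z_def by blast
    qed
  qed
  have A: "1\<^sub>m d = msum d (\<lambda>x. 1 \<cdot>\<^sub>m \<rho> (1\<^sub>m 0)) {()}" by (rule eq_matI) (auto simp: rep(2))
  have "(1\<^sub>m d :: complex mat) $$ (0, 0) \<noteq> 0\<^sub>m d d $$ (0, 0)" using rep(4) by simp
  then have nz: "(1\<^sub>m d :: complex mat) \<noteq> 0\<^sub>m d d" by metis
  show ?thesis
  proof (rule multiplicity_free_if_rank_1[OF irr GL_mult GL_one _ SL_subset_GL _ A _ nz unit_vec_carrier])
    show "GL 0 \<subseteq> carrier_mat 0 0" using GL_carrier by auto
    show "\<exists>g'\<in>GL 0. g' * g = 1\<^sub>m 0 \<and> g * g' = 1\<^sub>m 0 \<and> (\<forall>h\<in>SL 0. g' * h * g \<in> SL 0)"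
      if "g \<in> GL 0" for g :: "'r mat"
      using GL_inverse[OF that] SL_normal[OF _ that] by blast
    show "1\<^sub>m 0 \<in> SL 0" by (simp add: SL_def)
    show "\<exists>k. 1\<^sub>m d *\<^sub>v v = k \<cdot>\<^sub>v unit_vec d 0" if "v \<in> carrier_vec d" for v :: "complex vec"
      using line[OF that] that rep(2) by (auto simp: Z_def)
  qed
qed

theorem theorem1p4:
  fixes pw :: "'r::comm_ring_1" and \<pi> :: "'r \<Rightarrow> 'k::field" and \<phi> :: "'r \<Rightarrow> complex"
    and l n d :: nat and \<rho> :: "'r mat \<Rightarrow> complex mat"
  assumes "trunc_dvr pw l"
    and "residue_map pw \<pi>"
    and "add_char \<phi>"
    and "\<exists>a. \<phi> (pw ^ (l - 1) * a) \<noteq> 1"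
    and "l \<ge> 2"
    and "regular_rep pw l \<pi> \<phi> n \<rho> d"
  shows "multiplicity_free_restriction (SL n) n \<rho> d"
proof (cases "n = 0")
  case True
  then show ?thesis using assms(6) multiplicity_free_dim_0 by (auto simp: regular_rep_def)
next
  case False
  obtain xh where irr: "irreducible_rep (GL n) n \<rho> d" and xh: "xh \<in> carrier_mat n n"
      "regular_mat (map_mat \<pi> xh)" "contains_phi_x pw l \<phi> n \<rho> d xh"
    using assms(6) by (auto simp: regular_rep_def)
  interpret residue_rep pw l \<phi> \<pi> n d \<rho>
    using assms irr by unfold_locales auto
  obtain X where X: "companion n X" "Q X \<noteq> 0\<^sub>m d d"
    using regular_imp_companion[OF xh] by blast
  interpret companion_rep pw l \<phi> \<pi> n d \<rho> X
    using False X by unfold_locales auto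
  show ?thesis by (rule multiplicity_free_SL)
qed

end
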